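(* Let $A$ be a unital commutative associative algebra over $\mathbb{C}$ and let $B$ be a vertex $A$-algebroid. The group $\mathrm{Aut}^{o}(V_B)$ of grading-preserving automorphisms of the $\mathbb{N}$-graded vertex algebra $V_B$ is isomorphic to the group of automorphisms of the vertex $A$-algebroid $B$, with the restriction map $g\mapsto g|_{A\oplus B}$ (where $A\oplus B=(V_B)_{(0)}\oplus (V_B)_{(1)}$) as an isomorphism.
   Context: $\mathbb{N}=\{0,1,2,\dots\}$. Let $A$ be a unital commutative associative $\mathbb{C}$-algebra with identity $e$. A vertex $A$-algebroid is a $\mathbb{C}$-vector space $B$ with: a bilinear map $A\times B\to B$, $(a,v)\mapsto a*v$ (also written $av$), with $e*v=v$; a Leibniz algebra structure $[\cdot,\cdot]:B\otimes B\to B$; a homomorphism of Leibniz algebras $\pi:B\to \mathrm{Der}(A)$; a symmetric bilinear pairing $\langle\cdot,\cdot\rangle:B\otimes B\to A$; a linear map $\partial:A\to B$ with $\pi\circ\partial=0$; such that for $a,a'\in A$, $u,v,v_1,v_2\in B$: $a*(a'*v)-(aa')*v=\pi(v)(a)*\partial(a')+\pi(v)(a')*\partial(a)$; $[u,a*v]=\pi(u)(a)*v+a*[u,v]$; $[u,v]+[v,u]=\partial(\langle u,v\rangle)$; $\pi(a*v)=a\pi(v)$; $\langle a*u,v\rangle=a\langle u,v\rangle-\pi(u)(\pi(v)(a))$; $\pi(v)(\langle v_1,v_2\rangle)=\langle[v,v_1],v_2\rangle+\langle v_1,[v,v_2]\rangle$; $\partial(aa')=a*\partial(a')+a'*\partial(a)$;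 $[v,\partial(a)]=\partial(\pi(v)(a))$; $\langle v,\partial(a)\rangle=\pi(v)(a)$. On $C=A\oplus B$ write, for $a,a'\in A$, $u,v\in B$, $i=0,1$: $a_ia'=0$, $u_0v=[u,v]$, $u_1v=\langle u,v\rangle$, $u_0a=\pi(u)(a)$, $a_0u=-\pi(u)(a)$, and $a_1u=u_1a=0$. An automorphism of the vertex $A$-algebroid $B$ is a bijective linear map $f:A\oplus B\to A\oplus B$ with $f(A)\subset A$, $f(B)\subset B$ such that $f|_A$ is an associative algebra homomorphism, $f|_B$ is a Leibniz algebra homomorphism, $f(ab)=f(a)f(b)$ for $a\in A$, $b\in B$, $\langle f(u),f(v)\rangle=f(\langle u,v\rangle)$ for $u,v\in B$, $f\circ\partial=\partial\circ f$, and $f(b_0a)=f(b)_0f(a)$ for $a\in A$, $b\in B$. Construction of $V_B$. Let $L(A\oplus B)=(A\oplus B)\otimes\mathbb{C}[t,t^{-1}]$, $L(A)=A\otimes\mathbb{C}[t,t^{-1}]$, $\hat\partial=\partial\otimes1+1\otimes d/dt:L(A)\to L(A\oplus B)$. The quotient $\mathcal{L}=L(A\oplus B)/\hat\partial L(A)$ is a $\mathbb{Z}$-graded Lie algebra with bracket induced by $[a\otimes t^m,a'\otimes t^n]=0$, $[a\otimes t^m,b\otimes t^n]=a_0b\otimes t^{m+n}$, $[b\otimes t^n,a\otimes t^m]=b_0a\otimes t^{m+n}$, $[b\otimes t^m,b'\otimes t^n]=b_0b'\otimes t^{m+n}+m(b_1b')\otimes t^{m+n-1}$, and grading $\deg(a\otimes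 t^n)=-n-1$, $\deg(b\otimes t^n)=-n$. Write $u(n)$ for the image of $u\otimes t^n$. Let $\mathcal{L}^{\ge0}$ be the image of $(A\oplus B)\otimes\mathbb{C}[t]$ and $V_{\mathcal{L}}=U(\mathcal{L})\otimes_{U(\mathcal{L}^{\ge0})}\mathbb{C}$ with $\mathbb{C}$ trivial, of degree $0$; ${\bf 1}=1\otimes1$. $A\oplus B$ embeds in $V_{\mathcal{L}}$ by $u\mapsto u(-1){\bf 1}$, and $V_{\mathcal{L}}$ has a unique vertex algebra structure with vacuum ${\bf 1}$ and $Y(u,x)=\sum_{n\in\mathbb{Z}}u(n)x^{-n-1}$ for $u\in A\oplus B$; it is $\mathbb{N}$-graded with $A$ in degree $0$, $B$ in degree $1$. Put $E=\mathrm{span}\{e-{\bf 1},\,a(-1)a'-aa',\,a(-1)b-ab\mid a,a'\in A,\ b\in B\}\subset V_{\mathcal{L}}$ and $I_B=U(\mathcal{L})\mathbb{C}[\mathcal{D}]E$ where $\mathcal{D}v=v_{-2}{\bf 1}$; $I_B$ is a graded two-sided ideal and $V_B=V_{\mathcal{L}}/I_B$ is an $\mathbb{N}$-graded vertex algebra, with $(V_B)_{(0)}=A$, $(V_B)_{(1)}=B$, generated by $A\oplus B$. An automorphism of a vertex algebra $V$ is a bijective linear map $g$ with $g({\bf 1})={\bf 1}$ and $g(Y(u,x)v)=Y(g(u),x)g(v)$ for $u,v\in V$. *)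

theory Defs
  imports
    Complex_Main
    "HOL-Library.Poly_Mapping"
    "HOL-Library.Product_Plus"
    "HOL-Library.FuncSet"
    "HOL-Algebra.Group"
begin

section \<open>Quotients of vector spaces\<close>

text \<open>
  The quotient of a vector space by a subspace \<open>K\<close> is realised as the image of a chosen
  linear idempotent \<open>p\<close> with kernel \<open>K\<close>: then \<open>p\<close> is the quotient map, and \<open>p ` X\<close> is
  (canonically isomorphic to) \<open>X / K\<close> for every subspace \<open>X\<close> containing \<open>K\<close>.  Such a \<open>p\<close>
  exists for every subspace, see \<open>quot_map_props\<close>.  The advantage over cosets is that the
  quotient lives in the same type and inherits its addition.
\<close>

definition quot_map :: "(complex \<Rightarrow> 'v \<Rightarrow> 'v) \<Rightarrow> 'v::ab_group_add set \<Rightarrow> 'v \<Rightarrow> 'v" where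
  "quot_map s K = (SOME p. Vector_Spaces.linear s s p \<and> (\<forall>x. p (p x) = p x) \<and> {x. p x = 0} = K)"

lemma quot_map_props:
  assumes "vector_space s" and "module.subspace s K"
  shows "Vector_Spaces.linear s s (quot_map s K)"
    and "quot_map s K (quot_map s K x) = quot_map s K x"
    and "{x. quot_map s K x = 0} = K"
proof -
  interpret vector_space s by fact
  interpret vector_space_pair s s ..
  obtain g where g: "g ` UNIV \<subseteq> K" "Vector_Spaces.linear s s g" "\<forall>v\<in>K. g v = v"
    using linear_exists_left_inverse_on[OF linear_id assms(2)] by auto
  define p where "p = (\<lambda>x. x - g x)"
  have lin: "Vector_Spaces.linear s s p"
    unfolding p_def using linear_compose_sub[OF linear_ident g(2)] .
  have gg: "g (g x) = g x" for x
    using g by auto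
  have "p (p x) = p x" for x
    using gg linear_diff[OF g(2)] by (simp add: p_def)
  moreover have "{x. p x = 0} = K"
    using g by (auto simp: p_def)
  ultimately have "\<exists>p. Vector_Spaces.linear s s p \<and> (\<forall>x. p (p x) = p x) \<and> {x. p x = 0} = K"
    using lin by blast
  from someI_ex[OF this]
  show "Vector_Spaces.linear s s (quot_map s K)"
    and "quot_map s K (quot_map s K x) = quot_map s K x"
    and "{x. quot_map s K x = 0} = K"
    unfolding quot_map_def by blast+
qed

text \<open>
  Finitely supported functions serve both as \<open>V \<otimes> \<complex>[t, t\<inverse>]\<close> (index type \<^typ>\<open>int\<close>;
  \<open>v \<otimes> t\<^sup>n\<close> is \<open>Poly_Mapping.single n v\<close>) and as free complex vector spaces.
\<close>

definition pm_scale :: "(complex \<Rightarrow> 'v \<Rightarrow> 'v) \<Rightarrow> complex \<Rightarrow> ('k \<Rightarrow>\<^sub>0 'v::ab_group_add) \<Rightarrow> ('k \<Rightarrow>\<^sub>0 'v)" where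
  "pm_scale s c x = Poly_Mapping.map (s c) x"

lemma vector_space_pm_scale:
  assumes "vector_space s"
  shows "vector_space (pm_scale s)"
proof -
  interpret vector_space s by fact
  have lk: "Poly_Mapping.lookup (pm_scale s c x) k = s c (Poly_Mapping.lookup x k)" for c x k
    unfolding pm_scale_def by (simp add: map.rep_eq when_def)
  show ?thesis
    by unfold_locales
      (auto intro!: poly_mapping_eqI
        simp: lk lookup_add scale_right_distrib scale_left_distrib)
qed


section \<open>Universal enveloping algebras\<close>

text \<open>
  The free associative algebra on the letters \<open>'l\<close>: complex combinations of words, with
  concatenation as product.
\<close>

type_synonym 'l free_alg = "'l list \<Rightarrow>\<^sub>0 complex"

abbreviation fa_scale :: "complex \<Rightarrow> 'l free_alg \<Rightarrow> 'l free_alg" where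
  "fa_scale \<equiv> pm_scale (*)"

definition fa_word :: "'l list \<Rightarrow> 'l free_alg" where
  "fa_word w = Poly_Mapping.single w 1"

definition fa_mult :: "'l free_alg \<Rightarrow> 'l free_alg \<Rightarrow> 'l free_alg" where
  "fa_mult f g = (\<Sum>v\<in>Poly_Mapping.keys f. \<Sum>w\<in>Poly_Mapping.keys g.
     Poly_Mapping.single (v @ w) (Poly_Mapping.lookup f v * Poly_Mapping.lookup g w))"

text \<open>
  \<open>U(L)\<close> for a complex Lie algebra with carrier \<open>L\<close>, scalar multiplication \<open>s\<close> and bracket
  \<open>br\<close>: the free associative algebra on the set \<open>L\<close>, modulo the two-sided ideal which makes
  \<open>L \<rightarrow> U(L)\<close> linear (so that one gets the tensor algebra) and turns \<open>br\<close> into the commutator.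
\<close>

definition uea_rels ::
  "(complex \<Rightarrow> 'l \<Rightarrow> 'l) \<Rightarrow> 'l::ab_group_add set \<Rightarrow> ('l \<Rightarrow> 'l \<Rightarrow> 'l) \<Rightarrow> 'l free_alg set" where
  "uea_rels s L br =
     {fa_word [x + y] - fa_word [x] - fa_word [y] | x y. x \<in> L \<and> y \<in> L} \<union>
     {fa_word [s c x] - fa_scale c (fa_word [x]) | c x. x \<in> L} \<union>
     {fa_word [x, y] - fa_word [y, x] - fa_word [br x y] | x y. x \<in> L \<and> y \<in> L}"

definition uea_ideal ::
  "(complex \<Rightarrow> 'l \<Rightarrow> 'l) \<Rightarrow> 'l::ab_group_add set \<Rightarrow> ('l \<Rightarrow> 'l \<Rightarrow> 'l) \<Rightarrow> 'l free_alg set" where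
  "uea_ideal s L br = module.span fa_scale
     {fa_mult (fa_mult (fa_word v) r) (fa_word w) | v r w.
        v \<in> lists L \<and> w \<in> lists L \<and> r \<in> uea_rels s L br}"

definition uea_proj ::
  "(complex \<Rightarrow> 'l \<Rightarrow> 'l) \<Rightarrow> 'l::ab_group_add set \<Rightarrow> ('l \<Rightarrow> 'l \<Rightarrow> 'l) \<Rightarrow> 'l free_alg \<Rightarrow> 'l free_alg" where
  "uea_proj s L br = quot_map fa_scale (uea_ideal s L br)"

definition uea_carrier ::
  "(complex \<Rightarrow> 'l \<Rightarrow> 'l) \<Rightarrow> 'l::ab_group_add set \<Rightarrow> ('l \<Rightarrow> 'l \<Rightarrow> 'l) \<Rightarrow> 'l free_alg set" where
  "uea_carrier s L br = uea_proj s L br ` {f. Poly_Mapping.keys f \<subseteq> lists L}"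

definition uea_mult ::
  "(complex \<Rightarrow> 'l \<Rightarrow> 'l) \<Rightarrow> 'l::ab_group_add set \<Rightarrow> ('l \<Rightarrow> 'l \<Rightarrow> 'l) \<Rightarrow>
   'l free_alg \<Rightarrow> 'l free_alg \<Rightarrow> 'l free_alg" where
  "uea_mult s L br x y = uea_proj s L br (fa_mult x y)"

definition uea_one ::
  "(complex \<Rightarrow> 'l \<Rightarrow> 'l) \<Rightarrow> 'l::ab_group_add set \<Rightarrow> ('l \<Rightarrow> 'l \<Rightarrow> 'l) \<Rightarrow> 'l free_alg" where
  "uea_one s L br = uea_proj s L br (fa_word [])"

definition uea_gen ::
  "(complex \<Rightarrow> 'l \<Rightarrow> 'l) \<Rightarrow> 'l::ab_group_add set \<Rightarrow> ('l \<Rightarrow> 'l \<Rightarrow> 'l) \<Rightarrow> 'l \<Rightarrow> 'l free_alg" where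
  "uea_gen s L br x = uea_proj s L br (fa_word [x])"


section \<open>Vertex algebras\<close>

text \<open>
  \<open>Y u n v\<close> is \<open>u\<^sub>n v\<close>, the coefficient of \<open>x\<^bsup>-n-1\<^esup>\<close> in \<open>Y(u,x)v\<close>.  The last axiom is the
  Jacobi identity, read off coefficientwise (Borcherds identity); all its sums are finite
  by truncation.
\<close>

locale vertex_algebra = vector_space scale
  for scale :: "complex \<Rightarrow> 'v::ab_group_add \<Rightarrow> 'v" +
  fixes V :: "'v set" and vac :: 'v and Y :: "'v \<Rightarrow> int \<Rightarrow> 'v \<Rightarrow> 'v"
  assumes subspace_V: "module.subspace scale V"
    and vac_in: "vac \<in> V"
    and Y_in: "u \<in> V \<Longrightarrow> v \<in> V \<Longrightarrow> Y u n v \<in> V"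
    and Y_add_left: "u \<in> V \<Longrightarrow> u' \<in> V \<Longrightarrow> v \<in> V \<Longrightarrow> Y (u + u') n v = Y u n v + Y u' n v"
    and Y_scale_left: "u \<in> V \<Longrightarrow> v \<in> V \<Longrightarrow> Y (scale c u) n v = scale c (Y u n v)"
    and Y_add_right: "u \<in> V \<Longrightarrow> v \<in> V \<Longrightarrow> v' \<in> V \<Longrightarrow> Y u n (v + v') = Y u n v + Y u n v'"
    and Y_scale_right: "u \<in> V \<Longrightarrow> v \<in> V \<Longrightarrow> Y u n (scale c v) = scale c (Y u n v)"
    and truncation: "u \<in> V \<Longrightarrow> v \<in> V \<Longrightarrow> \<exists>N. \<forall>n\<ge>N. Y u n v = 0"
    and vacuum: "v \<in> V \<Longrightarrow> Y vac n v = (if n = -1 then v else 0)"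
    and creation: "v \<in> V \<Longrightarrow> Y v (-1) vac = v"
    and creation_nonneg: "v \<in> V \<Longrightarrow> n \<ge> 0 \<Longrightarrow> Y v n vac = 0"
    and borcherds: "u \<in> V \<Longrightarrow> v \<in> V \<Longrightarrow> w \<in> V \<Longrightarrow>
      Sum_any (\<lambda>i::nat. scale (of_int m gchoose i) (Y (Y u (l + int i) v) (m + n - int i) w)) =
      Sum_any (\<lambda>i::nat. scale ((-1) ^ i * (of_int l gchoose i))
        (Y u (m + l - int i) (Y v (n + int i) w)
         - scale ((-1) powi l) (Y v (n + l - int i) (Y u (m + int i) w))))"

text \<open>
  Automorphisms are taken to be \<open>undefined\<close> outside the carrier, so that they form a group
  under \<^const>\<open>compose\<close>.
\<close>

definition va_automorphism ::
  "(complex \<Rightarrow> 'v::ab_group_add \<Rightarrow> 'v) \<Rightarrow> 'v set \<Rightarrow> 'v \<Rightarrow> ('v \<Rightarrow> int \<Rightarrow> 'v \<Rightarrow> 'v) \<Rightarrow> ('v \<Rightarrow> 'v) \<Rightarrow> bool" where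
  "va_automorphism scale V vac Y g \<longleftrightarrow>
     g \<in> extensional V \<and> bij_betw g V V \<and>
     (\<forall>u\<in>V. \<forall>v\<in>V. g (u + v) = g u + g v) \<and>
     (\<forall>c. \<forall>v\<in>V. g (scale c v) = scale c (g v)) \<and>
     g vac = vac \<and>
     (\<forall>u\<in>V. \<forall>v\<in>V. \<forall>n. g (Y u n v) = Y (g u) n (g v))"


section \<open>Vertex algebroids\<close>

text \<open>
  Addition and multiplication of \<open>A\<close>, and addition of \<open>B\<close>, come from the type classes.  The
  identity of \<open>A\<close> is a field of the record because \<^class>\<open>comm_ring_1\<close> would exclude \<open>A = 0\<close>.
\<close>

record ('a, 'b) algebroid =
  smA :: "complex \<Rightarrow> 'a \<Rightarrow> 'a"
  unitA :: 'a                            \<comment> \<open>\<open>e\<close>\<close>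
  smB :: "complex \<Rightarrow> 'b \<Rightarrow> 'b"
  actB :: "'a \<Rightarrow> 'b \<Rightarrow> 'b"               \<comment> \<open>\<open>a * v\<close>\<close>
  brB :: "'b \<Rightarrow> 'b \<Rightarrow> 'b"                \<comment> \<open>\<open>[u, v]\<close>\<close>
  anchor :: "'b \<Rightarrow> 'a \<Rightarrow> 'a"             \<comment> \<open>\<open>\<pi>(v)(a)\<close>\<close>
  pairB :: "'b \<Rightarrow> 'b \<Rightarrow> 'a"              \<comment> \<open>\<open>\<langle>u, v\<rangle>\<close>\<close>
  del :: "'a \<Rightarrow> 'b"                      \<comment> \<open>\<open>\<partial>\<close>\<close>

locale unital_comm_algebra =
  fixes X :: "('a::comm_ring, 'b::ab_group_add) algebroid"
  assumes vs_A: "vector_space (smA X)"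
    and smA_mult: "smA X c a * a' = smA X c (a * a')"
    and unitA: "unitA X * a = a"

definition derivation_on :: "('a::comm_ring, 'b::ab_group_add) algebroid \<Rightarrow> ('a \<Rightarrow> 'a) \<Rightarrow> bool" where
  "derivation_on X d \<longleftrightarrow>
     Vector_Spaces.linear (smA X) (smA X) d \<and> (\<forall>a a'. d (a * a') = d a * a' + a * d a')"

locale vertex_algebroid = unital_comm_algebra X
  for X :: "('a::comm_ring, 'b::ab_group_add) algebroid" +
  assumes vs_B: "vector_space (smB X)"
    and actB_linear_left: "Vector_Spaces.linear (smA X) (smB X) (\<lambda>a. actB X a v)"
    and actB_linear_right: "Vector_Spaces.linear (smB X) (smB X) (actB X a)"
    and actB_unit: "actB X (unitA X) v = v"
    and brB_linear_left: "Vector_Spaces.linear (smB X) (smB X) (\<lambda>u. brB X u v)"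
    and brB_linear_right: "Vector_Spaces.linear (smB X) (smB X) (brB X u)"
    and leibniz: "brB X u (brB X v w) = brB X (brB X u v) w + brB X v (brB X u w)"
    and anchor_derivation: "derivation_on X (anchor X v)"
    and anchor_linear: "Vector_Spaces.linear (smB X) (smA X) (\<lambda>v. anchor X v a)"
    and anchor_brB: "anchor X (brB X u v) a = anchor X u (anchor X v a) - anchor X v (anchor X u a)"
    and pairB_linear_left: "Vector_Spaces.linear (smB X) (smA X) (\<lambda>u. pairB X u v)"
    and pairB_linear_right: "Vector_Spaces.linear (smB X) (smA X) (pairB X u)"
    and pairB_sym: "pairB X u v = pairB X v u"
    and del_linear: "Vector_Spaces.linear (smA X) (smB X) (del X)"
    and anchor_del: "anchor X (del X a) a' = 0"
    and actB_assoc: "actB X a (actB X a' v) - actB X (a * a') v =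
      actB X (anchor X v a) (del X a') + actB X (anchor X v a') (del X a)"
    and brB_actB: "brB X u (actB X a v) = actB X (anchor X u a) v + actB X a (brB X u v)"
    and brB_sym: "brB X u v + brB X v u = del X (pairB X u v)"
    and anchor_actB: "anchor X (actB X a v) a' = a * anchor X v a'"
    and pairB_actB: "pairB X (actB X a u) v = a * pairB X u v - anchor X u (anchor X v a)"
    and anchor_pairB: "anchor X v (pairB X v1 v2) = pairB X (brB X v v1) v2 + pairB X v1 (brB X v v2)"
    and del_mult: "del X (a * a') = actB X a (del X a') + actB X a' (del X a)"
    and brB_del: "brB X v (del X a) = del X (anchor X v a)"
    and pairB_del: "pairB X v (del X a) = anchor X v a"

text \<open>\<open>C = A \<oplus> B\<close> is \<^typ>\<open>'a \<times> 'b\<close>, with its products \<open>u\<^sub>0 v\<close> and \<open>u\<^sub>1 v\<close>.\<close>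

definition smC :: "('a::comm_ring, 'b::ab_group_add) algebroid \<Rightarrow> complex \<Rightarrow> 'a \<times> 'b \<Rightarrow> 'a \<times> 'b" where
  "smC X c u = (smA X c (fst u), smB X c (snd u))"

definition prod0 :: "('a::comm_ring, 'b::ab_group_add) algebroid \<Rightarrow> 'a \<times> 'b \<Rightarrow> 'a \<times> 'b \<Rightarrow> 'a \<times> 'b" where
  "prod0 X u v = (anchor X (snd u) (fst v) - anchor X (snd v) (fst u), brB X (snd u) (snd v))"

definition prod1 :: "('a::comm_ring, 'b::ab_group_add) algebroid \<Rightarrow> 'a \<times> 'b \<Rightarrow> 'a \<times> 'b \<Rightarrow> 'a \<times> 'b" where
  "prod1 X u v = (pairB X (snd u) (snd v), 0)"

definition algebroid_automorphism ::
  "('a::comm_ring, 'b::ab_group_add) algebroid \<Rightarrow> ('a \<times> 'b \<Rightarrow> 'a \<times> 'b) \<Rightarrow> bool" where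
  "algebroid_automorphism X f \<longleftrightarrow>
     Vector_Spaces.linear (smC X) (smC X) f \<and> bij f \<and>
     (\<forall>a. snd (f (a, 0)) = 0) \<and>
     (\<forall>b. fst (f (0, b)) = 0) \<and>
     (let fA = (\<lambda>a. fst (f (a, 0))); fB = (\<lambda>b. snd (f (0, b))) in
       (\<forall>a a'. fA (a * a') = fA a * fA a') \<and>
       (\<forall>u v. fB (brB X u v) = brB X (fB u) (fB v)) \<and>
       (\<forall>a b. fB (actB X a b) = actB X (fA a) (fB b)) \<and>
       (\<forall>u v. pairB X (fB u) (fB v) = fA (pairB X u v)) \<and>
       (\<forall>a. fB (del X a) = del X (fA a)) \<and>
       (\<forall>a b. fA (anchor X b a) = anchor X (fB b) (fA a)))"

definition Aut_algebroid :: "('a::comm_ring, 'b::ab_group_add) algebroid \<Rightarrow> ('a \<times> 'b \<Rightarrow> 'a \<times> 'b) monoid" where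
  "Aut_algebroid X = \<lparr>carrier = {f. algebroid_automorphism X f}, mult = (\<lambda>f g. f \<circ> g), one = id\<rparr>"


section \<open>The Lie algebra of a vertex algebroid\<close>

type_synonym ('a, 'b) loop = "int \<Rightarrow>\<^sub>0 ('a \<times> 'b)"

abbreviation smLoop :: "('a::comm_ring, 'b::ab_group_add) algebroid \<Rightarrow> complex \<Rightarrow> ('a, 'b) loop \<Rightarrow> ('a, 'b) loop" where
  "smLoop X \<equiv> pm_scale (smC X)"

text \<open>\<open>[u \<otimes> t\<^sup>m, v \<otimes> t\<^sup>n] = u\<^sub>0 v \<otimes> t\<^bsup>m+n\<^esup> + m (u\<^sub>1 v) \<otimes> t\<^bsup>m+n-1\<^esup>\<close>, extended bilinearly.\<close>

definition loop_bracket ::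
  "('a::comm_ring, 'b::ab_group_add) algebroid \<Rightarrow> ('a, 'b) loop \<Rightarrow> ('a, 'b) loop \<Rightarrow> ('a, 'b) loop" where
  "loop_bracket X x y = (\<Sum>m\<in>Poly_Mapping.keys x. \<Sum>n\<in>Poly_Mapping.keys y.
     Poly_Mapping.single (m + n) (prod0 X (Poly_Mapping.lookup x m) (Poly_Mapping.lookup y n)) +
     Poly_Mapping.single (m + n - 1)
       (smC X (of_int m) (prod1 X (Poly_Mapping.lookup x m) (Poly_Mapping.lookup y n))))"

text \<open>The image of \<open>\<partial> \<otimes> 1 + 1 \<otimes> d/dt\<close> on \<open>A \<otimes> \<complex>[t, t\<inverse>]\<close>.\<close>

definition del_hat_image :: "('a::comm_ring, 'b::ab_group_add) algebroid \<Rightarrow> ('a, 'b) loop set" where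
  "del_hat_image X = module.span (smLoop X)
     {Poly_Mapping.single n (0, del X a) + Poly_Mapping.single (n - 1) (smA X (of_int n) a, 0) | n a. True}"

definition lie_proj :: "('a::comm_ring, 'b::ab_group_add) algebroid \<Rightarrow> ('a, 'b) loop \<Rightarrow> ('a, 'b) loop" where
  "lie_proj X = quot_map (smLoop X) (del_hat_image X)"

definition lie_carrier :: "('a::comm_ring, 'b::ab_group_add) algebroid \<Rightarrow> ('a, 'b) loop set" where
  "lie_carrier X = range (lie_proj X)"

definition lie_bracket ::
  "('a::comm_ring, 'b::ab_group_add) algebroid \<Rightarrow> ('a, 'b) loop \<Rightarrow> ('a, 'b) loop \<Rightarrow> ('a, 'b) loop" where
  "lie_bracket X x y = lie_proj X (loop_bracket X x y)"

definition lie_nonneg :: "('a::comm_ring, 'b::ab_group_add) algebroid \<Rightarrow> ('a, 'b) loop set" where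
  "lie_nonneg X = lie_proj X ` {x. Poly_Mapping.keys x \<subseteq> {0..}}"

abbreviation U_carrier :: "('a::comm_ring, 'b::ab_group_add) algebroid \<Rightarrow> ('a, 'b) loop free_alg set" where
  "U_carrier X \<equiv> uea_carrier (smLoop X) (lie_carrier X) (lie_bracket X)"

abbreviation U_mult ::
  "('a::comm_ring, 'b::ab_group_add) algebroid \<Rightarrow>
   ('a, 'b) loop free_alg \<Rightarrow> ('a, 'b) loop free_alg \<Rightarrow> ('a, 'b) loop free_alg" where
  "U_mult X \<equiv> uea_mult (smLoop X) (lie_carrier X) (lie_bracket X)"

abbreviation U_one :: "('a::comm_ring, 'b::ab_group_add) algebroid \<Rightarrow> ('a, 'b) loop free_alg" where
  "U_one X \<equiv> uea_one (smLoop X) (lie_carrier X) (lie_bracket X)"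

abbreviation U_gen ::
  "('a::comm_ring, 'b::ab_group_add) algebroid \<Rightarrow> ('a, 'b) loop \<Rightarrow> ('a, 'b) loop free_alg" where
  "U_gen X \<equiv> uea_gen (smLoop X) (lie_carrier X) (lie_bracket X)"


section \<open>The induced module \<open>V\<^sub>\<L>\<close>\<close>

text \<open>
  Since \<open>\<L>\<^bsup>\<ge>0\<^esup>\<close> acts by zero on \<open>\<complex>\<close>, the induced module \<open>U(\<L>) \<otimes> \<complex>\<close> over
  \<open>U(\<L>\<^bsup>\<ge>0\<^esup>)\<close> is the quotient of \<open>U(\<L>)\<close> by the left ideal \<open>U(\<L>) \<L>\<^bsup>\<ge>0\<^esup>\<close>.
\<close>

definition VL_kernel :: "('a::comm_ring, 'b::ab_group_add) algebroid \<Rightarrow> ('a, 'b) loop free_alg set" where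
  "VL_kernel X = module.span fa_scale
     {U_mult X x (U_gen X h) | x h. x \<in> U_carrier X \<and> h \<in> lie_nonneg X}"

definition VL_proj ::
  "('a::comm_ring, 'b::ab_group_add) algebroid \<Rightarrow> ('a, 'b) loop free_alg \<Rightarrow> ('a, 'b) loop free_alg" where
  "VL_proj X = quot_map fa_scale (VL_kernel X)"

definition VL :: "('a::comm_ring, 'b::ab_group_add) algebroid \<Rightarrow> ('a, 'b) loop free_alg set" where
  "VL X = VL_proj X ` U_carrier X"

definition VL_vac :: "('a::comm_ring, 'b::ab_group_add) algebroid \<Rightarrow> ('a, 'b) loop free_alg" where
  "VL_vac X = VL_proj X (U_one X)"

text \<open>The action of \<open>U(\<L>)\<close> on \<open>V\<^sub>\<L>\<close>, and the operator \<open>u(n)\<close> for \<open>u \<in> A \<oplus> B\<close>.\<close>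

definition VL_act ::
  "('a::comm_ring, 'b::ab_group_add) algebroid \<Rightarrow>
   ('a, 'b) loop free_alg \<Rightarrow> ('a, 'b) loop free_alg \<Rightarrow> ('a, 'b) loop free_alg" where
  "VL_act X x v = VL_proj X (U_mult X x v)"

definition VL_mode ::
  "('a::comm_ring, 'b::ab_group_add) algebroid \<Rightarrow>
   'a \<times> 'b \<Rightarrow> int \<Rightarrow> ('a, 'b) loop free_alg \<Rightarrow> ('a, 'b) loop free_alg" where
  "VL_mode X u n v = VL_act X (U_gen X (lie_proj X (Poly_Mapping.single n u))) v"

definition VL_emb :: "('a::comm_ring, 'b::ab_group_add) algebroid \<Rightarrow> 'a \<times> 'b \<Rightarrow> ('a, 'b) loop free_alg" where
  "VL_emb X u = VL_mode X u (-1) (VL_vac X)"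

text \<open>
  The vertex algebra structure of \<open>V\<^sub>\<L>\<close> with \<open>Y(u,x) = \<Sum> u(n) x\<^bsup>-n-1\<^esup>\<close> for \<open>u \<in> A \<oplus> B\<close>.
  By a standard theorem such a \<open>Y\<close> exists and is unique (on \<open>V\<^sub>\<L>\<close>; its values elsewhere are
  irrelevant), so the predicate names \<open>the\<close> structure.
\<close>

definition VL_vertex_structure ::
  "('a::comm_ring, 'b::ab_group_add) algebroid \<Rightarrow>
   (('a, 'b) loop free_alg \<Rightarrow> int \<Rightarrow> ('a, 'b) loop free_alg \<Rightarrow> ('a, 'b) loop free_alg) \<Rightarrow> bool" where
  "VL_vertex_structure X Y \<longleftrightarrow>
     vertex_algebra fa_scale (VL X) (VL_vac X) Y \<and>
     (\<forall>u n. \<forall>v\<in>VL X. Y (VL_emb X u) n v = VL_mode X u n v)"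

text \<open>\<open>u\<^sub>1(n\<^sub>1) \<dots> u\<^sub>k(n\<^sub>k)1\<close> with homogeneous \<open>u\<^sub>i\<close>, together with its degree:
  \<open>a(n)\<close> has degree \<open>-n-1\<close> and \<open>b(n)\<close> has degree \<open>-n\<close>.\<close>

inductive VL_monomial ::
  "('a::comm_ring, 'b::ab_group_add) algebroid \<Rightarrow> int \<Rightarrow> ('a, 'b) loop free_alg \<Rightarrow> bool"
  for X where
  VL_monomial_vac: "VL_monomial X 0 (VL_vac X)"
| VL_monomial_A: "VL_monomial X d v \<Longrightarrow> VL_monomial X (d - n - 1) (VL_mode X (a, 0) n v)"
| VL_monomial_B: "VL_monomial X d v \<Longrightarrow> VL_monomial X (d - n) (VL_mode X (0, b) n v)"

definition VL_deg :: "('a::comm_ring, 'b::ab_group_add) algebroid \<Rightarrow> int \<Rightarrow> ('a, 'b) loop free_alg set" where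
  "VL_deg X d = module.span fa_scale {v. VL_monomial X d v}"


section \<open>The vertex algebra \<open>V\<^sub>B\<close>\<close>

text \<open>In this section \<open>Y\<close> is the vertex algebra structure of \<open>V\<^sub>\<L>\<close>.\<close>

type_synonym 'v vertex_op = "'v \<Rightarrow> int \<Rightarrow> 'v \<Rightarrow> 'v"

definition E_space :: "('a::comm_ring, 'b::ab_group_add) algebroid \<Rightarrow> ('a, 'b) loop free_alg set" where
  "E_space X = module.span fa_scale
     ({VL_emb X (unitA X, 0) - VL_vac X} \<union>
      {VL_mode X (a, 0) (-1) (VL_emb X (a', 0)) - VL_emb X (a * a', 0) | a a'. True} \<union>
      {VL_mode X (a, 0) (-1) (VL_emb X (0, b)) - VL_emb X (0, actB X a b) | a b. True})"

definition IB ::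
  "('a::comm_ring, 'b::ab_group_add) algebroid \<Rightarrow> ('a, 'b) loop free_alg vertex_op \<Rightarrow>
   ('a, 'b) loop free_alg set" where
  "IB X Y = module.span fa_scale
     {VL_act X x (((\<lambda>v. Y v (-2) (VL_vac X)) ^^ k) v) | x k v. x \<in> U_carrier X \<and> v \<in> E_space X}"

definition VB_proj ::
  "('a::comm_ring, 'b::ab_group_add) algebroid \<Rightarrow> ('a, 'b) loop free_alg vertex_op \<Rightarrow>
   ('a, 'b) loop free_alg \<Rightarrow> ('a, 'b) loop free_alg" where
  "VB_proj X Y = quot_map fa_scale (IB X Y)"

definition VB ::
  "('a::comm_ring, 'b::ab_group_add) algebroid \<Rightarrow> ('a, 'b) loop free_alg vertex_op \<Rightarrow>
   ('a, 'b) loop free_alg set" where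
  "VB X Y = VB_proj X Y ` VL X"

definition VB_vac ::
  "('a::comm_ring, 'b::ab_group_add) algebroid \<Rightarrow> ('a, 'b) loop free_alg vertex_op \<Rightarrow>
   ('a, 'b) loop free_alg" where
  "VB_vac X Y = VB_proj X Y (VL_vac X)"

text \<open>Elements of \<open>V\<^sub>B\<close> are their own representatives in \<open>V\<^sub>\<L>\<close>.\<close>

definition VB_op ::
  "('a::comm_ring, 'b::ab_group_add) algebroid \<Rightarrow> ('a, 'b) loop free_alg vertex_op \<Rightarrow>
   ('a, 'b) loop free_alg vertex_op" where
  "VB_op X Y u n v = VB_proj X Y (Y u n v)"

definition VB_deg ::
  "('a::comm_ring, 'b::ab_group_add) algebroid \<Rightarrow> ('a, 'b) loop free_alg vertex_op \<Rightarrow>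
   nat \<Rightarrow> ('a, 'b) loop free_alg set" where
  "VB_deg X Y n = VB_proj X Y ` VL_deg X (int n)"

definition VB_emb ::
  "('a::comm_ring, 'b::ab_group_add) algebroid \<Rightarrow> ('a, 'b) loop free_alg vertex_op \<Rightarrow>
   'a \<times> 'b \<Rightarrow> ('a, 'b) loop free_alg" where
  "VB_emb X Y u = VB_proj X Y (VL_emb X u)"

definition Aut_o_VB ::
  "('a::comm_ring, 'b::ab_group_add) algebroid \<Rightarrow> ('a, 'b) loop free_alg vertex_op \<Rightarrow>
   (('a, 'b) loop free_alg \<Rightarrow> ('a, 'b) loop free_alg) monoid" where
  "Aut_o_VB X Y =
     \<lparr>carrier = {g. va_automorphism fa_scale (VB X Y) (VB_vac X Y) (VB_op X Y) g \<and>
                    (\<forall>n. g ` VB_deg X Y n = VB_deg X Y n)},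
      mult = compose (VB X Y),
      one = restrict id (VB X Y)\<rparr>"

text \<open>\<open>g \<mapsto> g|\<^bsub>A \<oplus> B\<^esub>\<close>, where \<open>A \<oplus> B\<close> is identified with its image under \<^const>\<open>VB_emb\<close>.\<close>

definition restrict_AB ::
  "('a::comm_ring, 'b::ab_group_add) algebroid \<Rightarrow> ('a, 'b) loop free_alg vertex_op \<Rightarrow>
   (('a, 'b) loop free_alg \<Rightarrow> ('a, 'b) loop free_alg) \<Rightarrow> 'a \<times> 'b \<Rightarrow> 'a \<times> 'b" where
  "restrict_AB X Y g = (\<lambda>u. inv_into UNIV (VB_emb X Y) (g (VB_emb X Y u)))"

end

theory Submission
  imports Defs "HOL-Library.Function_Algebras"
begin

text \<open>
  Surjectivity of the restriction map follows from the universal property of \<open>V\<^sub>\<L>\<close>: an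
  automorphism of the algebroid acts on the modes \<open>u(n)\<close>, hence on \<open>V\<^sub>\<L>\<close>, and preserves
  \<open>I\<^sub>B\<close>.  Injectivity holds because \<open>V\<^sub>B\<close> is generated by \<open>A \<oplus> B\<close>.

  The main point is that \<open>A \<oplus> B\<close> embeds in \<open>V\<^sub>B\<close>.  Instead of a Poincare-Birkhoff-Witt theorem we
  use a module coinduced from the quotient \<open>A \<oplus> B\<close> of \<open>V\<^sub>B\<close> by its part of degree at least two,
  on which the modes of negative index act explicitly.  The universal property gives a map from
  \<open>V\<^sub>\<L>\<close> to this module which intertwines the translation operators and annihilates \<open>E\<close>, hence
  annihilates \<open>I\<^sub>B\<close>, and whose component in \<open>A \<oplus> B\<close> is a left inverse of the embedding.
\<close>

section \<open>Finitely supported functions\<close>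

text \<open>The modes of negative and of nonnegative index span complementary subalgebras of the Lie
  algebra, because the relation for \<open>del X\<close> never mixes the two. That V_L is free over
  the negative modes is the Poincare-Birkhoff-Witt theorem; and a map from V_L to A + B linear over
  the negative modes alone could not be seen to kill I_B, which is closed under all modes. What has
  to be checked instead is that negative modes preserve these relations and obey the commutator
  formula; both rest on the Jacobi identity. The quotient A + B is stable because negative modes
  never lower the degree. Its formulas are read off from V_B, but their commutation relations are
  proved from the axioms of the algebroid alone, so there is no circularity. The operation
  \<open>Y\<close> is given, not constructed: facts about it are deduced from the modes by the
  iterate and commutator formulas.\<close>

definition pm_sum :: "('k \<Rightarrow> 'v::zero \<Rightarrow> 'w::comm_monoid_add) \<Rightarrow> ('k \<Rightarrow>\<^sub>0 'v) \<Rightarrow> 'w" where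
  "pm_sum F p = (\<Sum>k\<in>Poly_Mapping.keys p. F k (Poly_Mapping.lookup p k))"

lemma pm_sum_superset:
  assumes "finite K" "Poly_Mapping.keys p \<subseteq> K" "\<And>k. F k 0 = 0"
  shows "pm_sum F p = (\<Sum>k\<in>K. F k (Poly_Mapping.lookup p k))"
  unfolding pm_sum_def using assms
  by (intro sum.mono_neutral_left) (auto simp: in_keys_iff)

lemma pm_sum_zero [simp]: "pm_sum F 0 = 0"
  by (simp add: pm_sum_def)

lemma pm_sum_single: "F k 0 = 0 \<Longrightarrow> pm_sum F (Poly_Mapping.single k x) = F k x"
  by (simp add: pm_sum_def)

lemma pm_sum_add:
  fixes F :: "'k \<Rightarrow> 'v::ab_group_add \<Rightarrow> 'w::ab_group_add"
  assumes add: "\<And>k x y. F k (x + y) = F k x + F k y"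
  shows "pm_sum F (p + q) = pm_sum F p + pm_sum F q"
proof -
  have z: "F k 0 = 0" for k using add[of k 0 0] by simp
  let ?K = "Poly_Mapping.keys p \<union> Poly_Mapping.keys q"
  have "pm_sum F (p + q) = (\<Sum>k\<in>?K. F k (Poly_Mapping.lookup (p + q) k))"
    by (rule pm_sum_superset) (auto simp: z dest: subsetD[OF keys_add])
  moreover have "pm_sum F p = (\<Sum>k\<in>?K. F k (Poly_Mapping.lookup p k))"
    by (rule pm_sum_superset) (auto simp: z)
  moreover have "pm_sum F q = (\<Sum>k\<in>?K. F k (Poly_Mapping.lookup q k))"
    by (rule pm_sum_superset) (auto simp: z)
  ultimately show ?thesis by (simp add: lookup_add add sum.distrib)
qed

lemma pm_sum_fun_add: "pm_sum (\<lambda>k x. F k x + G k x) p = pm_sum F p + pm_sum G p"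
  by (simp add: pm_sum_def sum.distrib)

lemma pm_sum_cong:
  "(\<And>k x. F k x = G k x) \<Longrightarrow> pm_sum F p = pm_sum G p"
  by (simp add: pm_sum_def)

text \<open>The case \<open>single\<close> keeps the information that the index is a key of
  \<open>p\<close>, so that a restriction on the support, such as words over a given alphabet in
  \<open>fa_over_induct\<close>, survives the decomposition into monomials.\<close>

lemma poly_mapping_single_induct [case_names zero single add]:
  fixes p :: "'k \<Rightarrow>\<^sub>0 'v::ab_group_add"
  assumes "P 0"
    and single: "\<And>k x. k \<in> Poly_Mapping.keys p \<Longrightarrow> P (Poly_Mapping.single k x)"
    and add: "\<And>p q. P p \<Longrightarrow> P q \<Longrightarrow> P (p + q)"
  shows "P p"
proof -
  have "P (\<Sum>k\<in>K. Poly_Mapping.single k (Poly_Mapping.lookup p k))"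
    if "finite K" "K \<subseteq> Poly_Mapping.keys p" for K
    using that by (induction K rule: finite_induct) (auto intro!: assms)
  from this[of "Poly_Mapping.keys p"]
  have "P (\<Sum>k\<in>Poly_Mapping.keys p. Poly_Mapping.single k (Poly_Mapping.lookup p k))" by simp
  moreover have "(\<Sum>k\<in>Poly_Mapping.keys p. Poly_Mapping.single k (Poly_Mapping.lookup p k)) = p"
    by (rule poly_mapping_eqI) (auto simp: lookup_sum lookup_single when_def in_keys_iff)
  ultimately show ?thesis by simp
qed

lemma lookup_pm_scale:
  assumes "vector_space s"
  shows "Poly_Mapping.lookup (pm_scale s c x) k = s c (Poly_Mapping.lookup x k)"
proof -
  interpret vector_space s by fact
  show ?thesis unfolding pm_scale_def by (simp add: map.rep_eq when_def)
qed

lemma pm_scale_single: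
  assumes "vector_space s"
  shows "pm_scale s c (Poly_Mapping.single k x) = Poly_Mapping.single k (s c x)"
proof -
  interpret vector_space s by fact
  show ?thesis
    by (rule poly_mapping_eqI) (simp add: lookup_pm_scale[OF assms] lookup_single when_def)
qed

lemma pm_sum_scale:
  assumes s: "vector_space s" and s': "vector_space s'"
    and scale: "\<And>k c x. F k (s c x) = s' c (F k x)"
  shows "pm_sum F (pm_scale s c p) = s' c (pm_sum F p)"
proof -
  interpret s: vector_space s by fact
  interpret s': vector_space s' by fact
  have z: "F k 0 = 0" for k using scale[of k 0 0] by simp
  have "pm_sum F (pm_scale s c p) = (\<Sum>k\<in>Poly_Mapping.keys p. F k (Poly_Mapping.lookup (pm_scale s c p) k))"
    by (rule pm_sum_superset) (auto simp: z in_keys_iff lookup_pm_scale[OF s])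
  then show ?thesis
    by (simp add: lookup_pm_scale[OF s] scale s'.scale_sum_right pm_sum_def)
qed

lemma vector_space_complex: "vector_space ((*) :: complex \<Rightarrow> complex \<Rightarrow> complex)"
  by unfold_locales (auto simp: algebra_simps)

lemma vector_space_fa_scale: "vector_space fa_scale"
  by (rule vector_space_pm_scale[OF vector_space_complex])

interpretation fa: vector_space fa_scale
  by (rule vector_space_fa_scale)

lemma linear_onI:
  assumes "vector_space s" "vector_space s'"
    "\<And>x y. f (x + y) = f x + f y" "\<And>c x. f (s c x) = s' c (f x)"
  shows "Vector_Spaces.linear s s' f"
  unfolding Vector_Spaces.linear_def module_hom_def module_hom_axioms_def
  using assms by (auto simp: module_iff_vector_space)

lemma fa_scale_word: "fa_scale c (fa_word w) = Poly_Mapping.single w c"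
  by (simp add: fa_word_def pm_scale_single[OF vector_space_complex])

lemma keys_fa_scale: "Poly_Mapping.keys (fa_scale c p) \<subseteq> Poly_Mapping.keys p"
  by (auto simp: in_keys_iff lookup_pm_scale[OF vector_space_complex])


section \<open>The free associative algebra\<close>

lemma fa_mult_pm_sum:
  "fa_mult f g = pm_sum (\<lambda>v c. pm_sum (\<lambda>w d. Poly_Mapping.single (v @ w) (c * d)) g) f"
  by (simp add: fa_mult_def pm_sum_def)

lemma fa_mult_add_right: "fa_mult f (g + h) = fa_mult f g + fa_mult f h"
  unfolding fa_mult_pm_sum
  by (subst pm_sum_fun_add[symmetric], rule pm_sum_cong, rule pm_sum_add)
    (simp add: distrib_left single_add)

lemma fa_mult_add_left: "fa_mult (f + g) h = fa_mult f h + fa_mult g h"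
  unfolding fa_mult_pm_sum
  by (rule pm_sum_add, subst pm_sum_fun_add[symmetric], rule pm_sum_cong)
    (simp add: distrib_right single_add)

lemma fa_mult_single [simp]:
  "fa_mult (Poly_Mapping.single v c) (Poly_Mapping.single w d) = Poly_Mapping.single (v @ w) (c * d)"
proof -
  have "pm_sum (\<lambda>w d. Poly_Mapping.single (v @ w) (c * d)) (Poly_Mapping.single w d) =
      Poly_Mapping.single (v @ w) (c * d)" for c
    by (subst pm_sum_single) auto
  moreover have "pm_sum (\<lambda>v c. pm_sum (\<lambda>w d. Poly_Mapping.single (v @ w) (c * d)) (Poly_Mapping.single w d))
      (Poly_Mapping.single v c)
    = pm_sum (\<lambda>w d. Poly_Mapping.single (v @ w) (c * d)) (Poly_Mapping.single w d)"
    by (subst pm_sum_single) (auto simp: pm_sum_def)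
  ultimately show ?thesis by (simp add: fa_mult_pm_sum)
qed

lemma fa_mult_zero [simp]: "fa_mult 0 f = 0" "fa_mult f 0 = 0"
  using fa_mult_add_left[of 0 0 f] fa_mult_add_right[of f 0 0] by simp_all

lemma fa_mult_scale_right: "fa_mult f (fa_scale c g) = fa_scale c (fa_mult f g)"
proof (induction f rule: poly_mapping_single_induct)
  case (single k x)
  show ?case
    by (induction g rule: poly_mapping_single_induct)
      (auto simp: fa_mult_add_right fa.scale_right_distrib
        pm_scale_single[OF vector_space_complex] mult.left_commute)
qed (auto simp: fa_mult_add_left fa.scale_right_distrib)

lemma fa_mult_scale_left: "fa_mult (fa_scale c f) g = fa_scale c (fa_mult f g)"
proof (induction f rule: poly_mapping_single_induct)
  case (single k x)
  show ?case
    by (induction g rule: poly_mapping_single_induct)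
      (auto simp: fa_mult_add_right fa.scale_right_distrib
        pm_scale_single[OF vector_space_complex] mult.assoc)
qed (auto simp: fa_mult_add_left fa.scale_right_distrib)

lemma fa_mult_diff_right: "fa_mult f (g - h) = fa_mult f g - fa_mult f h"
  using fa_mult_add_right[of f "g - h" h] by (simp add: algebra_simps)

lemma fa_mult_diff_left: "fa_mult (f - g) h = fa_mult f h - fa_mult g h"
  using fa_mult_add_left[of "f - g" g h] by (simp add: algebra_simps)

lemma fa_mult_assoc: "fa_mult (fa_mult f g) h = fa_mult f (fa_mult g h)"
proof (induction f rule: poly_mapping_single_induct)
  case (single u a)
  show ?case
  proof (induction g rule: poly_mapping_single_induct)
    case (single v b)
    show ?case
      by (induction h rule: poly_mapping_single_induct)
        (auto simp: fa_mult_add_right mult.assoc)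
  qed (auto simp: fa_mult_add_left fa_mult_add_right)
qed (auto simp: fa_mult_add_left)

lemma fa_mult_word [simp]: "fa_mult (fa_word v) (fa_word w) = fa_word (v @ w)"
  by (simp add: fa_word_def)

lemma fa_mult_one [simp]: "fa_mult (fa_word []) f = f" "fa_mult f (fa_word []) = f"
  by (induction f rule: poly_mapping_single_induct;
      simp add: fa_word_def fa_mult_add_left fa_mult_add_right)+

text \<open>The type of letters may be larger than the Lie algebra, and \<open>uea_ideal\<close> is
  built to absorb products with words over \<open>L\<close>; arguments about ideals are therefore
  confined to this subalgebra.\<close>

definition fa_over :: "'l set \<Rightarrow> 'l free_alg set" where
  "fa_over L = {f. Poly_Mapping.keys f \<subseteq> lists L}"

lemma subspace_fa_over: "fa.subspace (fa_over L)"
  by (rule fa.subspaceI)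
    (auto simp: fa_over_def dest!: subsetD[OF keys_add] subsetD[OF keys_fa_scale])

lemma fa_word_in_over: "(\<And>x. x \<in> set w \<Longrightarrow> x \<in> L) \<Longrightarrow> fa_word w \<in> fa_over L"
  by (auto simp: fa_over_def fa_word_def)

lemma fa_over_induct [consumes 1, case_names zero scale_word add]:
  assumes "p \<in> fa_over L" "P 0"
    and "\<And>c w. w \<in> lists L \<Longrightarrow> P (fa_scale c (fa_word w))"
    and "\<And>p q. P p \<Longrightarrow> P q \<Longrightarrow> P (p + q)"
  shows "P p"
proof (induction p rule: poly_mapping_single_induct)
  case (single k x)
  then have "k \<in> lists L" using assms(1) by (auto simp: fa_over_def)
  from assms(3)[OF this, of x] show ?case by (simp add: fa_scale_word)
qed (use assms in auto)

lemma fa_over_span: "fa_over L = fa.span (fa_word ` lists L)"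
proof
  show "fa_over L \<subseteq> fa.span (fa_word ` lists L)"
  proof
    fix p assume "p \<in> fa_over L"
    then show "p \<in> fa.span (fa_word ` lists L)"
      by (induction p rule: fa_over_induct)
        (auto intro: fa.span_zero fa.span_add fa.span_scale fa.span_base)
  qed
  show "fa.span (fa_word ` lists L) \<subseteq> fa_over L"
    by (rule fa.span_minimal) (auto intro: fa_word_in_over subspace_fa_over)
qed

text \<open>Bilinearity reduces the closure of \<open>fa_over\<close> and both ideal properties of
  \<open>uea_ideal\<close> to products of generators.\<close>

lemma fa_mult_in_subspace:
  assumes "fa.subspace S" "p \<in> fa.span P" "q \<in> fa.span Q"
    and PQ: "\<And>x y. x \<in> P \<Longrightarrow> y \<in> Q \<Longrightarrow> fa_mult x y \<in> S"
  shows "fa_mult p q \<in> S"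
  using assms(2)
proof (induction p rule: fa.span_induct)
  case base
  show ?case using assms(1)
    by (auto intro!: fa.subspaceI simp: fa_mult_add_left fa_mult_scale_left
        intro: fa.subspace_0 fa.subspace_add fa.subspace_scale)
next
  case (step x)
  show ?case using assms(3)
  proof (induction q rule: fa.span_induct)
    case base
    show ?case using assms(1)
      by (auto intro!: fa.subspaceI simp: fa_mult_add_right fa_mult_scale_right
          intro: fa.subspace_0 fa.subspace_add fa.subspace_scale)
  qed (use step PQ in auto)
qed

lemma fa_mult_over: "p \<in> fa_over L \<Longrightarrow> q \<in> fa_over L \<Longrightarrow> fa_mult p q \<in> fa_over L"
  by (rule fa_mult_in_subspace[OF subspace_fa_over, of p "fa_word ` lists L" q "fa_word ` lists L"])
    (auto simp: fa_over_span[symmetric] intro!: fa_word_in_over)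


section \<open>Universal enveloping algebras\<close>

lemma quot_map_kernel:
  assumes "vector_space s" "module.subspace s K"
  shows "quot_map s K x = 0 \<longleftrightarrow> x \<in> K"
  using quot_map_props(3)[OF assms] by auto

text \<open>Idempotence places the chosen representative in the class of \<open>x\<close>. This
  allows an operation to be computed on representatives and projected afterwards.\<close>

lemma quot_map_diff_in:
  assumes "vector_space s" "module.subspace s K"
  shows "quot_map s K x - x \<in> K"
proof -
  interpret l: Vector_Spaces.linear s s "quot_map s K" by (rule quot_map_props(1)[OF assms])
  have "quot_map s K (quot_map s K x - x) = 0"
    by (simp add: l.diff quot_map_props(2)[OF assms])
  then show ?thesis using quot_map_kernel[OF assms] by simp
qed

lemma quot_map_eq_iff:
  assumes "vector_space s" "module.subspace s K"
  shows "quot_map s K x = quot_map s K y \<longleftrightarrow> x - y \<in> K"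
proof -
  interpret l: Vector_Spaces.linear s s "quot_map s K" by (rule quot_map_props(1)[OF assms])
  have "quot_map s K x = quot_map s K y \<longleftrightarrow> quot_map s K (x - y) = 0" by (simp add: l.diff)
  then show ?thesis using quot_map_kernel[OF assms] by simp
qed

locale enveloping = vector_space s for s :: "complex \<Rightarrow> 'l::ab_group_add \<Rightarrow> 'l" +
  fixes L :: "'l set" and br :: "'l \<Rightarrow> 'l \<Rightarrow> 'l"
  assumes subspace_L: "subspace L"
    and br_in: "x \<in> L \<Longrightarrow> y \<in> L \<Longrightarrow> br x y \<in> L"
begin

abbreviation "U_ideal \<equiv> uea_ideal s L br"
abbreviation "U_proj \<equiv> uea_proj s L br"
abbreviation "FL \<equiv> fa_over L"

lemma subspace_U_ideal: "fa.subspace U_ideal"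
  by (simp add: uea_ideal_def)

lemma uea_rels_over: "r \<in> uea_rels s L br \<Longrightarrow> r \<in> FL"
  unfolding uea_rels_def
  by (auto intro!: fa.subspace_diff[OF subspace_fa_over] fa.subspace_scale[OF subspace_fa_over]
      fa_word_in_over br_in subspace_add[OF subspace_L] subspace_scale[OF subspace_L])

lemma U_ideal_over: "U_ideal \<subseteq> FL"
  unfolding uea_ideal_def
  by (rule fa.span_minimal) (auto intro!: subspace_fa_over fa_mult_over fa_word_in_over intro: uea_rels_over)

lemma U_ideal_left:
  assumes "p \<in> FL" "r \<in> U_ideal"
  shows "fa_mult p r \<in> U_ideal"
proof (rule fa_mult_in_subspace[OF subspace_U_ideal])
  show "p \<in> fa.span (fa_word ` lists L)" using assms(1) by (simp add: fa_over_span)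
  show "r \<in> fa.span {fa_mult (fa_mult (fa_word v) r) (fa_word w) | v r w.
        v \<in> lists L \<and> w \<in> lists L \<and> r \<in> uea_rels s L br}"
    using assms(2) by (simp add: uea_ideal_def)
  fix x y
  assume "x \<in> fa_word ` lists L" and
    "y \<in> {fa_mult (fa_mult (fa_word v) r) (fa_word w) | v r w.
        v \<in> lists L \<and> w \<in> lists L \<and> r \<in> uea_rels s L br}"
  then obtain u v r w where *: "x = fa_word u" "y = fa_mult (fa_mult (fa_word v) r) (fa_word w)"
    "u \<in> lists L" "v \<in> lists L" "w \<in> lists L" "r \<in> uea_rels s L br" by auto
  then have "fa_mult x y = fa_mult (fa_mult (fa_word (u @ v)) r) (fa_word w)"
    by (simp add: fa_mult_assoc flip: fa_mult_word)
  with * show "fa_mult x y \<in> U_ideal"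
    unfolding uea_ideal_def
    by (intro fa.span_base CollectI exI[of _ "u @ v"] exI[of _ r] exI[of _ w]) auto
qed

lemma U_ideal_right:
  assumes "r \<in> U_ideal" "p \<in> FL"
  shows "fa_mult r p \<in> U_ideal"
proof (rule fa_mult_in_subspace[OF subspace_U_ideal])
  show "p \<in> fa.span (fa_word ` lists L)" using assms(2) by (simp add: fa_over_span)
  show "r \<in> fa.span {fa_mult (fa_mult (fa_word v) r) (fa_word w) | v r w.
        v \<in> lists L \<and> w \<in> lists L \<and> r \<in> uea_rels s L br}"
    using assms(1) by (simp add: uea_ideal_def)
  fix x y
  assume "y \<in> fa_word ` lists L" and
    "x \<in> {fa_mult (fa_mult (fa_word v) r) (fa_word w) | v r w.
        v \<in> lists L \<and> w \<in> lists L \<and> r \<in> uea_rels s L br}"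
  then obtain u v r w where *: "y = fa_word u" "x = fa_mult (fa_mult (fa_word v) r) (fa_word w)"
    "u \<in> lists L" "v \<in> lists L" "w \<in> lists L" "r \<in> uea_rels s L br" by auto
  then have "fa_mult x y = fa_mult (fa_mult (fa_word v) r) (fa_word (w @ u))"
    by (simp add: fa_mult_assoc flip: fa_mult_word)
  with * show "fa_mult x y \<in> U_ideal"
    unfolding uea_ideal_def
    by (intro fa.span_base CollectI exI[of _ v] exI[of _ r] exI[of _ "w @ u"]) auto
qed

lemma linear_U_proj: "Vector_Spaces.linear fa_scale fa_scale U_proj"
  unfolding uea_proj_def by (rule quot_map_props(1)[OF vector_space_fa_scale subspace_U_ideal])

sublocale U_proj: Vector_Spaces.linear fa_scale fa_scale U_proj
  by (rule linear_U_proj)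

lemma U_proj_diff_in: "U_proj p - p \<in> U_ideal"
  unfolding uea_proj_def by (rule quot_map_diff_in[OF vector_space_fa_scale subspace_U_ideal])

lemma U_proj_eq_iff: "U_proj p = U_proj q \<longleftrightarrow> p - q \<in> U_ideal"
  unfolding uea_proj_def by (rule quot_map_eq_iff[OF vector_space_fa_scale subspace_U_ideal])

lemma U_proj_idem [simp]: "U_proj (U_proj p) = U_proj p"
  unfolding uea_proj_def by (rule quot_map_props(2)[OF vector_space_fa_scale subspace_U_ideal])

lemma U_proj_over:
  assumes "p \<in> FL" shows "U_proj p \<in> FL"
proof -
  have "U_proj p = (U_proj p - p) + p" by simp
  moreover have "U_proj p - p \<in> FL" using U_proj_diff_in U_ideal_over by blast
  ultimately show ?thesis using assms fa.subspace_add[OF subspace_fa_over] by metis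
qed

lemma U_carrier_eq: "uea_carrier s L br = U_proj ` FL"
  by (simp add: uea_carrier_def fa_over_def)

lemma U_mult_proj:
  assumes "p \<in> FL" "q \<in> FL"
  shows "uea_mult s L br (U_proj p) (U_proj q) = U_proj (fa_mult p q)"
proof -
  have "fa_mult (U_proj p) (U_proj q) - fa_mult p q =
      fa_mult (U_proj p - p) (U_proj q) + fa_mult p (U_proj q - q)"
    by (simp add: fa_mult_diff_left fa_mult_diff_right)
  also have "\<dots> \<in> U_ideal"
    using assms by (intro fa.subspace_add[OF subspace_U_ideal] U_ideal_left U_ideal_right
        U_proj_diff_in U_proj_over)
  finally show ?thesis unfolding uea_mult_def U_proj_eq_iff .
qed

lemma U_proj_rel:
  assumes "r \<in> uea_rels s L br" "v \<in> lists L" "w \<in> FL"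
  shows "U_proj (fa_mult (fa_mult (fa_word v) r) w) = 0"
proof -
  have "fa_mult (fa_word []) r \<in> U_ideal"
    unfolding uea_ideal_def using assms(1)
    by (intro fa.span_base) (metis (mono_tags, lifting) fa_mult_one(1,2) lists.Nil mem_Collect_eq)
  then have "fa_mult (fa_mult (fa_word v) r) w \<in> U_ideal"
    using assms by (intro U_ideal_left U_ideal_right) (auto intro: fa_word_in_over)
  then show ?thesis
    using U_proj_eq_iff[of _ 0] by (simp add: U_proj.zero)
qed

end


section \<open>The induced module\<close>

lemma linear_addD: "Vector_Spaces.linear s s' f \<Longrightarrow> f (x + y) = f x + f y"
  by (rule module_hom.add) (rule Vector_Spaces.linear.axioms(3))

lemma linear_scaleD: "Vector_Spaces.linear s s' f \<Longrightarrow> f (s c x) = s' c (f x)"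
  by (rule module_hom.scale) (rule Vector_Spaces.linear.axioms(3))

lemma linear_zeroD: "Vector_Spaces.linear s s' f \<Longrightarrow> f 0 = 0"
  by (rule module_hom.zero) (rule Vector_Spaces.linear.axioms(3))

lemma linear_diffD: "Vector_Spaces.linear s s' f \<Longrightarrow> f (x - y) = f x - f y"
  by (rule module_hom.diff) (rule Vector_Spaces.linear.axioms(3))

context vertex_algebroid
begin

lemma anchor_linear_right: "Vector_Spaces.linear (smA X) (smA X) (anchor X v)"
  using anchor_derivation unfolding derivation_on_def by blast

lemma anchor_mult: "anchor X v (a * a') = anchor X v a * a' + a * anchor X v a'"
  using anchor_derivation unfolding derivation_on_def by blast

lemmas algebroid_linear =
  actB_linear_left actB_linear_right brB_linear_left brB_linear_right
  anchor_linear anchor_linear_right pairB_linear_left pairB_linear_right del_linear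

lemmas op_add = algebroid_linear[THEN linear_addD]
lemmas op_scale = algebroid_linear[THEN linear_scaleD]
lemmas op_zero = algebroid_linear[THEN linear_zeroD]
lemmas op_diff = algebroid_linear[THEN linear_diffD]

lemma unitA_right: "a * unitA X = a"
  using unitA[of a] by (simp add: mult.commute)

lemma anchor_unit [simp]: "anchor X v (unitA X) = 0"
  using anchor_mult[of v "unitA X" "unitA X"] by (simp add: unitA unitA_right)

sublocale A: vector_space "smA X" by (rule vs_A)
sublocale B: vector_space "smB X" by (rule vs_B)

sublocale C: vector_space "smC X"
  by unfold_locales
    (auto simp: smC_def A.scale_right_distrib B.scale_right_distrib A.scale_left_distrib
      B.scale_left_distrib)

sublocale loop: vector_space "smLoop X"
  by (rule vector_space_pm_scale[OF C.vector_space_axioms])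

lemma prod0_add_left: "prod0 X (u + u') v = prod0 X u v + prod0 X u' v"
  by (simp add: prod0_def op_add)

lemma prod0_add_right: "prod0 X u (v + v') = prod0 X u v + prod0 X u v'"
  by (simp add: prod0_def op_add)

lemma prod1_add_left: "prod1 X (u + u') v = prod1 X u v + prod1 X u' v"
  by (simp add: prod1_def op_add)

lemma prod1_add_right: "prod1 X u (v + v') = prod1 X u v + prod1 X u v'"
  by (simp add: prod1_def op_add)

lemma prod0_scale_left: "prod0 X (smC X c u) v = smC X c (prod0 X u v)"
  by (simp add: prod0_def smC_def op_scale A.scale_right_diff_distrib)

lemma prod0_scale_right: "prod0 X u (smC X c v) = smC X c (prod0 X u v)"
  by (simp add: prod0_def smC_def op_scale A.scale_right_diff_distrib)

lemma prod1_scale_left: "prod1 X (smC X c u) v = smC X c (prod1 X u v)"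
  by (simp add: prod1_def smC_def op_scale)

lemma prod1_scale_right: "prod1 X u (smC X c v) = smC X c (prod1 X u v)"
  by (simp add: prod1_def smC_def op_scale)

lemmas prod_add = prod0_add_left prod0_add_right prod1_add_left prod1_add_right
lemmas prod_scale = prod0_scale_left prod0_scale_right prod1_scale_left prod1_scale_right

section \<open>The loop bracket and its descent to the quotient Lie algebra\<close>

lemma loop_bracket_pm_sum:
  "loop_bracket X x y = pm_sum (\<lambda>m u. pm_sum (\<lambda>n v. Poly_Mapping.single (m + n) (prod0 X u v) +
     Poly_Mapping.single (m + n - 1) (smC X (of_int m) (prod1 X u v))) y) x"
  by (simp add: loop_bracket_def pm_sum_def)

lemma loop_bracket_add_right: "loop_bracket X x (y + z) = loop_bracket X x y + loop_bracket X x z"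
  unfolding loop_bracket_pm_sum
  by (subst pm_sum_fun_add[symmetric], rule pm_sum_cong, rule pm_sum_add)
    (simp add: prod_add single_add C.scale_right_distrib add_ac)

lemma loop_bracket_add_left: "loop_bracket X (x + y) z = loop_bracket X x z + loop_bracket X y z"
  unfolding loop_bracket_pm_sum
  by (rule pm_sum_add, subst pm_sum_fun_add[symmetric], rule pm_sum_cong)
    (simp add: prod_add single_add C.scale_right_distrib add_ac)

lemma prod_zero [simp]: "prod0 X 0 v = 0" "prod0 X u 0 = 0" "prod1 X 0 v = 0" "prod1 X u 0 = 0"
  by (simp_all add: prod0_def prod1_def op_zero zero_prod_def)

lemma loop_bracket_single:
  "loop_bracket X (Poly_Mapping.single m u) (Poly_Mapping.single n v) =
     Poly_Mapping.single (m + n) (prod0 X u v) +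
     Poly_Mapping.single (m + n - 1) (smC X (of_int m) (prod1 X u v))"
  unfolding loop_bracket_pm_sum
  by (subst pm_sum_single; subst pm_sum_single; simp add: pm_sum_def)

lemma loop_bracket_zero [simp]: "loop_bracket X 0 y = 0" "loop_bracket X x 0 = 0"
  using loop_bracket_add_left[of 0 0 y] loop_bracket_add_right[of x 0 0] by simp_all

lemma loop_bracket_scale_left: "loop_bracket X (smLoop X c x) y = smLoop X c (loop_bracket X x y)"
  unfolding loop_bracket_pm_sum
proof (rule pm_sum_scale[OF C.vector_space_axioms loop.vector_space_axioms])
  fix k d u
  show "pm_sum (\<lambda>n v. Poly_Mapping.single (k + n) (prod0 X (smC X d u) v) +
      Poly_Mapping.single (k + n - 1) (smC X (of_int k) (prod1 X (smC X d u) v))) y =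
    smLoop X d (pm_sum (\<lambda>n v. Poly_Mapping.single (k + n) (prod0 X u v) +
      Poly_Mapping.single (k + n - 1) (smC X (of_int k) (prod1 X u v))) y)"
    by (simp add: pm_sum_def loop.scale_sum_right loop.scale_right_distrib prod_scale
        pm_scale_single[OF C.vector_space_axioms] mult.commute)
qed

lemma loop_bracket_scale_right: "loop_bracket X x (smLoop X c y) = smLoop X c (loop_bracket X x y)"
proof (induction x rule: poly_mapping_single_induct)
  case (single m u)
  show ?case
    by (induction y rule: poly_mapping_single_induct)
      (simp_all add: loop_bracket_add_right loop.scale_right_distrib loop_bracket_single prod_scale
        pm_scale_single[OF C.vector_space_axioms] mult.commute)
qed (simp_all add: loop_bracket_add_left loop.scale_right_distrib)

definition del_hat :: "int \<Rightarrow> 'a \<Rightarrow> ('a, 'b) loop" where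
  "del_hat n a = Poly_Mapping.single n (0, del X a) + Poly_Mapping.single (n - 1) (smA X (of_int n) a, 0)"

lemma del_hat_image_span: "del_hat_image X = loop.span {del_hat n a | n a. True}"
  by (simp add: del_hat_image_def del_hat_def)

lemma subspace_del_hat_image: "loop.subspace (del_hat_image X)"
  by (simp add: del_hat_image_span)

lemma del_hat_in: "del_hat n a \<in> del_hat_image X"
  unfolding del_hat_image_span by (rule loop.span_base) auto

lemma brB_del_left [simp]: "brB X (del X a) v = 0"
  using brB_sym[of "del X a" v] pairB_del[of v a] by (simp add: brB_del pairB_sym)

lemma pairB_del_left [simp]: "pairB X (del X a) v = anchor X v a"
  using pairB_del pairB_sym by metis

lemma prod_del [simp]:
  "prod0 X (0, del X a) v = 0" "prod0 X v (0, del X a) = (0, del X (anchor X (snd v) a))"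
  "prod1 X (0, del X a) v = (anchor X (snd v) a, 0)" "prod1 X v (0, del X a) = (anchor X (snd v) a, 0)"
  by (simp_all add: prod0_def prod1_def op_zero anchor_del brB_del pairB_del zero_prod_def)

lemma prod_A [simp]:
  "prod0 X (a, 0) v = (- anchor X (snd v) a, 0)" "prod0 X v (a, 0) = (anchor X (snd v) a, 0)"
  "prod1 X (a, 0) v = 0" "prod1 X v (a, 0) = 0"
  by (simp_all add: prod0_def prod1_def op_zero zero_prod_def)

lemma smC_A [simp]: "smC X c (a, 0) = (smA X c a, 0)"
  by (simp add: smC_def)

text \<open>The bracket vanishes before passing to the quotient: [del a, v] = 0, while the term n
  <del a, v> = n pi(v)(a) cancels (n a)_0 v = - n pi(v)(a) in the same power of t.\<close>

lemma loop_bracket_del_hat_left: "loop_bracket X (del_hat n a) y = 0"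
proof (induction y rule: poly_mapping_single_induct)
  case (single k v)
  have e: "n + k - 1 = n - 1 + k" by simp
  show ?case
    by (simp add: del_hat_def loop_bracket_add_left loop_bracket_single op_scale e)
      (simp add: e flip: single_add zero_prod_def)
qed (simp_all add: loop_bracket_add_right)

text \<open>On this side the bracket with a monomial is again a generator: in the A-component the
  summand \<open>k\<close> comes from the derivative term of the bracket and \<open>n\<close> from
  the generator, which gives the factor \<open>k + n\<close> of
  \<open>del_hat (k + n)\<close>.\<close>

lemma loop_bracket_del_hat_right: "loop_bracket X y (del_hat n a) \<in> del_hat_image X"
proof (induction y rule: poly_mapping_single_induct)
  case (single k v)
  have e: "k + (n - 1) = k + n - 1" by simp
  have "loop_bracket X (Poly_Mapping.single k v) (del_hat n a) = del_hat (k + n) (anchor X (snd v) a)"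
    by (simp add: del_hat_def loop_bracket_add_right loop_bracket_single op_scale e
        A.scale_left_distrib flip: single_add)
  then show ?case by (simp add: del_hat_in)
qed (simp_all add: loop_bracket_add_left loop.subspace_0[OF subspace_del_hat_image]
      loop.subspace_add[OF subspace_del_hat_image])

lemma linear_lie_proj: "Vector_Spaces.linear (smLoop X) (smLoop X) (lie_proj X)"
  unfolding lie_proj_def by (rule quot_map_props(1)[OF loop.vector_space_axioms subspace_del_hat_image])

sublocale lie_proj: Vector_Spaces.linear "smLoop X" "smLoop X" "lie_proj X"
  by (rule linear_lie_proj)

lemma lie_proj_eq_iff: "lie_proj X x = lie_proj X y \<longleftrightarrow> x - y \<in> del_hat_image X"
  unfolding lie_proj_def by (rule quot_map_eq_iff[OF loop.vector_space_axioms subspace_del_hat_image])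

lemma lie_proj_diff_in: "lie_proj X x - x \<in> del_hat_image X"
  unfolding lie_proj_def by (rule quot_map_diff_in[OF loop.vector_space_axioms subspace_del_hat_image])

lemma loop_bracket_minus: "loop_bracket X (x - x') y = loop_bracket X x y - loop_bracket X x' y"
  "loop_bracket X y (x - x') = loop_bracket X y x - loop_bracket X y x'"
  using loop_bracket_add_left[of "x - x'" x' y] loop_bracket_add_right[of y "x - x'" x']
  by (simp_all add: algebra_simps)

lemma loop_bracket_del_hat_image_left:
  assumes "d \<in> del_hat_image X"
  shows "loop_bracket X d y \<in> del_hat_image X"
  using assms unfolding del_hat_image_span
proof (induction d rule: loop.span_induct)
  case base
  show ?case
    by (rule loop.subspaceI)
      (auto simp: loop_bracket_add_left loop_bracket_scale_left loop.span_zero loop.span_add loop.span_scale)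
qed (auto simp: loop_bracket_del_hat_left loop.span_zero)

lemma loop_bracket_del_hat_image_right:
  assumes "d \<in> del_hat_image X"
  shows "loop_bracket X y d \<in> del_hat_image X"
  using assms unfolding del_hat_image_span
proof (induction d rule: loop.span_induct)
  case base
  show ?case
    by (rule loop.subspaceI)
      (auto simp: loop_bracket_add_right loop_bracket_scale_right loop.span_zero loop.span_add loop.span_scale)
qed (use loop_bracket_del_hat_right[unfolded del_hat_image_span] in auto)

lemma lie_bracket_proj: "lie_bracket X (lie_proj X x) (lie_proj X y) = lie_proj X (loop_bracket X x y)"
proof -
  have "loop_bracket X (lie_proj X x) (lie_proj X y) - loop_bracket X x y =
      loop_bracket X (lie_proj X x - x) (lie_proj X y) + loop_bracket X x (lie_proj X y - y)"
    by (simp add: loop_bracket_minus)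
  also have "\<dots> \<in> del_hat_image X"
    by (intro loop.subspace_add[OF subspace_del_hat_image] loop_bracket_del_hat_image_left
        loop_bracket_del_hat_image_right lie_proj_diff_in)
  finally show ?thesis unfolding lie_bracket_def lie_proj_eq_iff .
qed

lemma subspace_lie_carrier: "loop.subspace (lie_carrier X)"
  unfolding lie_carrier_def by (rule lie_proj.subspace_image) simp

lemma lie_proj_in [simp]: "lie_proj X x \<in> lie_carrier X"
  by (simp add: lie_carrier_def)

sublocale enveloping "smLoop X" "lie_carrier X" "lie_bracket X"
  by unfold_locales (auto simp: subspace_lie_carrier lie_bracket_def)

section \<open>The induced module presented by words, and its modes\<close>

lemma subspace_VL_kernel: "fa.subspace (VL_kernel X)"
  by (simp add: VL_kernel_def)

lemma linear_VL_proj: "Vector_Spaces.linear fa_scale fa_scale (VL_proj X)"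
  unfolding VL_proj_def by (rule quot_map_props(1)[OF vector_space_fa_scale subspace_VL_kernel])

sublocale VL_proj: Vector_Spaces.linear fa_scale fa_scale "VL_proj X"
  by (rule linear_VL_proj)

lemma VL_proj_diff_in: "VL_proj X x - x \<in> VL_kernel X"
  unfolding VL_proj_def by (rule quot_map_diff_in[OF vector_space_fa_scale subspace_VL_kernel])

lemma VL_proj_zero_iff: "VL_proj X x = 0 \<longleftrightarrow> x \<in> VL_kernel X"
  unfolding VL_proj_def by (rule quot_map_kernel[OF vector_space_fa_scale subspace_VL_kernel])

lemma U_proj_mult_left: "q \<in> FL \<Longrightarrow> U_proj (fa_mult (U_proj p) q) = U_proj (fa_mult p q)"
  unfolding U_proj_eq_iff fa_mult_diff_left[symmetric] by (intro U_ideal_right U_proj_diff_in)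

lemma U_proj_mult_right: "p \<in> FL \<Longrightarrow> U_proj (fa_mult p (U_proj q)) = U_proj (fa_mult p q)"
  unfolding U_proj_eq_iff fa_mult_diff_right[symmetric] by (intro U_ideal_left U_proj_diff_in)

lemma letter_over: "x \<in> lie_carrier X \<Longrightarrow> fa_word [x] \<in> FL"
  by (intro fa_word_in_over) auto

lemma lie_nonneg_carrier: "h \<in> lie_nonneg X \<Longrightarrow> h \<in> lie_carrier X"
  by (auto simp: lie_nonneg_def)

lemma VL_kernel_gens:
  "VL_kernel X = fa.span {U_proj (fa_mult p (fa_word [h])) | p h. p \<in> FL \<and> h \<in> lie_nonneg X}"
proof -
  have *: "U_mult X (U_proj p) (U_gen X h) = U_proj (fa_mult p (fa_word [h]))"
    if "p \<in> FL" "h \<in> lie_nonneg X" for p h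
    unfolding uea_gen_def using that by (intro U_mult_proj letter_over lie_nonneg_carrier)
  then have "{U_mult X x (U_gen X h) | x h. x \<in> U_carrier X \<and> h \<in> lie_nonneg X} =
      {U_proj (fa_mult p (fa_word [h])) | p h. p \<in> FL \<and> h \<in> lie_nonneg X}"
    unfolding U_carrier_eq by (auto; metis (no_types, lifting) * image_eqI)
  then show ?thesis by (simp add: VL_kernel_def)
qed

lemma VL_kernel_over: "VL_kernel X \<subseteq> FL"
  unfolding VL_kernel_gens
  by (rule fa.span_minimal)
    (auto intro!: subspace_fa_over U_proj_over fa_mult_over letter_over lie_nonneg_carrier)

lemma VL_kernel_left:
  assumes "p \<in> FL" "k \<in> VL_kernel X"
  shows "U_proj (fa_mult p k) \<in> VL_kernel X"
  using assms(2) unfolding VL_kernel_gens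
proof (induction k rule: fa.span_induct)
  case base
  show ?case
    by (rule fa.subspaceI)
      (auto simp: fa_mult_add_right U_proj.add U_proj.zero U_proj.scale fa_mult_scale_right
        fa.span_zero fa.span_add fa.span_scale)
next
  case (step k)
  then obtain q h where qh: "k = U_proj (fa_mult q (fa_word [h]))" "q \<in> FL" "h \<in> lie_nonneg X"
    by auto
  then have "U_proj (fa_mult p k) = U_proj (fa_mult (fa_mult p q) (fa_word [h]))"
    using assms(1) by (simp add: U_proj_mult_right fa_mult_assoc)
  then show ?case
    by (intro fa.span_base CollectI exI[of _ "fa_mult p q"] exI[of _ h])
      (use qh assms(1) fa_mult_over in auto)
qed

text \<open>The composite of the quotient maps from the free algebra to U(L) and on to V_L. The
  action of U(L) becomes concatenation of words (\<open>VL_act_quot\<close>), so identities in V_L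
  are checked on words.\<close>

definition VL_quot :: "('a, 'b) loop free_alg \<Rightarrow> ('a, 'b) loop free_alg" where
  "VL_quot p = VL_proj X (U_proj p)"

lemma VL_quot_linear [simp]:
  "VL_quot (p + q) = VL_quot p + VL_quot q" "VL_quot 0 = 0" "VL_quot (fa_scale c p) = fa_scale c (VL_quot p)"
  "VL_quot (p - q) = VL_quot p - VL_quot q"
  by (simp_all add: VL_quot_def U_proj.add U_proj.zero U_proj.scale U_proj.diff
      VL_proj.add VL_proj.zero VL_proj.scale VL_proj.diff)

lemma VL_eq: "VL X = VL_quot ` FL"
  by (auto simp: VL_def U_carrier_eq VL_quot_def)

lemma VL_vac_eq: "VL_vac X = VL_quot (fa_word [])"
  by (simp add: VL_vac_def uea_one_def VL_quot_def)

lemma VL_over: "VL X \<subseteq> FL"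
proof
  fix v assume "v \<in> VL X"
  then obtain p where p: "p \<in> FL" "v = VL_proj X (U_proj p)" by (auto simp: VL_eq VL_quot_def)
  have "VL_proj X (U_proj p) - U_proj p \<in> FL"
    by (rule subsetD[OF VL_kernel_over VL_proj_diff_in])
  from fa.subspace_add[OF subspace_fa_over this U_proj_over[OF p(1)]]
  show "v \<in> FL" using p by simp
qed

lemma subspace_VL: "fa.subspace (VL X)"
  unfolding VL_def
  by (rule VL_proj.subspace_image)
    (simp add: U_carrier_eq U_proj.subspace_image subspace_fa_over)

lemma VL_act_quot:
  assumes "p \<in> FL" "q \<in> FL"
  shows "VL_act X (U_proj p) (VL_quot q) = VL_quot (fa_mult p q)"
proof -
  have v: "VL_quot q \<in> FL" using VL_over VL_eq assms by blast
  define k where "k = VL_quot q - U_proj q"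
  have k: "k \<in> VL_kernel X" by (simp add: k_def VL_quot_def VL_proj_diff_in)
  have "U_mult X (U_proj p) (VL_quot q) = U_proj (fa_mult p (VL_quot q))"
    using v by (simp add: uea_mult_def U_proj_mult_left)
  also have "\<dots> = U_proj (fa_mult p (U_proj q + k))" by (simp add: k_def)
  finally have "U_mult X (U_proj p) (VL_quot q) = U_proj (fa_mult p q) + U_proj (fa_mult p k)"
    using assms by (simp add: fa_mult_add_right U_proj.add U_proj_mult_right)
  moreover have "VL_proj X (U_proj (fa_mult p k)) = 0"
    using VL_kernel_left[OF assms(1) k] by (simp add: VL_proj_zero_iff)
  ultimately show ?thesis by (simp add: VL_act_def VL_quot_def VL_proj.add)
qed

lemma VL_act_add_right: "VL_act X x (v + w) = VL_act X x v + VL_act X x w"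
  by (simp add: VL_act_def uea_mult_def fa_mult_add_right U_proj.add VL_proj.add)

lemma VL_act_scale_right: "VL_act X x (fa_scale c v) = fa_scale c (VL_act X x v)"
  by (simp add: VL_act_def uea_mult_def fa_mult_scale_right U_proj.scale VL_proj.scale)

definition lie_act :: "('a, 'b) loop \<Rightarrow> ('a, 'b) loop free_alg \<Rightarrow> ('a, 'b) loop free_alg" where
  "lie_act x v = VL_act X (U_gen X x) v"

lemma lie_act_quot:
  "x \<in> lie_carrier X \<Longrightarrow> q \<in> FL \<Longrightarrow> lie_act x (VL_quot q) = VL_quot (fa_mult (fa_word [x]) q)"
  unfolding lie_act_def uea_gen_def by (intro VL_act_quot letter_over)

lemma VL_mode_lie_act: "VL_mode X u n v = lie_act (lie_proj X (Poly_Mapping.single n u)) v"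
  by (simp add: VL_mode_def lie_act_def)

lemma lie_act_linear_right:
  "lie_act x (v + w) = lie_act x v + lie_act x w" "lie_act x (fa_scale c v) = fa_scale c (lie_act x v)"
  by (simp_all add: lie_act_def VL_act_add_right VL_act_scale_right)

lemma lie_act_rel:
  assumes "r \<in> uea_rels (smLoop X) (lie_carrier X) (lie_bracket X)" "q \<in> FL"
  shows "VL_quot (fa_mult r q) = 0"
  using U_proj_rel[OF assms(1), of "[]" q] assms(2) by (simp add: VL_quot_def VL_proj.zero)

lemma lie_act_add_left:
  assumes "x \<in> lie_carrier X" "y \<in> lie_carrier X" "v \<in> VL X"
  shows "lie_act (x + y) v = lie_act x v + lie_act y v"
proof -
  obtain q where q: "v = VL_quot q" "q \<in> FL" using assms(3) by (auto simp: VL_eq)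
  have "fa_word [x + y] - fa_word [x] - fa_word [y] \<in> uea_rels (smLoop X) (lie_carrier X) (lie_bracket X)"
    using assms unfolding uea_rels_def by blast
  from lie_act_rel[OF this q(2)] q assms show ?thesis
    by (simp add: lie_act_quot loop.subspace_add[OF subspace_lie_carrier] fa_mult_diff_left fa_mult_add_left algebra_simps)
qed

lemma lie_act_scale_left:
  assumes "x \<in> lie_carrier X" "v \<in> VL X"
  shows "lie_act (smLoop X c x) v = fa_scale c (lie_act x v)"
proof -
  obtain q where q: "v = VL_quot q" "q \<in> FL" using assms(2) by (auto simp: VL_eq)
  have "fa_word [smLoop X c x] - fa_scale c (fa_word [x]) \<in> uea_rels (smLoop X) (lie_carrier X) (lie_bracket X)"
    using assms unfolding uea_rels_def by blast
  from lie_act_rel[OF this q(2)] q assms show ?thesis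
    by (simp add: lie_act_quot loop.subspace_scale[OF subspace_lie_carrier] fa_mult_diff_left fa_mult_scale_left)
qed

lemma lie_act_bracket:
  assumes "x \<in> lie_carrier X" "y \<in> lie_carrier X" "v \<in> VL X"
  shows "lie_act x (lie_act y v) - lie_act y (lie_act x v) = lie_act (lie_bracket X x y) v"
proof -
  obtain q where q: "v = VL_quot q" "q \<in> FL" using assms(3) by (auto simp: VL_eq)
  have "fa_word [x, y] - fa_word [y, x] - fa_word [lie_bracket X x y]
      \<in> uea_rels (smLoop X) (lie_carrier X) (lie_bracket X)"
    using assms unfolding uea_rels_def by blast
  from lie_act_rel[OF this q(2)] q assms show ?thesis
    by (simp add: lie_act_quot br_in fa_mult_over letter_over fa_mult_diff_left
        flip: fa_mult_assoc)
qed

lemma lie_act_in: "x \<in> lie_carrier X \<Longrightarrow> v \<in> VL X \<Longrightarrow> lie_act x v \<in> VL X"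
  by (auto simp: VL_eq lie_act_quot intro!: imageI fa_mult_over letter_over)

lemma lie_act_zero_left [simp]: "v \<in> VL X \<Longrightarrow> lie_act 0 v = 0"
  using lie_act_scale_left[of 0 v 0] lie_proj_in[of 0] by (simp add: lie_proj.zero)

text \<open>Letters of a word are arbitrary elements of the Lie algebra. Writing their action as a
  finite sum of modes is what makes closure under the u(n) imply closure under U(L).\<close>

lemma lie_act_loop:
  assumes "v \<in> VL X"
  shows "lie_act (lie_proj X x) v = pm_sum (\<lambda>n u. VL_mode X u n v) x"
proof (induction x rule: poly_mapping_single_induct)
  case (single k x)
  have "VL_mode X 0 k v = 0" using assms by (simp add: VL_mode_lie_act lie_proj.zero)
  then show ?case by (simp add: pm_sum_single) (simp add: VL_mode_lie_act)
next
  case (add p q)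
  have "VL_mode X (u + u') n v = VL_mode X u n v + VL_mode X u' n v" for u u' n
    using assms by (simp add: VL_mode_lie_act single_add lie_proj.add lie_act_add_left)
  then show ?case using add assms
    by (simp add: lie_proj.add lie_act_add_left pm_sum_add)
qed (use assms in \<open>simp add: lie_proj.zero\<close>)

lemma VL_vac_in: "VL_vac X \<in> VL X"
  by (auto simp: VL_vac_eq VL_eq intro!: imageI fa_word_in_over)

lemma VL_mode_vac:
  assumes "n \<ge> 0"
  shows "VL_mode X u n (VL_vac X) = 0"
proof -
  let ?h = "lie_proj X (Poly_Mapping.single n u)"
  have h: "?h \<in> lie_nonneg X" using assms unfolding lie_nonneg_def by auto
  have "U_proj (fa_mult (fa_word []) (fa_word [?h])) \<in> VL_kernel X"
    unfolding VL_kernel_gens using h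
    by (intro fa.span_base CollectI exI[of _ "fa_word []"] exI[of _ ?h]) (auto intro!: fa_word_in_over)
  moreover have "fa_word [] \<in> FL" by (intro fa_word_in_over) auto
  ultimately show ?thesis
    by (simp add: VL_mode_lie_act VL_vac_eq lie_act_quot)
      (simp add: VL_quot_def VL_proj_zero_iff)
qed

lemma VL_induct_subspace:
  assumes S: "fa.subspace S" and vac: "VL_vac X \<in> S"
    and mode: "\<And>u n v. v \<in> S \<Longrightarrow> v \<in> VL X \<Longrightarrow> VL_mode X u n v \<in> S"
  shows "VL X \<subseteq> S"
proof
  have w: "VL_quot (fa_word w) \<in> S \<and> VL_quot (fa_word w) \<in> VL X" if "w \<in> lists (lie_carrier X)" for w
    using that
  proof (induction w)
    case Nil
    then show ?case using vac VL_vac_in by (simp add: VL_vac_eq)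
  next
    case (Cons x w)
    then obtain y where y: "x = lie_proj X y" by (auto simp: lie_carrier_def)
    have IH: "VL_quot (fa_word w) \<in> S" "VL_quot (fa_word w) \<in> VL X"
      and wFL: "fa_word w \<in> FL" using Cons by (auto intro!: fa_word_in_over)
    have "VL_quot (fa_word (x # w)) = lie_act x (VL_quot (fa_word w))"
      using Cons wFL by (simp add: lie_act_quot)
    moreover have "lie_act x (VL_quot (fa_word w)) \<in> S"
      unfolding y lie_act_loop[OF IH(2)] pm_sum_def
      by (intro fa.subspace_sum[OF S] mode IH)
    ultimately show ?case using lie_act_in[OF _ IH(2)] Cons by auto
  qed
  fix v assume "v \<in> VL X"
  then obtain p where p: "p \<in> FL" "v = VL_quot p" by (auto simp: VL_eq)
  from p(1) have "VL_quot p \<in> S"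
    by (induction p rule: fa_over_induct)
      (auto simp: w fa.subspace_0[OF S] fa.subspace_add[OF S] fa.subspace_scale[OF S])
  then show "v \<in> S" using p by simp
qed

lemma VL_mode_in: "v \<in> VL X \<Longrightarrow> VL_mode X u n v \<in> VL X"
  by (simp add: VL_mode_lie_act lie_act_in)

lemma VL_act_in_subspace:
  assumes S: "fa.subspace S" "S \<subseteq> VL X" and mode: "\<And>u n v. v \<in> S \<Longrightarrow> VL_mode X u n v \<in> S"
    and "x \<in> U_carrier X" "v \<in> S"
  shows "VL_act X x v \<in> S"
proof -
  obtain q where q: "v = VL_quot q" "q \<in> FL" using assms by (auto simp: VL_eq)
  have w: "VL_quot (fa_mult (fa_word w) q) \<in> S" if "w \<in> lists (lie_carrier X)" for w
    using that
  proof (induction w)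
    case Nil
    then show ?case using assms q by simp
  next
    case (Cons x w)
    then obtain y where y: "x = lie_proj X y" by (auto simp: lie_carrier_def)
    let ?v = "VL_quot (fa_mult (fa_word w) q)"
    have IH: "?v \<in> S" using Cons by auto
    have wFL: "fa_mult (fa_word w) q \<in> FL" using Cons q by (auto intro!: fa_word_in_over fa_mult_over)
    have "VL_quot (fa_mult (fa_word (x # w)) q) = lie_act x ?v"
      using Cons wFL by (simp add: lie_act_quot flip: fa_mult_assoc)
    moreover have "lie_act x ?v \<in> S"
      unfolding y lie_act_loop[OF subsetD[OF S(2) IH]] pm_sum_def
      by (intro fa.subspace_sum[OF S(1)] mode IH)
    ultimately show ?case by auto
  qed
  obtain p where p: "x = U_proj p" "p \<in> FL" using assms by (auto simp: U_carrier_eq)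
  from p(2) have "VL_quot (fa_mult p q) \<in> S"
    by (induction p rule: fa_over_induct)
      (auto simp: w fa_mult_add_left fa_mult_scale_left fa.subspace_0[OF S(1)]
        fa.subspace_add[OF S(1)] fa.subspace_scale[OF S(1)])
  then show ?thesis using p q by (simp add: VL_act_quot)
qed

lemma VL_act_mode:
  assumes "x \<in> U_carrier X" "v \<in> VL X"
  shows "\<exists>x'\<in>U_carrier X. VL_mode X u n (VL_act X x v) = VL_act X x' v"
proof -
  obtain q where q: "v = VL_quot q" "q \<in> FL" using assms by (auto simp: VL_eq)
  obtain p where p: "x = U_proj p" "p \<in> FL" using assms by (auto simp: U_carrier_eq)
  let ?l = "fa_word [lie_proj X (Poly_Mapping.single n u)]"
  have l: "?l \<in> FL" by (simp add: letter_over)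
  have "VL_mode X u n (VL_act X x v) = VL_act X (U_proj (fa_mult ?l p)) v"
    using p q l by (simp add: VL_act_quot VL_mode_lie_act lie_act_quot fa_mult_over fa_mult_assoc)
  then show ?thesis using p l fa_mult_over by (auto simp: U_carrier_eq)
qed

lemma VL_mode_add_right: "VL_mode X u n (v + w) = VL_mode X u n v + VL_mode X u n w"
  by (simp add: VL_mode_lie_act lie_act_linear_right)

lemma VL_mode_scale_right: "VL_mode X u n (fa_scale c v) = fa_scale c (VL_mode X u n v)"
  by (simp add: VL_mode_lie_act lie_act_linear_right)

lemma VL_mode_add_left: "v \<in> VL X \<Longrightarrow> VL_mode X (u + u') n v = VL_mode X u n v + VL_mode X u' n v"
  by (simp add: VL_mode_lie_act single_add lie_proj.add lie_act_add_left)

lemma VL_mode_scale_left: "v \<in> VL X \<Longrightarrow> VL_mode X (smC X c u) n v = fa_scale c (VL_mode X u n v)"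
  by (simp add: VL_mode_lie_act lie_act_scale_left lie_proj.scale
      flip: pm_scale_single[OF C.vector_space_axioms])

lemma VL_mode_del:
  assumes "v \<in> VL X"
  shows "VL_mode X (0, del X a) n v + fa_scale (of_int n) (VL_mode X (a, 0) (n - 1) v) = 0"
proof -
  have "lie_proj X (del_hat n a) = 0"
    using lie_proj_eq_iff[of "del_hat n a" 0] del_hat_in by (simp add: lie_proj.zero)
  with assms have "lie_act (lie_proj X (del_hat n a)) v = 0" by simp
  with assms have "VL_mode X (0, del X a) n v + VL_mode X (smC X (of_int n) (a, 0)) (n - 1) v = 0"
    by (simp add: del_hat_def lie_proj.add lie_act_add_left VL_mode_lie_act)
  with assms show ?thesis by (simp only: VL_mode_scale_left)
qed

lemma VL_mode_comm:
  assumes "w \<in> VL X"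
  shows "VL_mode X u m (VL_mode X v n w) - VL_mode X v n (VL_mode X u m w) =
    VL_mode X (prod0 X u v) (m + n) w + fa_scale (of_int m) (VL_mode X (prod1 X u v) (m + n - 1) w)"
  using assms
  by (simp add: VL_mode_lie_act lie_act_bracket lie_bracket_proj loop_bracket_single lie_proj.add
      lie_act_add_left flip: VL_mode_scale_left[unfolded VL_mode_lie_act])

text \<open>Generators of \<open>IB\<close> are written with a factor from U(L); this exhibits the
  elements of \<open>E_space\<close> and their translates among them.\<close>

lemma VL_act_one:
  assumes "v \<in> VL X"
  shows "\<exists>x\<in>U_carrier X. VL_act X x v = v"
proof -
  obtain q where q: "v = VL_quot q" "q \<in> FL" using assms by (auto simp: VL_eq)
  have 1: "fa_word [] \<in> FL" by (intro fa_word_in_over) auto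
  have "VL_act X (U_proj (fa_word [])) v = v"
    using q 1 by (simp add: VL_act_quot)
  then show ?thesis using 1 by (auto simp: U_carrier_eq)
qed

end


section \<open>The universal property of the induced module\<close>

text \<open>A module over the quotient Lie algebra given by its modes: \<open>T_del\<close> says
  that the relations divided out of the loop space act by zero, and \<open>T_comm\<close> is the
  bracket on monomials. The carrier \<open>S\<close> accommodates modules that are subspaces of
  their type, as are the coinduced functions and \<open>VL X\<close>.\<close>

locale mode_module = vertex_algebroid X + W: vector_space sW
  for X :: "('a::comm_ring, 'b::ab_group_add) algebroid"
    and sW :: "complex \<Rightarrow> 'w::ab_group_add \<Rightarrow> 'w" +
  fixes S :: "'w set" and T :: "'a \<times> 'b \<Rightarrow> int \<Rightarrow> 'w \<Rightarrow> 'w"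
  assumes subspace_S: "W.subspace S"
    and T_in: "x \<in> S \<Longrightarrow> T u n x \<in> S"
    and T_add: "x \<in> S \<Longrightarrow> y \<in> S \<Longrightarrow> T u n (x + y) = T u n x + T u n y"
    and T_scale: "x \<in> S \<Longrightarrow> T u n (sW c x) = sW c (T u n x)"
    and T_add_left: "x \<in> S \<Longrightarrow> T (u + v) n x = T u n x + T v n x"
    and T_scale_left: "x \<in> S \<Longrightarrow> T (smC X c u) n x = sW c (T u n x)"
    and T_del: "x \<in> S \<Longrightarrow> T (0, del X a) n x + sW (of_int n) (T (a, 0) (n - 1) x) = 0"
    and T_comm: "x \<in> S \<Longrightarrow> T u m (T v n x) - T v n (T u m x) =
      T (prod0 X u v) (m + n) x + sW (of_int m) (T (prod1 X u v) (m + n - 1) x)"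
begin

lemma S_closed: "0 \<in> S" "x \<in> S \<Longrightarrow> y \<in> S \<Longrightarrow> x + y \<in> S" "x \<in> S \<Longrightarrow> sW c x \<in> S"
  using subspace_S by (auto intro: W.subspace_0 W.subspace_add W.subspace_scale)

lemma T_zero [simp]: "T u n 0 = 0"
  using T_scale[OF S_closed(1), of u n 0] by simp

lemma T_zero_left [simp]: "x \<in> S \<Longrightarrow> T 0 n x = 0"
  using T_scale_left[of x 0 0 n] by simp

definition loop_op :: "('a, 'b) loop \<Rightarrow> 'w \<Rightarrow> 'w" where
  "loop_op x s = pm_sum (\<lambda>n u. T u n s) x"

context
  fixes s assumes s: "s \<in> S"
begin

lemma loop_op_add_left: "loop_op (x + y) s = loop_op x s + loop_op y s"
  unfolding loop_op_def by (rule pm_sum_add) (simp add: T_add_left s)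

lemma loop_op_single: "loop_op (Poly_Mapping.single n u) s = T u n s"
  unfolding loop_op_def by (rule pm_sum_single) (simp add: s)

lemma loop_op_zero_left [simp]: "loop_op 0 s = 0"
  by (simp add: loop_op_def)

lemma loop_op_scale_left: "loop_op (smLoop X c x) s = sW c (loop_op x s)"
  unfolding loop_op_def
  by (rule pm_sum_scale[OF C.vector_space_axioms W.vector_space_axioms]) (simp add: T_scale_left s)

lemma loop_op_in: "loop_op x s \<in> S"
  unfolding loop_op_def pm_sum_def by (intro W.subspace_sum[OF subspace_S] T_in s)

lemma loop_op_del_hat_image: "d \<in> del_hat_image X \<Longrightarrow> loop_op d s = 0"
  unfolding del_hat_image_span
proof (induction d rule: loop.span_induct)
  case base
  show ?case by (rule loop.subspaceI) (auto simp: loop_op_add_left loop_op_scale_left)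
next
  case (step x)
  then show ?case
    using T_del[OF s] T_scale_left[OF s]
    by (auto simp: del_hat_def loop_op_add_left loop_op_single simp flip: smC_A)
qed

lemma loop_op_lie_proj: "loop_op (lie_proj X x) s = loop_op x s"
  using loop_op_del_hat_image[OF lie_proj_diff_in, of x] loop_op_add_left[of "lie_proj X x - x" x]
  by simp

end

lemma loop_op_add: "s \<in> S \<Longrightarrow> s' \<in> S \<Longrightarrow> loop_op x (s + s') = loop_op x s + loop_op x s'"
  by (simp add: loop_op_def pm_sum_def T_add sum.distrib)

lemma loop_op_scale: "s \<in> S \<Longrightarrow> loop_op x (sW c s) = sW c (loop_op x s)"
  by (simp add: loop_op_def pm_sum_def T_scale W.scale_sum_right)

lemma loop_op_bracket:
  assumes "s \<in> S"
  shows "loop_op (loop_bracket X x y) s = loop_op x (loop_op y s) - loop_op y (loop_op x s)"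
proof (induction x rule: poly_mapping_single_induct)
  case (single m u)
  show ?case
  proof (induction y rule: poly_mapping_single_induct)
    case (single n v)
    then show ?case using assms
      by (simp add: loop_bracket_single loop_op_add_left loop_op_single T_scale_left T_comm T_in)
  qed (use assms in \<open>simp_all add: loop_bracket_add_right loop_op_add_left loop_op_add loop_op_in
      loop_op_def[of _ 0] pm_sum_def S_closed\<close>)
qed (use assms in \<open>simp_all add: loop_bracket_add_left loop_op_add_left loop_op_add loop_op_in
      loop_op_def[of _ 0] pm_sum_def S_closed\<close>)

definition word_op :: "('a, 'b) loop list \<Rightarrow> 'w \<Rightarrow> 'w" where
  "word_op w s = foldr loop_op w s"

lemma word_op_in: "s \<in> S \<Longrightarrow> word_op w s \<in> S"
  unfolding word_op_def by (induction w) (auto intro: loop_op_in)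

lemma word_op_add: "s \<in> S \<Longrightarrow> s' \<in> S \<Longrightarrow> word_op w (s + s') = word_op w s + word_op w s'"
  by (induction w) (simp_all add: word_op_def loop_op_add word_op_in[unfolded word_op_def])

lemma word_op_scale: "s \<in> S \<Longrightarrow> word_op w (sW c s) = sW c (word_op w s)"
  by (induction w) (simp_all add: word_op_def loop_op_scale word_op_in[unfolded word_op_def])

definition fa_op :: "('a, 'b) loop free_alg \<Rightarrow> 'w \<Rightarrow> 'w" where
  "fa_op p s = pm_sum (\<lambda>w c. sW c (word_op w s)) p"

lemma fa_op_add_left: "fa_op (p + q) s = fa_op p s + fa_op q s"
  unfolding fa_op_def by (rule pm_sum_add) (rule W.scale_left_distrib)

lemma fa_op_scale_left: "fa_op (fa_scale c p) s = sW c (fa_op p s)"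
  unfolding fa_op_def
  by (rule pm_sum_scale[OF vector_space_complex W.vector_space_axioms]) simp

lemma linear_fa_op: "Vector_Spaces.linear fa_scale sW (\<lambda>p. fa_op p s)"
  by (rule linear_onI[OF vector_space_fa_scale W.vector_space_axioms])
    (simp_all only: fa_op_add_left fa_op_scale_left)

lemma fa_op_diff_left: "fa_op (p - q) s = fa_op p s - fa_op q s"
  by (rule linear_diffD[OF linear_fa_op])

lemma fa_op_zero_left [simp]: "fa_op 0 s = 0"
  by (rule linear_zeroD[OF linear_fa_op])

lemma fa_op_single: "fa_op (Poly_Mapping.single w c) s = sW c (word_op w s)"
  unfolding fa_op_def by (rule pm_sum_single) simp

lemma fa_op_word: "fa_op (fa_word w) s = word_op w s"
  by (simp add: fa_word_def fa_op_single)

lemma fa_op_in: "s \<in> S \<Longrightarrow> fa_op p s \<in> S"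
  unfolding fa_op_def pm_sum_def
  by (rule W.subspace_sum[OF subspace_S]) (simp add: S_closed(3) word_op_in)

lemma fa_op_add: "s \<in> S \<Longrightarrow> s' \<in> S \<Longrightarrow> fa_op p (s + s') = fa_op p s + fa_op p s'"
  by (simp add: fa_op_def pm_sum_def word_op_add W.scale_right_distrib sum.distrib)

lemma fa_op_zero [simp]: "fa_op p 0 = 0"
  using fa_op_add[OF S_closed(1) S_closed(1), of p] by simp

lemma fa_op_mult:
  assumes "s \<in> S"
  shows "fa_op (fa_mult p q) s = fa_op p (fa_op q s)"
proof (induction p rule: poly_mapping_single_induct)
  case (single v c)
  show ?case
  proof (induction q rule: poly_mapping_single_induct)
    case (single w d)
    then show ?case using assms
      by (simp add: fa_op_single word_op_scale word_op_in) (simp add: word_op_def)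
  qed (use assms in \<open>simp_all add: fa_mult_add_right fa_op_add_left fa_op_add fa_op_in\<close>)
qed (simp_all add: fa_mult_add_left fa_op_add_left)

lemma loop_op_lie_bracket:
  assumes "s \<in> S" "x \<in> lie_carrier X" "y \<in> lie_carrier X"
  shows "loop_op (lie_bracket X x y) s = loop_op x (loop_op y s) - loop_op y (loop_op x s)"
  using assms by (simp add: lie_bracket_def loop_op_lie_proj loop_op_bracket)

lemma fa_op_rel:
  assumes "s \<in> S" "r \<in> uea_rels (smLoop X) (lie_carrier X) (lie_bracket X)"
  shows "fa_op r s = 0"
  using assms unfolding uea_rels_def
  by (auto simp: fa_op_diff_left fa_op_word fa_op_scale_left word_op_def loop_op_add_left
      loop_op_scale_left loop_op_lie_bracket)

lemma fa_op_U_ideal: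
  assumes "s \<in> S" "r \<in> uea_ideal (smLoop X) (lie_carrier X) (lie_bracket X)"
  shows "fa_op r s = 0"
  using assms(2) unfolding uea_ideal_def
proof (induction r rule: fa.span_induct)
  case base
  show ?case by (rule fa.subspaceI) (auto simp: fa_op_add_left fa_op_scale_left)
next
  case (step x)
  then show ?case using assms(1) by (auto simp: fa_op_mult fa_op_in fa_op_rel)
qed

lemma fa_op_U_proj: "s \<in> S \<Longrightarrow> fa_op (U_proj p) s = fa_op p s"
  using fa_op_U_ideal[OF _ U_proj_diff_in, of s p] by (simp add: fa_op_diff_left)

text \<open>The free algebra acts on \<open>S\<close>, the ideal of relations acts by zero, and
  evaluation at \<open>s0\<close> kills the left ideal generated by the nonnegative modes. As
  quotients are realised by representatives inside the free algebra, evaluation at \<open>s0\<close>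
  is itself the required map: it takes the same value on \<open>p\<close> and on
  \<open>VL_quot p\<close>.\<close>

theorem VL_universal:
  assumes s0: "s0 \<in> S" and vac: "\<And>u n. n \<ge> 0 \<Longrightarrow> T u n s0 = 0"
  obtains H where "Vector_Spaces.linear fa_scale sW H" "H (VL_vac X) = s0"
    "\<And>v. H v \<in> S" "\<And>u n v. v \<in> VL X \<Longrightarrow> H (VL_mode X u n v) = T u n (H v)"
proof -
  have k: "fa_op k s0 = 0" if "k \<in> VL_kernel X" for k
    using that unfolding VL_kernel_gens
  proof (induction k rule: fa.span_induct)
    case base
    show ?case by (rule fa.subspaceI) (auto simp: fa_op_add_left fa_op_scale_left)
  next
    case (step k)
    then obtain p x where k: "k = U_proj (fa_mult p (fa_word [lie_proj X x]))"
      and x: "Poly_Mapping.keys x \<subseteq> {0..}"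
      by (auto simp: lie_nonneg_def)
    have "loop_op x s0 = 0"
      unfolding loop_op_def pm_sum_def using x by (intro sum.neutral) (auto intro!: vac)
    then show ?case using s0
      by (simp add: k fa_op_U_proj fa_op_mult fa_op_word) (simp add: word_op_def loop_op_lie_proj)
  qed
  have q: "fa_op (VL_quot p) s0 = fa_op p s0" for p
    using k[OF VL_proj_diff_in, of "U_proj p"] fa_op_U_proj[OF s0, of p]
    by (simp add: VL_quot_def fa_op_diff_left)
  show thesis
  proof (rule that)
    show "Vector_Spaces.linear fa_scale sW (\<lambda>p. fa_op p s0)" by (rule linear_fa_op)
    show "fa_op (VL_vac X) s0 = s0" by (simp add: VL_vac_eq q fa_op_word) (simp add: word_op_def)
    show "fa_op v s0 \<in> S" for v by (rule fa_op_in[OF s0])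
    fix u n v assume "v \<in> VL X"
    then obtain p where p: "v = VL_quot p" "p \<in> FL" by (auto simp: VL_eq)
    then show "fa_op (VL_mode X u n v) s0 = T u n (fa_op v s0)"
      using s0 fa_op_in[OF s0]
      by (simp add: VL_mode_lie_act lie_act_quot q fa_op_mult fa_op_word)
        (simp add: word_op_def loop_op_lie_proj loop_op_single)
  qed
qed

end


section \<open>A coinduced module\<close>

text \<open>The value on the bracket [u(m), v(n)] of the function of modes given by
  \<open>T\<close>. Since \<open>T\<close> is arbitrary, iterated brackets are obtained by nesting,
  as in \<open>mode_bracket_jacobi\<close>.\<close>

definition mode_bracket ::
  "('a::comm_ring, 'b::ab_group_add) algebroid \<Rightarrow> (complex \<Rightarrow> 'w \<Rightarrow> 'w) \<Rightarrow>
   ('a \<times> 'b \<Rightarrow> int \<Rightarrow> 'w::ab_group_add) \<Rightarrow> 'a \<times> 'b \<Rightarrow> int \<Rightarrow> 'a \<times> 'b \<Rightarrow> int \<Rightarrow> 'w" where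
  "mode_bracket X s T u m v n = T (prod0 X u v) (m + n) + s (of_int m) (T (prod1 X u v) (m + n - 1))"

section \<open>The Jacobi identity for modes, and the negative modes on A + B\<close>

context vertex_algebroid
begin

text \<open>Together with \<open>prod1_prod0\<close> and \<open>prod0_prod1\<close>, these are the
  commutator formulas [u_i, v_j] = sum over k of binom(i, k) (u_k v)_(i+j-k) for i + j at most
  1.\<close>

lemma prod0_leibniz: "prod0 X u (prod0 X v w) = prod0 X (prod0 X u v) w + prod0 X v (prod0 X u w)"
proof -
  have "brB X (snd u) (brB X (snd v) (snd w)) =
    brB X (brB X (snd u) (snd v)) (snd w) + brB X (snd v) (brB X (snd u) (snd w))"
    by (rule leibniz)
  then show ?thesis by (simp add: prod0_def op_diff anchor_brB algebra_simps)
qed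

lemma prod1_prod0:
  "prod1 X u (prod0 X v w) =
    prod1 X (prod0 X u v) w + prod0 X (prod1 X u v) w + prod0 X v (prod1 X u w)"
proof -
  \<comment> \<open>Both summands together are <del <u, v>, w>, because [u, v] + [v, u] = del <u,
    v>, and pairing with a value of \<open>del X\<close> is the anchor.\<close>
  have "pairB X (brB X (snd u) (snd v)) (snd w) + pairB X (brB X (snd v) (snd u)) (snd w) =
      anchor X (snd w) (pairB X (snd u) (snd v))"
    using brB_sym[of "snd u" "snd v"] op_add(7) by (metis pairB_del_left)
  then show ?thesis
    by (simp add: prod0_def prod1_def op_zero anchor_pairB algebra_simps)
qed

lemma prod0_prod1: "prod0 X u (prod1 X v w) = prod1 X (prod0 X u v) w + prod1 X v (prod0 X u w)"
  by (simp add: prod0_def prod1_def op_zero anchor_pairB)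

lemma prod1_prod1 [simp]: "prod1 X u (prod1 X v w) = 0" "prod1 X (prod1 X u v) w = 0"
  by (simp_all add: prod1_def op_zero zero_prod_def)

lemma prod0_skew: "prod0 X u v + prod0 X v u = (0, del X (pairB X (snd u) (snd v)))"
  by (simp add: prod0_def brB_sym)

text \<open>The Jacobi identity in Leibniz form for u(l), v(m), w(n), read through \<open>T\<close>.
  It already holds in the loop space, by the three product identities; the relation for
  \<open>del X\<close> enters with skew-symmetry.\<close>

lemma mode_bracket_jacobi:
  assumes s: "vector_space s" and add: "\<And>u v n. T (u + v) n = T u n + T v n"
    and scale: "\<And>c u n. T (smC X c u) n = s c (T u n)"
  shows "mode_bracket X s (\<lambda>w k. mode_bracket X s T u l w k) v m w n =
    mode_bracket X s (\<lambda>z k. mode_bracket X s T z k w n) u l v m +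
    mode_bracket X s (\<lambda>w k. mode_bracket X s T v m w k) u l w n"
proof -
  interpret W: vector_space s by fact
  have T0: "T 0 n = 0" for n using add[of 0 0 n] by simp
  have idx: "l + (m + n) = l + m + n" "m + (l + n) = l + m + n" "l + (m + n - 1) = l + m + n - 1"
    "m + (l + n - 1) = l + m + n - 1" "l + m - 1 + n = l + m + n - 1" by simp_all
  show ?thesis
    unfolding mode_bracket_def idx
    by (simp add: prod0_leibniz[of u v w] prod1_prod0[of u v w] prod0_prod1[of u v w] add T0
        W.scale_right_distrib W.scale_left_distrib mult.commute algebra_simps)
qed

text \<open>The sum [u(m), v(n)] + [v(n), u(m)] is the element \<open>del_hat (m + n)\<close> taken
  at <u, v>, on which \<open>T\<close> vanishes.\<close>

lemma mode_bracket_skew: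
  assumes s: "vector_space s" and add: "\<And>u v n. T (u + v) n = T u n + T v n"
    and del: "\<And>a n. T (0, del X a) n + s (of_int n) (T (a, 0) (n - 1)) = 0"
  shows "mode_bracket X s T u m v n = - mode_bracket X s T v n u m"
proof -
  interpret W: vector_space s by fact
  let ?p = "pairB X (snd u) (snd v)"
  have "mode_bracket X s T u m v n + mode_bracket X s T v n u m =
      T (prod0 X u v + prod0 X v u) (m + n) + s (of_int (m + n)) (T (?p, 0) (m + n - 1))"
    by (simp add: mode_bracket_def prod1_def pairB_sym add add.commute[of n m] W.scale_left_distrib
        algebra_simps)
  also have "\<dots> = 0" unfolding prod0_skew by (rule del)
  finally show ?thesis by (simp add: eq_neg_iff_add_eq_0)
qed

text \<open>
  \<open>low_act u n\<close> with \<open>n < 0\<close> is the action of the modes \<open>u(n)\<close> on \<open>A \<oplus> B\<close> viewed as the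
  quotient of \<open>V\<^sub>B\<close> by its part of degree at least two; for instance
  \<open>b(-1)a = a(-1)b + (\<pi>(b)(a))(-2)\<one>\<close>.
\<close>

definition low_act :: "'a \<times> 'b \<Rightarrow> int \<Rightarrow> 'a \<times> 'b \<Rightarrow> 'a \<times> 'b" where
  "low_act u n p =
    (if n = -1 then (fst u * fst p,
        actB X (fst u) (snd p) + actB X (fst p) (snd u) + del X (anchor X (snd u) (fst p)))
     else if n = -2 then (0, actB X (fst p) (del X (fst u))) else 0)"

lemma low_act_add: "low_act u n (p + q) = low_act u n p + low_act u n q"
  by (simp add: low_act_def op_add distrib_left add_ac)

lemma mult_smA: "a * smA X c a' = smA X c (a * a')"
  using smA_mult[of c a' a] by (simp add: mult.commute)

lemma low_act_scale: "low_act u n (smC X c p) = smC X c (low_act u n p)"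
  by (simp add: low_act_def smC_def op_scale B.scale_right_distrib mult_smA zero_prod_def)

lemma low_act_add_left: "low_act (u + v) n p = low_act u n p + low_act v n p"
  by (simp add: low_act_def op_add distrib_right add_ac)

lemma low_act_scale_left: "low_act (smC X c u) n p = smC X c (low_act u n p)"
  by (simp add: low_act_def smC_def op_scale B.scale_right_distrib smA_mult zero_prod_def)

lemma low_act_del: "n < 0 \<Longrightarrow> low_act (0, del X a) n p + smC X (of_int n) (low_act (a, 0) (n - 1) p) = 0"
  by (simp add: low_act_def smC_def op_zero anchor_del zero_prod_def)

text \<open>The correction term in \<open>actB_assoc\<close> is symmetric in \<open>a\<close> and
  \<open>a'\<close>.\<close>

lemma actB_commute: "actB X a (actB X a' v) = actB X a' (actB X a v)"
  using actB_assoc[of a a' v] actB_assoc[of a' a v]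
  by (simp add: mult.commute add.commute) (metis diff_add_cancel)

text \<open>For m = n = -1 only (u_0 v)(-2) is left of the bracket, as \<open>low_act\<close>
  vanishes at index -3. If exactly one index is -2, the two orders agree by
  \<open>actB_assoc\<close>; in the remaining cases both sides are zero.\<close>

lemma low_act_comm:
  assumes "m < 0" "n < 0"
  shows "low_act u m (low_act v n p) - low_act v n (low_act u m p) =
    mode_bracket X (smC X) (\<lambda>w k. low_act w k p) u m v n"
proof -
  consider "m = -1" "n = -1" | "m = -1" "n = -2" | "m = -2" "n = -1" | "m = -2" "n = -2"
    | "m < -2 \<or> n < -2" using assms by linarith
  then show ?thesis
  proof cases
    case 1
    obtain a b a' b' c d where eq: "u = (a, b)" "v = (a', b')" "p = (c, d)" by (cases u; cases v; cases p)
    \<comment> \<open>The associativity defect and the Leibniz rule for \<open>del X\<close> cancel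
      up to - c * del(pi(y)(x)). The two instances \<open>e1\<close> and \<open>e2\<close> combine
      to the action at index -2 of pi(b)(a') - pi(b')(a), the A-part of u_0 v.\<close>
    have x: "actB X x (actB X c y) - actB X (c * x) y + actB X x (del X (anchor X y c))
      - del X (anchor X y (c * x)) = - actB X c (del X (anchor X y x))" for x y
      using actB_assoc[of x c y] by (simp add: anchor_mult del_mult op_add mult.commute algebra_simps)
    have comm: "actB X a (actB X a' d) = actB X a' (actB X a d)" by (rule actB_commute)
    have e1: "actB X a (actB X c b') + actB X a (del X (anchor X b' c))
        - actB X (c * a) b' - del X (anchor X b' (c * a)) = - actB X c (del X (anchor X b' a))"
      using x[of a b'] by (simp add: algebra_simps)
    have e2: "actB X a' (actB X c b) + actB X a' (del X (anchor X b c))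
        - actB X (c * a') b - del X (anchor X b (c * a')) = - actB X c (del X (anchor X b a'))"
      using x[of a' b] by (simp add: algebra_simps)
    from arg_cong2[of _ _ _ _ "(-)", OF e1 e2] show ?thesis
      unfolding 1 eq mode_bracket_def
      by (simp add: low_act_def prod0_def op_add op_diff comm mult.commute mult.left_commute)
        (simp add: algebra_simps)
  next
    case 2
    then show ?thesis using actB_assoc[of "fst u" "fst p" "del X (fst v)"]
      by (simp add: mode_bracket_def low_act_def op_zero anchor_del mult.commute zero_prod_def)
  next
    case 3
    then show ?thesis using actB_assoc[of "fst v" "fst p" "del X (fst u)"]
      by (simp add: mode_bracket_def low_act_def op_zero anchor_del mult.commute zero_prod_def)
  qed (use assms in \<open>auto simp: mode_bracket_def low_act_def op_zero zero_prod_def\<close>)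
qed

text \<open>
  A vector of the module coinduced from \<open>low_act\<close> is a function on words in the modes \<open>u(n)\<close>
  with \<open>n \<ge> 0\<close>: \<open>f [x\<^sub>1, \<dots>, x\<^sub>k]\<close> stands for the component in \<open>A \<oplus> B\<close> of
  \<open>x\<^sub>k \<dots> x\<^sub>1 f\<close>.  A mode with negative index is moved past the letters of the word by means of
  the commutator formula.
\<close>

abbreviation tail :: "'l \<Rightarrow> ('l list \<Rightarrow> 'w) \<Rightarrow> 'l list \<Rightarrow> 'w" where
  "tail x f \<equiv> \<lambda>w. f (x # w)"

text \<open>Bracketing with a letter can raise a negative index to a nonnegative one, so the case
  distinction on \<open>n\<close> recurs at every stage; the recursion runs over the word
  alone.\<close>

primrec act_at :: "(('a \<times> 'b) \<times> nat) list \<Rightarrow> 'a \<times> 'b \<Rightarrow> int \<Rightarrow>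
    ((('a \<times> 'b) \<times> nat) list \<Rightarrow> 'a \<times> 'b) \<Rightarrow> 'a \<times> 'b" where
  "act_at [] u n f = (if n \<ge> 0 then f [(u, nat n)] else low_act u n (f []))"
| "act_at (x # w) u n f = (if n \<ge> 0 then f ((u, nat n) # x # w) else
     act_at w u n (tail x f) + (act_at w (prod0 X (fst x) u) (int (snd x) + n) f +
     smC X (of_int (int (snd x))) (act_at w (prod1 X (fst x) u) (int (snd x) + n - 1) f)))"

definition act :: "'a \<times> 'b \<Rightarrow> int \<Rightarrow> ((('a \<times> 'b) \<times> nat) list \<Rightarrow> 'a \<times> 'b) \<Rightarrow>
    (('a \<times> 'b) \<times> nat) list \<Rightarrow> 'a \<times> 'b" where
  "act u n f w = act_at w u n f"

definition scale_fun :: "complex \<Rightarrow> ('l \<Rightarrow> 'a \<times> 'b) \<Rightarrow> 'l \<Rightarrow> 'a \<times> 'b" where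
  "scale_fun c f w = smC X c (f w)"

lemma act_nonneg: "n \<ge> 0 \<Longrightarrow> act u n f w = f ((u, nat n) # w)"
  by (cases w) (simp_all add: act_def)

lemma act_Nil: "n < 0 \<Longrightarrow> act u n f [] = low_act u n (f [])"
  by (simp add: act_def)

lemma act_Cons:
  "n < 0 \<Longrightarrow> act u n f (x # w) =
    act u n (tail x f) w + mode_bracket X (smC X) (\<lambda>u n. act u n f w) (fst x) (int (snd x)) u n"
  by (simp add: act_def mode_bracket_def)

lemma act_add: "act u n (f + g) w = act u n f w + act u n g w"
proof (induction w arbitrary: u n f g)
  case Nil
  then show ?case by (cases "n < 0") (simp_all add: act_Nil low_act_add act_nonneg)
next
  case (Cons x w)
  show ?case
  proof (cases "n < 0")
    case True
    have t: "tail x (f + g) = tail x f + tail x g" by (simp add: fun_eq_iff)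
    show ?thesis unfolding act_Cons[OF True] t Cons mode_bracket_def
      by (simp add: C.scale_right_distrib)
  qed (simp add: act_nonneg)
qed

lemma act_scale: "act u n (scale_fun c f) w = smC X c (act u n f w)"
proof (induction w arbitrary: u n f)
  case Nil
  then show ?case
    by (cases "n < 0") (simp_all add: act_Nil low_act_scale act_nonneg scale_fun_def)
next
  case (Cons x w)
  show ?case
  proof (cases "n < 0")
    case True
    have t: "tail x (scale_fun c f) = scale_fun c (tail x f)" by (simp add: fun_eq_iff scale_fun_def)
    show ?thesis unfolding act_Cons[OF True] t Cons mode_bracket_def
      by (simp add: C.scale_right_distrib mult.commute)
  qed (simp add: act_nonneg scale_fun_def)
qed

text \<open>The relations between nonnegative modes, imposed on the first letters. The first letter
  acts first, so the word starting v(n), u(m) minus the word starting u(m), v(n) stands for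
  [u(m), v(n)]. Subtraction of natural numbers is truncated only where the factor
  \<open>of_nat m\<close> is zero.\<close>

definition head_relations :: "((('a \<times> 'b) \<times> nat) list \<Rightarrow> 'a \<times> 'b) \<Rightarrow> bool" where
  "head_relations f \<longleftrightarrow>
    (\<forall>u v m w. f ((u + v, m) # w) = f ((u, m) # w) + f ((v, m) # w)) \<and>
    (\<forall>c u m w. f ((smC X c u, m) # w) = smC X c (f ((u, m) # w))) \<and>
    (\<forall>a m w. f (((0, del X a), m) # w) + smC X (of_nat m) (f (((a, 0), m - 1) # w)) = 0) \<and>
    (\<forall>u m v n w. f ((v, n) # (u, m) # w) - f ((u, m) # (v, n) # w) =
      f ((prod0 X u v, m + n) # w) + smC X (of_nat m) (f ((prod1 X u v, m + n - 1) # w)))"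

text \<open>The prefix \<open>v\<close> moves the relations to every position of a word, so that
  \<open>f\<close> amounts to a linear function on the enveloping algebra of the nonnegative
  modes.\<close>

definition coinduced :: "((('a \<times> 'b) \<times> nat) list \<Rightarrow> 'a \<times> 'b) set" where
  "coinduced = {f. \<forall>v. head_relations (\<lambda>w. f (v @ w))}"

lemma coinduced_head: "f \<in> coinduced \<Longrightarrow> head_relations f"
  unfolding coinduced_def by (auto dest: spec[of _ "[]"])

lemma coinduced_tail: "f \<in> coinduced \<Longrightarrow> tail x f \<in> coinduced"
  unfolding coinduced_def by (auto dest: spec[of _ "x # _"])

lemma head_relations_add:
  assumes "head_relations f" "head_relations g" shows "head_relations (\<lambda>w. f w + g w)"
proof -
  have "f (((0, del X a), m) # w) + g (((0, del X a), m) # w) +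
    smC X (of_nat m) (f (((a, 0), m - 1) # w) + g (((a, 0), m - 1) # w)) = 0" for a m w
  proof -
    have "(f (((0, del X a), m) # w) + smC X (of_nat m) (f (((a, 0), m - 1) # w))) +
      (g (((0, del X a), m) # w) + smC X (of_nat m) (g (((a, 0), m - 1) # w))) = 0"
      using assms unfolding head_relations_def by simp
    then show ?thesis by (simp add: C.scale_right_distrib add_ac)
  qed
  moreover have "f ((v, n) # (u, m) # w) + g ((v, n) # (u, m) # w) -
      (f ((u, m) # (v, n) # w) + g ((u, m) # (v, n) # w)) =
      f ((prod0 X u v, m + n) # w) + g ((prod0 X u v, m + n) # w) +
      smC X (of_nat m) (f ((prod1 X u v, m + n - 1) # w) + g ((prod1 X u v, m + n - 1) # w))"
    for u m v n w
  proof -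
    have "(f ((v, n) # (u, m) # w) - f ((u, m) # (v, n) # w)) +
      (g ((v, n) # (u, m) # w) - g ((u, m) # (v, n) # w)) =
      (f ((prod0 X u v, m + n) # w) + smC X (of_nat m) (f ((prod1 X u v, m + n - 1) # w))) +
      (g ((prod0 X u v, m + n) # w) + smC X (of_nat m) (g ((prod1 X u v, m + n - 1) # w)))"
      using assms unfolding head_relations_def by presburger
    then show ?thesis by (simp add: C.scale_right_distrib algebra_simps)
  qed
  ultimately show ?thesis
    using assms unfolding head_relations_def by (simp add: C.scale_right_distrib add_ac)
qed

lemma head_relations_scale:
  assumes "head_relations f" shows "head_relations (\<lambda>w. smC X c (f w))"
proof -
  have "smC X c (f (((0, del X a), m) # w)) +
    smC X (of_nat m) (smC X c (f (((a, 0), m - 1) # w))) = 0" for a m w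
  proof -
    have "smC X c (f (((0, del X a), m) # w) + smC X (of_nat m) (f (((a, 0), m - 1) # w))) = 0"
      using assms unfolding head_relations_def by simp
    then show ?thesis by (simp add: C.scale_right_distrib mult.commute)
  qed
  moreover have "smC X c (f ((v, n) # (u, m) # w)) - smC X c (f ((u, m) # (v, n) # w)) =
      smC X c (f ((prod0 X u v, m + n) # w)) +
      smC X (of_nat m) (smC X c (f ((prod1 X u v, m + n - 1) # w)))"
    for u m v n w
  proof -
    have "smC X c (f ((v, n) # (u, m) # w) - f ((u, m) # (v, n) # w)) =
      smC X c (f ((prod0 X u v, m + n) # w) + smC X (of_nat m) (f ((prod1 X u v, m + n - 1) # w)))"
      using assms unfolding head_relations_def by presburger
    then show ?thesis by (simp add: C.scale_right_distrib C.scale_right_diff_distrib mult.commute)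
  qed
  ultimately show ?thesis
    using assms unfolding head_relations_def by (simp add: C.scale_right_distrib mult.commute)
qed

context
  fixes f assumes f: "f \<in> coinduced"
begin

lemma coinduced_add_head: "f ((u + v, m) # w) = f ((u, m) # w) + f ((v, m) # w)"
  using coinduced_head[OF f] unfolding head_relations_def by blast

lemma coinduced_scale_head: "f ((smC X c u, m) # w) = smC X c (f ((u, m) # w))"
  using coinduced_head[OF f] unfolding head_relations_def by blast

lemma coinduced_del_head: "f (((0, del X a), m) # w) + smC X (of_nat m) (f (((a, 0), m - 1) # w)) = 0"
  using coinduced_head[OF f] unfolding head_relations_def by blast

lemma coinduced_comm_head: "f ((v, n) # (u, m) # w) - f ((u, m) # (v, n) # w) =
    f ((prod0 X u v, m + n) # w) + smC X (of_nat m) (f ((prod1 X u v, m + n - 1) # w))"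
  using coinduced_head[OF f] unfolding head_relations_def by blast

text \<open>For \<open>n < 0\<close> this is the recursion, for \<open>n >= 0\<close> the commutator
  relation at the head. With one formula for all indices, the inductions for
  \<open>act_add_left\<close>, \<open>act_scale_left\<close>, \<open>act_del\<close> and
  \<open>act_comm\<close> distinguish cases only at the empty word.\<close>

lemma act_mode_tail:
  "act u n f (x # w) =
    act u n (tail x f) w + mode_bracket X (smC X) (\<lambda>u n. act u n f w) (fst x) (int (snd x)) u n"
proof (cases "n < 0")
  case False
  obtain v m where x: "x = (v, m)" by (cases x)
  \<comment> \<open>For \<open>m = 0\<close> the index on the left may be truncated, but the factor
    is zero.\<close>
  have "smC X (of_nat m) (f ((prod1 X v u, m + nat n - 1) # w)) =
      smC X (of_nat m) (act (prod1 X v u) (int m + n - 1) f w)"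
    using False by (cases "m = 0") (simp_all add: act_nonneg nat_diff_distrib nat_add_distrib)
  moreover have "f ((u, nat n) # (v, m) # w) = f ((v, m) # (u, nat n) # w) +
      (f ((prod0 X v u, m + nat n) # w) + smC X (of_nat m) (f ((prod1 X v u, m + nat n - 1) # w)))"
    using coinduced_comm_head[of u "nat n" v m w] by (simp add: algebra_simps)
  ultimately show ?thesis using False
    by (simp add: x act_nonneg mode_bracket_def nat_add_distrib)
qed (rule act_Cons)

end

section \<open>The coinduced functions form a module over the Lie algebra\<close>

lemma act_add_left: "f \<in> coinduced \<Longrightarrow> act (u + v) n f w = act u n f w + act v n f w"
proof (induction w arbitrary: u v n f)
  case Nil
  then show ?case
    by (cases "n < 0") (simp_all add: act_Nil low_act_add_left act_nonneg coinduced_add_head)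
next
  case (Cons x w)
  show ?case
    unfolding act_mode_tail[OF Cons.prems] mode_bracket_def prod0_add_right prod1_add_right
      Cons.IH[OF Cons.prems] Cons.IH[OF coinduced_tail[OF Cons.prems]]
    by (simp add: C.scale_right_distrib)
qed

lemma act_scale_left: "f \<in> coinduced \<Longrightarrow> act (smC X c u) n f w = smC X c (act u n f w)"
proof (induction w arbitrary: u n f)
  case Nil
  then show ?case
    by (cases "n < 0") (simp_all add: act_Nil low_act_scale_left act_nonneg coinduced_scale_head)
next
  case (Cons x w)
  show ?case
    unfolding act_mode_tail[OF Cons.prems] mode_bracket_def prod0_scale_right prod1_scale_right
      Cons.IH[OF Cons.prems] Cons.IH[OF coinduced_tail[OF Cons.prems]]
    by (simp add: C.scale_right_distrib mult.commute)
qed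

text \<open>Bracketing a letter v(m) with the relation at \<open>a\<close>, \<open>n\<close> gives
  the relation at pi(v)(a), m + n. The induction hypothesis is therefore used twice: for the tail of
  \<open>f\<close>, and for this new relation.\<close>

lemma act_del:
  "f \<in> coinduced \<Longrightarrow> act (0, del X a) n f w + smC X (of_int n) (act (a, 0) (n - 1) f w) = 0"
proof (induction w arbitrary: a n f)
  case Nil
  show ?case
  proof (cases "n < 0")
    case False
    then show ?thesis using coinduced_del_head[OF Nil, of a "nat n" "[]"]
      by (cases "n = 0") (simp_all add: act_nonneg nat_diff_distrib)
  qed (simp add: act_Nil low_act_del)
next
  case (Cons x w)
  obtain v m where x: "x = (v, m)" by (cases x)
  let ?c = "anchor X (snd v) a"
  have idx: "int m + (n - 1) = int m + n - 1" by simp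
  have "act (0, del X a) n f (x # w) + smC X (of_int n) (act (a, 0) (n - 1) f (x # w)) =
      (act (0, del X a) n (tail x f) w + smC X (of_int n) (act (a, 0) (n - 1) (tail x f) w)) +
      (act (0, del X ?c) (int m + n) f w + smC X (of_int (int m + n)) (act (?c, 0) (int m + n - 1) f w)) +
      smC X (of_int n * of_nat m) (act 0 (int m + n - 2) f w)"
    unfolding act_mode_tail[OF Cons.prems] mode_bracket_def
    by (simp add: x idx C.scale_right_distrib C.scale_left_distrib)
  moreover have "act 0 (int m + n - 2) f w = 0"
    using act_add_left[OF Cons.prems, of 0 0] by simp
  ultimately show ?case
    using Cons.IH[OF Cons.prems, of ?c "int m + n"] Cons.IH[OF coinduced_tail[OF Cons.prems]] by simp
qed

lemma act_bracket_skew: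
  assumes "f \<in> coinduced"
  shows "mode_bracket X (smC X) (\<lambda>u n. act u n f w) u m v n =
    - mode_bracket X (smC X) (\<lambda>u n. act u n f w) v n u m"
  by (rule mode_bracket_skew[OF C.vector_space_axioms])
    (simp_all add: act_add_left act_del assms)

lemma act_bracket_jacobi:
  fixes w :: "(('a \<times> 'b) \<times> nat) list"
  assumes "f \<in> coinduced"
  defines "br \<equiv> mode_bracket X (smC X)" and "T \<equiv> \<lambda>u n. act u n f w"
  shows "br (\<lambda>w k. br T u l w k) v m z n =
    br (\<lambda>y k. br T y k z n) u l v m + br (\<lambda>w k. br T v m w k) u l z n"
  unfolding br_def T_def
  by (rule mode_bracket_jacobi[OF C.vector_space_axioms]) (simp_all add: act_add_left act_scale_left assms(1))


text \<open>The commutator relation is the hard one. A negative mode moves past two letters in four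
  ways: bracketed with neither, with one, with the other, or with both. Exchanging the letters swaps
  the two middle terms; the first term changes by the relation for \<open>f\<close> and the last by
  the Jacobi identity, and these changes make up the required bracket.\<close>

lemma act_neg_head_relations:
  assumes f: "f \<in> coinduced" and n: "n < 0"
  shows "head_relations (act u n f)"
proof -
  note T = act_mode_tail[OF f]
  have t_add: "tail (v + v', m) f = tail (v, m) f + tail (v', m) f" for v v' and m :: nat
    by (simp add: fun_eq_iff coinduced_add_head[OF f])
  have t_scale: "tail (smC X c v, m) f = scale_fun c (tail (v, m) f)" for c v and m :: nat
    by (simp add: fun_eq_iff scale_fun_def coinduced_scale_head[OF f])
  have t_del: "tail ((0, del X a), m) f + scale_fun (of_nat m) (tail ((a, 0), m - 1) f) = 0" for a m
    using coinduced_del_head[OF f] by (simp add: fun_eq_iff scale_fun_def)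
  have act0: "act u n 0 w = 0" for w
    using act_scale[of u n 0 0 w] by (simp add: scale_fun_def[abs_def] zero_fun_def)
  have act_0_left: "act 0 k f w = 0" for k w
    using act_add_left[OF f, of 0 0] by simp
  have add: "act u n f ((v + v', m) # w) = act u n f ((v, m) # w) + act u n f ((v', m) # w)" for v v' m w
    unfolding T t_add mode_bracket_def
    by (simp add: prod_add act_add_left[OF f] act_add C.scale_right_distrib add_ac)
  have scale: "act u n f ((smC X c v, m) # w) = smC X c (act u n f ((v, m) # w))" for c v m w
    unfolding T t_scale mode_bracket_def
    by (simp add: prod_scale act_scale_left[OF f] act_scale C.scale_right_distrib mult.commute)
  have del: "act u n f (((0, del X a), m) # w) + smC X (of_nat m) (act u n f (((a, 0), m - 1) # w)) = 0" for a m w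
  proof -
    have "act u n (tail ((0, del X a), m) f) w + smC X (of_nat m) (act u n (tail ((a, 0), m - 1) f) w) =
        act u n (tail ((0, del X a), m) f + scale_fun (of_nat m) (tail ((a, 0), m - 1) f)) w"
      by (simp only: act_add act_scale)
    also have "\<dots> = 0" unfolding t_del by (rule act0)
    finally have 1: "act u n (tail ((0, del X a), m) f) w + smC X (of_nat m) (act u n (tail ((a, 0), m - 1) f) w) = 0" .
    have neg: "act (- v, 0) k f w = - act (v, 0) k f w" for v k
      using act_add_left[OF f, of "(- v, 0)" "(v, 0)" k w] act_0_left[of k w]
      by (simp add: zero_prod_def eq_neg_iff_add_eq_0)
    show ?thesis
      unfolding T mode_bracket_def using 1
      by (cases "m = 0") (simp_all add: act_0_left C.scale_right_distrib neg of_nat_diff algebra_simps)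
  qed
  have comm: "act u n f ((v, k) # (v', m) # w) - act u n f ((v', m) # (v, k) # w) =
      act u n f ((prod0 X v' v, m + k) # w) + smC X (of_nat m) (act u n f ((prod1 X v' v, m + k - 1) # w))"
    for v k v' m w
  proof -
    let ?br = "mode_bracket X (smC X)" and ?T = "\<lambda>u n. act u n f w"
    have f': "tail x f \<in> coinduced" for x by (rule coinduced_tail[OF f])
    have exp: "act u n f ((v, k) # (v', m) # w) = act u n (tail (v', m) (tail (v, k) f)) w +
        ?br (\<lambda>u n. act u n (tail (v, k) f) w) v' (int m) u n +
        ?br (\<lambda>u n. act u n (tail (v', m) f) w) v (int k) u n +
        ?br (\<lambda>z l. ?br ?T v' (int m) z l) v (int k) u n" for v k v' m
    proof -
      have "act u n f ((v, k) # (v', m) # w) = act u n (tail (v, k) f) ((v', m) # w) +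
          ?br (\<lambda>u n. act u n f ((v', m) # w)) v (int k) u n"
        using T[of u n "(v, k)" "(v', m) # w"] by simp
      also have "act u n (tail (v, k) f) ((v', m) # w) = act u n (tail (v', m) (tail (v, k) f)) w +
          ?br (\<lambda>u n. act u n (tail (v, k) f) w) v' (int m) u n"
        using act_mode_tail[OF f', of u n "(v, k)" "(v', m)" w] by simp
      also have "(\<lambda>u n. act u n f ((v', m) # w)) =
          (\<lambda>u n. act u n (tail (v', m) f) w + ?br ?T v' (int m) u n)"
        using T[of _ _ "(v', m)" w] by simp
      finally show ?thesis
        by (simp add: mode_bracket_def[of _ _ _ v] C.scale_right_distrib add_ac)
    qed
    have t: "tail (v', m) (tail (v, k) f) - tail (v, k) (tail (v', m) f) =
        tail (prod0 X v' v, m + k) f + scale_fun (of_nat m) (tail (prod1 X v' v, m + k - 1) f)"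
      by (simp add: fun_eq_iff scale_fun_def coinduced_comm_head[OF f])
    have act_diff: "act u n (g - h) w = act u n g w - act u n h w" for g h
      using act_add[of u n "g - h" h w] by simp
    have 2: "act u n (tail (v', m) (tail (v, k) f)) w - act u n (tail (v, k) (tail (v', m) f)) w =
       act u n (tail (prod0 X v' v, m + k) f) w + smC X (of_nat m) (act u n (tail (prod1 X v' v, m + k - 1) f) w)"
      unfolding act_diff[symmetric] t by (simp only: act_add act_scale)
    have "?br (\<lambda>z l. ?br ?T v' (int m) z l) v (int k) u n - ?br (\<lambda>z l. ?br ?T v (int k) z l) v' (int m) u n =
      ?br (\<lambda>y k. ?br ?T y k u n) v' (int m) v (int k)"
      unfolding act_bracket_jacobi[OF f, of w v' "int m" v "int k" u n] by simp
    also have "\<dots> = ?br ?T (prod0 X v' v) (int (m + k)) u n +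
       smC X (of_nat m) (?br ?T (prod1 X v' v) (int (m + k - 1)) u n)"
      unfolding mode_bracket_def[of _ _ _ v']
      by (cases "m = 0") (simp_all add: of_nat_diff)
    finally have 3: "?br (\<lambda>z l. ?br ?T v' (int m) z l) v (int k) u n - ?br (\<lambda>z l. ?br ?T v (int k) z l) v' (int m) u n =
       ?br ?T (prod0 X v' v) (int (m + k)) u n + smC X (of_nat m) (?br ?T (prod1 X v' v) (int (m + k - 1)) u n)" .
    show ?thesis
      unfolding exp[of v k v' m] exp[of v' m v k]
      using 2 3 by (simp add: T C.scale_right_distrib algebra_simps)
  qed
  show ?thesis
    unfolding head_relations_def using add scale del comm by blast
qed

text \<open>Relations deeper in a word reduce to those at its head: \<open>act_mode_tail\<close>
  removes one letter of the prefix and leaves combinations of modes applied to coinduced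
  functions.\<close>

lemma act_coinduced:
  assumes "f \<in> coinduced"
  shows "act u n f \<in> coinduced"
proof -
  have "head_relations (\<lambda>w. act u n f (v @ w))" for v
    using assms
  proof (induction v arbitrary: u n f)
    case Nil
    show ?case
    proof (cases "n < 0")
      case False
      then have "act u n f = tail (u, nat n) f" by (simp add: fun_eq_iff act_nonneg)
      then show ?thesis using coinduced_head[OF coinduced_tail[OF Nil]] by simp
    qed (simp add: act_neg_head_relations Nil)
  next
    case (Cons x v)
    have "(\<lambda>w. act u n f ((x # v) @ w)) = (\<lambda>w. act u n (tail x f) (v @ w) +
      (act (prod0 X (fst x) u) (int (snd x) + n) f (v @ w) +
       smC X (of_int (int (snd x))) (act (prod1 X (fst x) u) (int (snd x) + n - 1) f (v @ w))))"
      by (simp only: append_Cons act_mode_tail[OF Cons.prems] mode_bracket_def)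
    then show ?case
      by (simp only:) (intro head_relations_add head_relations_scale Cons.IH coinduced_tail Cons.prems)
  qed
  then show ?thesis by (simp add: coinduced_def)
qed

lemma vector_space_scale_fun: "vector_space (scale_fun :: complex \<Rightarrow> ('l \<Rightarrow> 'a \<times> 'b) \<Rightarrow> _)"
  by unfold_locales
    (auto simp: fun_eq_iff scale_fun_def C.scale_right_distrib C.scale_left_distrib)

text \<open>A nonnegative mode merely prepends its letter, so for \<open>m >= 0\<close> this is
  \<open>act_mode_tail\<close>; otherwise skew-symmetry exchanges the roles of the two
  modes.\<close>

lemma act_comm_nonneg:
  assumes "f \<in> coinduced" "m \<ge> 0 \<or> n \<ge> 0"
  shows "act u m (act v n f) w - act v n (act u m f) w = mode_bracket X (smC X) (\<lambda>u n. act u n f w) u m v n"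
proof -
  have *: "act u m (act v n f) w - act v n (act u m f) w = mode_bracket X (smC X) (\<lambda>u n. act u n f w) u m v n"
    if "m \<ge> 0" for u m v n
  proof -
    have "act u m f = tail (u, nat m) f" using that by (simp add: fun_eq_iff act_nonneg)
    then show ?thesis
      using act_mode_tail[OF assms(1), of v n "(u, nat m)" w] that by (simp add: act_nonneg[of m])
  qed
  show ?thesis
  proof (cases "m \<ge> 0")
    case False
    then show ?thesis using *[of n v u m] assms act_bracket_skew[OF assms(1), of w u m v n]
      by (simp add: algebra_simps)
  qed (rule *)
qed

lemma mode_bracket_diff:
  assumes "vector_space s"
  shows "mode_bracket X s T u m v n - mode_bracket X s T' u m v n =
    mode_bracket X s (\<lambda>u n. T u n - T' u n) u m v n"
proof -
  interpret W: vector_space s by fact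
  show ?thesis by (simp add: mode_bracket_def W.scale_right_diff_distrib algebra_simps)
qed

lemma act_mode_bracket:
  "act u k (\<lambda>w. mode_bracket X (smC X) (\<lambda>u n. act u n f w) x m v n) w =
    mode_bracket X (smC X) (\<lambda>z l. act u k (act z l f) w) x m v n"
proof -
  have "(\<lambda>w. mode_bracket X (smC X) (\<lambda>u n. act u n f w) x m v n) =
    act (prod0 X x v) (m + n) f + scale_fun (of_int m) (act (prod1 X x v) (m + n - 1) f)"
    by (simp add: fun_eq_iff mode_bracket_def scale_fun_def)
  then show ?thesis by (simp only: act_add act_scale mode_bracket_def)
qed

text \<open>Two negative modes satisfy this on the empty word by \<open>low_act_comm\<close>. When a
  letter x is moved past both modes, the iterated brackets that remain are [u(m), [x, v(n)]] -
  [v(n), [x, u(m)]], and the Jacobi identity turns them into [x, [u(m), v(n)]].\<close>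

lemma act_comm:
  assumes "f \<in> coinduced"
  shows "act u m (act v n f) w - act v n (act u m f) w = mode_bracket X (smC X) (\<lambda>u n. act u n f w) u m v n"
  using assms
proof (induction w arbitrary: u m v n f)
  case Nil
  show ?case
  proof (cases "m \<ge> 0 \<or> n \<ge> 0")
    case False
    then have "m < 0" "n < 0" by auto
    then show ?thesis using low_act_comm[of m n u v "f []"]
      by (simp add: act_Nil mode_bracket_def)
  qed (rule act_comm_nonneg[OF Nil])
next
  case (Cons x w)
  let ?br = "mode_bracket X (smC X)" and ?T = "\<lambda>u n. act u n f w"
  note f = Cons.prems
  note T = act_mode_tail[OF f]
  have f': "tail x f \<in> coinduced" by (rule coinduced_tail[OF f])
  have t: "tail x (act v n f) = act v n (tail x f) + (\<lambda>w. ?br (\<lambda>u n. act u n f w) (fst x) (int (snd x)) v n)" for v n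
    by (simp add: fun_eq_iff T)
  have exp: "act u m (act v n f) (x # w) = act u m (act v n (tail x f)) w +
      ?br (\<lambda>y k. act u m (act y k f) w) (fst x) (int (snd x)) v n +
      ?br (\<lambda>y k. act y k (act v n f) w) (fst x) (int (snd x)) u m" for u m v n
    unfolding act_mode_tail[OF act_coinduced[OF f]] t act_add act_mode_bracket ..
  have comm: "?br (\<lambda>y k. act u m (act y k f) w) z l v n - ?br (\<lambda>y k. act y k (act u m f) w) z l v n =
      ?br (\<lambda>y k. ?br ?T u m y k) z l v n" for u m v n z l
    unfolding mode_bracket_diff[OF C.vector_space_axioms] Cons.IH[OF f] ..
  have diff: "act u m (act v n f) (x # w) - act v n (act u m f) (x # w) =
      ?br (\<lambda>u n. act u n (tail x f) w) u m v n + ?br (\<lambda>y k. ?br ?T u m y k) (fst x) (int (snd x)) v n -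
      ?br (\<lambda>y k. ?br ?T v n y k) (fst x) (int (snd x)) u m"
    unfolding exp comm[symmetric] Cons.IH[OF f', symmetric] by (simp add: algebra_simps)
  have jacobi: "?br (\<lambda>y k. ?br ?T u m y k) (fst x) (int (snd x)) v n -
      ?br (\<lambda>y k. ?br ?T v n y k) (fst x) (int (snd x)) u m =
      ?br (\<lambda>y k. ?br ?T (fst x) (int (snd x)) y k) u m v n"
  proof -
    have e1: "?br (\<lambda>y k. ?br ?T y k v n) (fst x) (int (snd x)) u m =
        ?br (\<lambda>y k. - ?br ?T v n y k) (fst x) (int (snd x)) u m"
      by (rule arg_cong[where f = "\<lambda>T. ?br T (fst x) (int (snd x)) u m"])
        (intro ext act_bracket_skew[OF f])
    have e2: "?br (\<lambda>y k. - ?br ?T v n y k) (fst x) (int (snd x)) u m =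
        - ?br (\<lambda>y k. ?br ?T v n y k) (fst x) (int (snd x)) u m"
      by (simp only: mode_bracket_def[of _ _ _ "fst x"] C.scale_minus_right minus_add_distrib)
    show ?thesis
      unfolding act_bracket_jacobi[OF f, of w "fst x" "int (snd x)" u m v n] e1 e2 by simp
  qed
  have "?br (\<lambda>u n. act u n f (x # w)) u m v n =
      ?br (\<lambda>u n. act u n (tail x f) w) u m v n + ?br (\<lambda>y k. ?br ?T (fst x) (int (snd x)) y k) u m v n"
    unfolding T mode_bracket_def[of _ _ _ u] by (simp add: C.scale_right_distrib)
  then show ?case unfolding diff jacobi[symmetric] by simp
qed

lemma subspace_coinduced: "module.subspace scale_fun coinduced"
proof (rule module.subspaceI)
  show "module (scale_fun :: complex \<Rightarrow> ('l \<Rightarrow> 'a \<times> 'b) \<Rightarrow> _)"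
    using vector_space_scale_fun module_iff_vector_space by blast
qed (auto simp: coinduced_def head_relations_add scale_fun_def head_relations_scale
    intro!: head_relations_add head_relations_scale, auto simp: head_relations_def)

lemma mode_module_coinduced: "mode_module X scale_fun coinduced act"
proof -
  interpret M: vector_space "scale_fun :: complex \<Rightarrow> ((('a \<times> 'b) \<times> nat) list \<Rightarrow> 'a \<times> 'b) \<Rightarrow> _"
    by (rule vector_space_scale_fun)
  show ?thesis
  proof unfold_locales
    show "act u m (act v n f) - act v n (act u m f) =
      act (prod0 X u v) (m + n) f + scale_fun (of_int m) (act (prod1 X u v) (m + n - 1) f)"
      if "f \<in> coinduced" for u m v n f
      using act_comm[OF that, of u m v n] by (simp add: fun_eq_iff mode_bracket_def scale_fun_def)
  qed (simp_all add: fun_eq_iff subspace_coinduced act_coinduced act_add act_scale act_add_left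
      act_scale_left act_del, simp_all add: scale_fun_def act_scale_left act_del
      act_scale[unfolded scale_fun_def[abs_def]])
qed

section \<open>The vacuum and the translation operator of the coinduced module\<close>

definition vac_fun :: "(('a \<times> 'b) \<times> nat) list \<Rightarrow> 'a \<times> 'b" where
  "vac_fun w = (if w = [] then (unitA X, 0) else 0)"

lemma vac_fun_coinduced: "vac_fun \<in> coinduced"
  by (simp add: coinduced_def head_relations_def vac_fun_def)

text \<open>The translation operator D. On the quotient A + B it sends a to del a, and b into degree
  two, hence to zero; a letter is passed by u(m) D = D u(m) + m u(m-1).\<close>

primrec der_at :: "(('a \<times> 'b) \<times> nat) list \<Rightarrow> ((('a \<times> 'b) \<times> nat) list \<Rightarrow> 'a \<times> 'b) \<Rightarrow> 'a \<times> 'b" where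
  "der_at [] f = (0, del X (fst (f [])))"
| "der_at (x # w) f = der_at w (tail x f) + smC X (of_nat (snd x)) (f ((fst x, snd x - 1) # w))"

definition der :: "((('a \<times> 'b) \<times> nat) list \<Rightarrow> 'a \<times> 'b) \<Rightarrow> (('a \<times> 'b) \<times> nat) list \<Rightarrow> 'a \<times> 'b" where
  "der f w = der_at w f"

lemma der_Nil: "der f [] = (0, del X (fst (f [])))"
  by (simp add: der_def)

lemma der_Cons: "der f (x # w) = der (tail x f) w + smC X (of_nat (snd x)) (f ((fst x, snd x - 1) # w))"
  by (simp add: der_def)

lemma der_add: "der (f + g) w = der f w + der g w"
proof (induction w arbitrary: f g)
  case (Cons x w)
  have t: "tail x (f + g) = tail x f + tail x g" by (simp add: fun_eq_iff)
  show ?case unfolding der_Cons t Cons by (simp add: C.scale_right_distrib)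
qed (simp add: der_Nil op_add)

lemma der_scale: "der (scale_fun c f) w = smC X c (der f w)"
proof (induction w arbitrary: f)
  case (Cons x w)
  have t: "tail x (scale_fun c f) = scale_fun c (tail x f)" by (simp add: fun_eq_iff scale_fun_def)
  show ?case unfolding der_Cons t Cons by (simp add: C.scale_right_distrib scale_fun_def mult.commute)
qed (simp add: der_Nil op_scale smC_def scale_fun_def)

text \<open>This is the counterpart of \<open>D_mode\<close>, and it makes the map from V_L
  intertwine the two translation operators. On the empty word, index -1 amounts to the Leibniz rule
  for \<open>del X\<close>.\<close>

lemma der_act: "der (act u n f) w = act u n (der f) w - smC X (of_int n) (act u (n - 1) f w)"
proof (induction w arbitrary: u n f)
  case Nil
  show ?case
  proof (cases "n < 0")
    case True
    consider "n = -1" | "n = -2" | "n < -2" using True by linarith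
    then show ?thesis
      by cases (simp_all add: der_Nil act_Nil low_act_def op_zero op_add del_mult zero_prod_def
          smC_def mult.commute)
  next
    case False
    then show ?thesis
      by (cases "n = 0") (simp_all add: act_nonneg der_Nil der_Cons nat_diff_distrib[symmetric] nat_diff_distrib)
  qed
next
  case (Cons x w)
  show ?case
  proof (cases "n < 0")
    case False
    then have "der (act u n f) (x # w) = der (tail (u, nat n) f) (x # w)"
      by (intro arg_cong[where f = "\<lambda>g. der g (x # w)"] ext) (simp add: act_nonneg)
    then show ?thesis using False
      by (cases "n = 0") (simp_all add: act_nonneg der_Cons[of f] nat_diff_distrib)
  next
    case True
    obtain v m where x: "x = (v, m)" by (cases x)
    have t: "tail (v, m) (act u n f) = act u n (tail (v, m) f) + (act (prod0 X v u) (int m + n) f +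
        scale_fun (of_nat m) (act (prod1 X v u) (int m + n - 1) f))"
      using act_Cons[OF True] by (simp add: fun_eq_iff mode_bracket_def scale_fun_def)
    have t': "tail (v, m) (der f) = der (tail (v, m) f) + scale_fun (of_nat m) (tail (v, m - 1) f)"
      by (simp add: fun_eq_iff der_Cons scale_fun_def)
    have n1: "n - 1 < 0" using True by simp
    have 1: "der (act u n f) ((v, m) # w) = act u n (der (tail (v, m) f)) w -
        smC X (of_int n) (act u (n - 1) (tail (v, m) f) w) +
        (act (prod0 X v u) (int m + n) (der f) w -
          smC X (of_int (int m + n)) (act (prod0 X v u) (int m + n - 1) f w) +
        smC X (of_nat m) (act (prod1 X v u) (int m + n - 1) (der f) w -
          smC X (of_int (int m + n - 1)) (act (prod1 X v u) (int m + n - 1 - 1) f w))) +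
        smC X (of_nat m) (act u n f ((v, m - 1) # w))"
      unfolding der_Cons[of "act u n f" "(v, m)"] t der_add der_scale Cons.IH fst_conv snd_conv ..
    have 2: "act u n (der f) ((v, m) # w) = act u n (der (tail (v, m) f)) w +
        smC X (of_nat m) (act u n (tail (v, m - 1) f) w) +
        (act (prod0 X v u) (int m + n) (der f) w +
         smC X (of_nat m) (act (prod1 X v u) (int m + n - 1) (der f) w))"
      unfolding act_Cons[OF True, of u "der f"] t' act_add act_scale
      by (simp add: mode_bracket_def)
    have 3: "smC X (of_nat m) (act u n f ((v, m - 1) # w)) =
        smC X (of_nat m) (act u n (tail (v, m - 1) f) w) +
        smC X (of_nat m) (act (prod0 X v u) (int m + n - 1) f w) +
        smC X (of_nat m * (of_nat m - 1)) (act (prod1 X v u) (int m + n - 1 - 1) f w)"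
      unfolding act_Cons[OF True]
      by (cases "m = 0") (simp_all add: mode_bracket_def of_nat_diff C.scale_right_distrib algebra_simps)
    have 4: "act u (n - 1) f ((v, m) # w) = act u (n - 1) (tail (v, m) f) w +
        act (prod0 X v u) (int m + n - 1) f w +
        smC X (of_nat m) (act (prod1 X v u) (int m + n - 1 - 1) f w)"
      unfolding act_Cons[OF n1] by (simp add: mode_bracket_def algebra_simps)
    \<comment> \<open>The coefficients agree: -(m + n) + m = -n for the 0-product at index m + n -
      1, and -m (m + n - 1) + m (m - 1) = -m n for the 1-product at index m + n - 2.\<close>
    show ?thesis
      unfolding x 1 2 3 4
      by (simp add: C.scale_right_distrib C.scale_left_distrib C.scale_right_diff_distrib
        C.scale_left_diff_distrib algebra_simps)
  qed
qed

end


section \<open>The images of A + B and of the relations in E\<close>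

context vertex_algebroid
begin

abbreviation creation_fun :: "'a \<times> 'b \<Rightarrow> (('a \<times> 'b) \<times> nat) list \<Rightarrow> 'a \<times> 'b" where
  "creation_fun u \<equiv> act u (-1) vac_fun"

lemma act_zero: "act u n (\<lambda>w. 0) w = 0"
  using act_scale[of u n 0 0 w] by (simp add: scale_fun_def[abs_def])

lemma act_zero_left: "f \<in> coinduced \<Longrightarrow> act 0 n f w = 0"
  using act_add_left[of f 0 0 n w] by simp

lemma act_vac_nonneg: "n \<ge> 0 \<Longrightarrow> act u n vac_fun w = 0"
  by (simp add: act_nonneg vac_fun_def)

text \<open>On the vacuum, [v(m), u(-1)] is (v_0 u)(m-1) + m (v_1 u)(m-2). Nonnegative modes kill
  the vacuum, which leaves v_0 u for m = 0 and v_1 u for m = 1.\<close>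

lemma creation_fun_Cons:
  "creation_fun u ((v, m) # w) =
    (if m = 0 then creation_fun (prod0 X v u) w else if m = 1 then creation_fun (prod1 X v u) w else 0)"
proof -
  have "tail (v, m) vac_fun = (\<lambda>w. 0)" for v and m :: nat by (simp add: vac_fun_def)
  then show ?thesis
    by (simp add: act_Cons mode_bracket_def act_zero act_vac_nonneg)
qed

text \<open>The relations are needed on all words, that is, after applying any nonnegative modes. A
  letter v(m) turns each into relations of the same kind: for m = 0 by \<open>anchor_mult\<close>,
  \<open>anchor_actB\<close> and \<open>brB_actB\<close>, for m = 1 by \<open>pairB_actB\<close>;
  for m >= 2 both sides vanish.\<close>

lemma creation_fun_relations:
  "creation_fun (unitA X, 0) w = vac_fun w"
  "act (a, 0) (-1) (creation_fun (a', 0)) w = creation_fun (a * a', 0) w"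
  "act (a, 0) (-1) (creation_fun (0, b)) w = creation_fun (0, actB X a b) w"
proof (induction w arbitrary: a a' b)
  case Nil
  { case 1 show ?case by (simp add: act_Nil low_act_def vac_fun_def unitA op_zero) }
  { case 2 show ?case by (simp add: act_Nil low_act_def vac_fun_def unitA_right op_zero mult.assoc) }
  { case 3 show ?case by (simp add: act_Nil low_act_def vac_fun_def op_zero actB_unit) }
next
  case (Cons x w)
  obtain v m where x: "x = (v, m)" by (cases x)
  let ?c = "\<lambda>a. anchor X (snd v) a"
  have coind: "creation_fun u \<in> coinduced" for u
    by (rule act_coinduced[OF vac_fun_coinduced])
  have step: "act (a, 0) (-1) f (x # w) = act (a, 0) (-1) (tail x f) w + act (?c a, 0) (int m - 1) f w"
    if "f \<in> coinduced" for f a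
    using that by (simp add: act_Cons mode_bracket_def x act_zero_left)
  have c_add: "creation_fun (u + u') w = creation_fun u w + creation_fun u' w" for u u' w
    by (rule act_add_left[OF vac_fun_coinduced])
  consider "m = 0" | "m = 1" | "m \<ge> 2" by linarith
  note m = this
  { case 1
    have "creation_fun 0 w = 0" by (rule act_zero_left[OF vac_fun_coinduced])
    then show ?case by (simp add: x creation_fun_Cons flip: zero_prod_def) (simp add: vac_fun_def) }
  { case 2
    from m show ?case
    proof cases
      case 1
      then have "tail x (creation_fun (a', 0)) = creation_fun (?c a', 0)"
        by (simp add: fun_eq_iff x creation_fun_Cons)
      then show ?thesis
        unfolding step[OF coind] using Cons.IH(2)[of a "?c a'"] Cons.IH(2)[of "?c a" a'] 1
          c_add[of "(a * ?c a', 0)" "(?c a * a', 0)" w]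
        by (simp add: x creation_fun_Cons anchor_mult add.commute)
    next
      case 2
      then have "tail x (creation_fun (a', 0)) = (\<lambda>w. 0)"
        by (simp add: fun_eq_iff x creation_fun_Cons act_zero_left[OF vac_fun_coinduced])
      then show ?thesis
        unfolding step[OF coind] using 2
        by (simp add: x creation_fun_Cons act_zero act_nonneg op_zero
            act_zero_left[OF vac_fun_coinduced] flip: zero_prod_def)
    next
      case 3
      then have "tail x (creation_fun (a', 0)) = (\<lambda>w. 0)"
        by (simp add: fun_eq_iff x creation_fun_Cons)
      then show ?thesis
        unfolding step[OF coind] using 3
        by (simp add: x creation_fun_Cons act_zero act_nonneg op_zero
            act_zero_left[OF vac_fun_coinduced] flip: zero_prod_def)
    qed }
  { case 3
    from m show ?case
    proof cases
      case 1
      let ?d = "- anchor X b (fst v)" and ?e = "brB X (snd v) b"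
      have "tail x (creation_fun (0, b)) = creation_fun (?d, 0) + creation_fun (0, ?e)"
        using c_add[of "(?d, 0)" "(0, ?e)"] 1
        by (simp add: fun_eq_iff x creation_fun_Cons prod0_def op_zero)
      moreover have "creation_fun (0, actB X a b) (x # w) = creation_fun (a * ?d, 0) w +
          creation_fun (0, actB X a ?e) w + creation_fun (0, actB X (?c a) b) w"
        using 1 c_add[of "(a * ?d, 0)" "(0, actB X a ?e)" w]
          c_add[of "(a * ?d, actB X a ?e)" "(0, actB X (?c a) b)" w]
        by (simp add: x creation_fun_Cons prod0_def anchor_actB brB_actB op_zero add.commute)
      ultimately show ?thesis
        unfolding step[OF coind] using 1
        by (simp add: act_add Cons.IH)
    next
      case 2
      \<comment> \<open>The term \<open>?q\<close> is pi(v)(a) with mode 0 applied to b; it accounts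
        for the second-order term in \<open>pairB_actB\<close>.\<close>
      let ?p = "pairB X (snd v) b" and ?q = "- anchor X b (?c a)"
      have "tail x (creation_fun (0, b)) = creation_fun (?p, 0)"
        using 2 by (simp add: fun_eq_iff x creation_fun_Cons prod1_def)
      moreover have "act (?c a, 0) 0 (creation_fun (0, b)) w = creation_fun (?q, 0) w"
        by (simp add: act_nonneg creation_fun_Cons)
      moreover have "pairB X (snd v) (actB X a b) = a * ?p + ?q"
        using pairB_actB[of a b "snd v"] by (simp add: pairB_sym)
      moreover have "creation_fun (a * ?p + ?q, 0) w = creation_fun (a * ?p, 0) w + creation_fun (?q, 0) w"
        using c_add[of "(a * ?p, 0)" "(?q, 0)" w] by simp
      ultimately show ?thesis
        unfolding step[OF coind] using 2
        by (simp add: x creation_fun_Cons prod1_def Cons.IH)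
    next
      case 3
      then have "tail x (creation_fun (0, b)) = (\<lambda>w. 0)"
        by (simp add: fun_eq_iff x creation_fun_Cons)
      then show ?thesis
        unfolding step[OF coind] using 3
        by (simp add: x creation_fun_Cons act_zero act_nonneg op_zero
            act_zero_left[OF vac_fun_coinduced] flip: zero_prod_def)
    qed }
qed

lemma creation_fun_Nil: "creation_fun u [] = u"
  by (cases u) (simp add: act_Nil low_act_def vac_fun_def unitA_right actB_unit op_zero)

lemma del_unit [simp]: "del X (unitA X) = 0"
  using del_mult[of "unitA X" "unitA X"] by (simp add: unitA actB_unit)

lemma der_zero: "der 0 w = 0"
  using der_add[of 0 0 w] by simp

lemma der_vac: "der vac_fun w = 0"
proof (induction w)
  case (Cons x w)
  have "tail x vac_fun = scale_fun 0 vac_fun" by (simp add: fun_eq_iff vac_fun_def scale_fun_def)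
  then show ?case by (simp add: der_Cons der_scale) (simp add: vac_fun_def)
qed (simp add: der_Nil vac_fun_def zero_prod_def)

end


section \<open>The vertex algebra structure\<close>

lemma (in vector_space) Sum_any_in_subspace:
  assumes "subspace S" "\<And>i. g i \<in> S"
  shows "Sum_any g \<in> S"
  unfolding Sum_any.expand_set by (intro subspace_sum assms)

context vertex_algebra
begin

lemma Y_zero_right [simp]: "u \<in> V \<Longrightarrow> Y u n 0 = 0"
  using Y_scale_right[of u vac n 0] vac_in by simp

text \<open>The Borcherds identity at m = 0, where only i = 0 survives on the left.\<close>

lemma iterate_formula:
  assumes "u \<in> V" "v \<in> V" "w \<in> V"
  shows "Y (Y u l v) n w = Sum_any (\<lambda>i::nat. scale ((-1) ^ i * (of_int l gchoose i))
    (Y u (l - int i) (Y v (n + int i) w) - scale ((-1) powi l) (Y v (n + l - int i) (Y u (int i) w))))"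
proof -
  have "Sum_any (\<lambda>i::nat. scale (of_int 0 gchoose i) (Y (Y u (l + int i) v) (0 + n - int i) w)) =
      (\<Sum>i\<in>{0}. scale (of_int 0 gchoose i) (Y (Y u (l + int i) v) (0 + n - int i) w))"
    by (rule Sum_any.expand_superset) (auto simp: gbinomial_0_left split: if_splits)
  then have "Y (Y u l v) n w =
      Sum_any (\<lambda>i::nat. scale (of_int 0 gchoose i) (Y (Y u (l + int i) v) (0 + n - int i) w))"
    by simp
  also note borcherds[OF assms, of 0 l n]
  finally show ?thesis by simp
qed

text \<open>The Borcherds identity at l = 0, where only i = 0 survives on the right.\<close>

lemma commutator_formula:
  assumes "u \<in> V" "v \<in> V" "w \<in> V"
  shows "Y u m (Y v n w) - Y v n (Y u m w) =
    Sum_any (\<lambda>i::nat. scale (of_int m gchoose i) (Y (Y u (int i) v) (m + n - int i) w))"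
proof -
  let ?g = "\<lambda>i::nat. scale ((-1) ^ i * (of_int 0 gchoose i)) (Y u (m + 0 - int i) (Y v (n + int i) w)
         - scale ((-1) powi 0) (Y v (n + 0 - int i) (Y u (m + int i) w)))"
  have "Sum_any ?g = sum ?g {0}"
    by (rule Sum_any.expand_superset) (auto simp: gbinomial_0_left split: if_splits)
  then have "Y u m (Y v n w) - Y v n (Y u m w) = Sum_any ?g" by simp
  also note borcherds[OF assms, of m 0 n, symmetric]
  finally show ?thesis by simp
qed

definition D :: "'v \<Rightarrow> 'v" where
  "D v = Y v (-2) vac"

lemma D_in: "v \<in> V \<Longrightarrow> D v \<in> V"
  by (simp add: D_def Y_in vac_in)

lemma D_vac [simp]: "D vac = 0"
  by (simp add: D_def vacuum vac_in)

lemma D_add: "v \<in> V \<Longrightarrow> w \<in> V \<Longrightarrow> D (v + w) = D v + D w"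
  by (simp add: D_def Y_add_left vac_in)

lemma D_scale: "v \<in> V \<Longrightarrow> D (scale c v) = scale c (D v)"
  by (simp add: D_def Y_scale_left vac_in)

text \<open>The iterate formula on the vacuum at index -2: u_i vac = 0 removes its second half, and
  v_(i-2) vac = 0 for i >= 2 leaves i = 0 and i = 1, the latter giving the term with factor
  n.\<close>

lemma D_Y:
  assumes "u \<in> V" "v \<in> V"
  shows "D (Y u n v) = Y u n (D v) - scale (of_int n) (Y u (n - 1) v)"
proof -
  let ?g = "\<lambda>i::nat. scale ((-1) ^ i * (of_int n gchoose i))
    (Y u (n - int i) (Y v (-2 + int i) vac) - scale ((-1) powi n) (Y v (-2 + n - int i) (Y u (int i) vac)))"
  have z: "?g i = 0" if "i \<noteq> 0" "i \<noteq> 1" for i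
    using that assms by (simp add: creation_nonneg vac_in)
  have "D (Y u n v) = Sum_any ?g"
    unfolding D_def by (rule iterate_formula[OF assms vac_in])
  also have "\<dots> = sum ?g {0, 1}"
    using z by (intro Sum_any.expand_superset) auto
  also have "\<dots> = Y u n (D v) - scale (of_int n) (Y u (n - 1) v)"
    using assms by (simp add: creation creation_nonneg vac_in D_def)
  finally show ?thesis .
qed

end

locale VL_structure = vertex_algebroid X
  for X :: "('a::comm_ring, 'b::ab_group_add) algebroid" +
  fixes Y :: "('a, 'b) loop free_alg vertex_op"
  assumes vertex_structure: "VL_vertex_structure X Y"
begin

sublocale V: vertex_algebra fa_scale "VL X" "VL_vac X" Y
  using vertex_structure unfolding VL_vertex_structure_def by blast

lemma Y_emb: "v \<in> VL X \<Longrightarrow> Y (VL_emb X u) n v = VL_mode X u n v"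
  using vertex_structure unfolding VL_vertex_structure_def by blast

lemma VL_emb_in: "VL_emb X u \<in> VL X"
  by (simp add: VL_emb_def VL_mode_in VL_vac_in)

lemma VL_emb_add: "VL_emb X (u + v) = VL_emb X u + VL_emb X v"
  by (simp add: VL_emb_def VL_mode_add_left VL_vac_in)

lemma VL_emb_scale: "VL_emb X (smC X c u) = fa_scale c (VL_emb X u)"
  by (simp add: VL_emb_def VL_mode_scale_left VL_vac_in)

lemma D_mode:
  "v \<in> VL X \<Longrightarrow> V.D (VL_mode X u n v) = VL_mode X u n (V.D v) - fa_scale (of_int n) (VL_mode X u (n - 1) v)"
  using V.D_Y[OF VL_emb_in, of v u n] by (simp add: Y_emb V.D_in)

section \<open>The subspace I_B is a two-sided ideal\<close>

lemma IB_gens: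
  "IB X Y = fa.span {VL_act X x ((V.D ^^ k) v) | x k v. x \<in> U_carrier X \<and> v \<in> E_space X}"
  unfolding IB_def V.D_def ..

lemma E_space_in: "E_space X \<subseteq> VL X"
  unfolding E_space_def
  by (rule fa.span_minimal)
    (auto intro!: subspace_VL fa.subspace_diff[OF subspace_VL] VL_mode_in VL_emb_in VL_vac_in)

lemma D_pow_in: "v \<in> VL X \<Longrightarrow> (V.D ^^ k) v \<in> VL X"
  by (induction k) (auto intro: V.D_in)

lemma subspace_IB: "fa.subspace (IB X Y)"
  by (simp add: IB_gens)

text \<open>Inclusion of \<open>IB\<close> in a kernel or a preimage can thus be verified separately
  on \<open>E_space\<close>, on translation and on modes.\<close>

lemma IB_least:
  assumes "fa.subspace S" "S \<subseteq> VL X" "E_space X \<subseteq> S"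
    "\<And>v. v \<in> S \<Longrightarrow> V.D v \<in> S" "\<And>u n v. v \<in> S \<Longrightarrow> VL_mode X u n v \<in> S"
  shows "IB X Y \<subseteq> S"
proof -
  have "(V.D ^^ k) v \<in> S" if "v \<in> S" for v k
    using that by (induction k) (auto intro: assms)
  then show ?thesis
    unfolding IB_gens using assms
    by (intro fa.span_minimal) (auto intro!: VL_act_in_subspace[where S = S])
qed

lemma IB_in_VL: "IB X Y \<subseteq> VL X"
  by (rule IB_least) (auto intro: subspace_VL V.D_in VL_mode_in subsetD[OF E_space_in])

lemma D_pow_E_in_IB:
  assumes "v \<in> E_space X"
  shows "(V.D ^^ k) v \<in> IB X Y"
proof -
  have "(V.D ^^ k) v \<in> VL X" using assms E_space_in D_pow_in by blast
  then obtain x where x: "x \<in> U_carrier X" "VL_act X x ((V.D ^^ k) v) = (V.D ^^ k) v"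
    using VL_act_one by blast
  then have "VL_act X x ((V.D ^^ k) v) \<in> IB X Y"
    unfolding IB_gens using assms by (intro fa.span_base) blast
  with x show ?thesis by simp
qed

lemma E_in_IB: "E_space X \<subseteq> IB X Y"
  using D_pow_E_in_IB[of _ 0] by auto

lemma IB_mode: "w \<in> IB X Y \<Longrightarrow> VL_mode X u n w \<in> IB X Y"
  unfolding IB_gens
proof (induction w rule: fa.span_induct)
  case base
  show ?case
    by (rule fa.subspaceI)
      (auto simp: VL_mode_add_right VL_mode_scale_right VL_mode_scale_right[of _ _ 0 0, simplified]
        fa.span_zero fa.span_add fa.span_scale)
next
  case (step w)
  then obtain x k v where w: "w = VL_act X x ((V.D ^^ k) v)" "x \<in> U_carrier X" "v \<in> E_space X" by blast
  then have "(V.D ^^ k) v \<in> VL X" using E_space_in D_pow_in by blast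
  from VL_act_mode[OF w(2) this] obtain x'
    where "x' \<in> U_carrier X" "VL_mode X u n w = VL_act X x' ((V.D ^^ k) v)" unfolding w by blast
  then show ?case using w by (auto intro!: fa.span_base)
qed

text \<open>In the definition of \<open>IB\<close> translation comes before U(L), so D has to be
  moved inward past the modes; the extra terms in \<open>D_mode\<close> are modes again and stay in
  the ideal.\<close>

lemma IB_D:
  assumes "w \<in> IB X Y" shows "V.D w \<in> IB X Y"
proof -
  let ?S = "{w \<in> IB X Y. V.D w \<in> IB X Y}"
  have S: "fa.subspace ?S"
    using IB_in_VL fa.subspace_0[OF subspace_IB] V.D_scale[of 0 0] fa.subspace_0[OF subspace_VL]
    by (intro fa.subspaceI)
      (auto simp: V.D_add V.D_scale subsetD fa.subspace_add[OF subspace_IB] fa.subspace_scale[OF subspace_IB])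
  have "VL_act X x ((V.D ^^ k) v) \<in> ?S" if "x \<in> U_carrier X" "v \<in> E_space X" for x k v
  proof (rule VL_act_in_subspace[OF S])
    show "?S \<subseteq> VL X" using IB_in_VL by blast
    show "(V.D ^^ k) v \<in> ?S"
      using D_pow_E_in_IB[OF that(2), of k] D_pow_E_in_IB[OF that(2), of "Suc k"] by simp
    show "VL_mode X u n w \<in> ?S" if "w \<in> ?S" for u n w
      using that IB_in_VL IB_mode fa.subspace_diff[OF subspace_IB] fa.subspace_scale[OF subspace_IB]
      by (auto simp: D_mode subsetD)
  qed (rule that)
  then have "IB X Y \<subseteq> ?S"
    unfolding IB_gens by (intro fa.span_minimal S[unfolded IB_gens]) blast
  then show ?thesis using assms by blast
qed

lemma VL_induct [consumes 1, case_names zero add scale vac mode]: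
  assumes "v \<in> VL X" and "P 0" and "\<And>v w. v \<in> VL X \<Longrightarrow> w \<in> VL X \<Longrightarrow> P v \<Longrightarrow> P w \<Longrightarrow> P (v + w)"
    and "\<And>c v. v \<in> VL X \<Longrightarrow> P v \<Longrightarrow> P (fa_scale c v)" and "P (VL_vac X)"
    and "\<And>u n v. v \<in> VL X \<Longrightarrow> P v \<Longrightarrow> P (VL_mode X u n v)"
  shows "P v"
proof -
  have "VL X \<subseteq> {v \<in> VL X. P v}"
    using assms(2-)
    by (intro VL_induct_subspace fa.subspaceI)
      (auto intro: VL_vac_in VL_mode_in fa.subspace_0[OF subspace_VL] fa.subspace_add[OF subspace_VL]
        fa.subspace_scale[OF subspace_VL])
  then show ?thesis using assms(1) by blast
qed

lemma Y_zero_left [simp]: "v \<in> VL X \<Longrightarrow> Y 0 n v = 0"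
  using V.Y_scale_left[OF VL_vac_in, of v 0 n] by simp

text \<open>The iterate formula reduces the operation of u(k)v to the operations of v and the modes
  of u, under which the ideal is closed.\<close>

lemma IB_left:
  assumes "u \<in> VL X" "w \<in> IB X Y"
  shows "Y u n w \<in> IB X Y"
  using assms
proof (induction u arbitrary: n w rule: VL_induct)
  case zero
  then show ?case using IB_in_VL fa.subspace_0[OF subspace_IB] by (auto simp: subsetD)
next
  case (add v v')
  then show ?case using IB_in_VL fa.subspace_add[OF subspace_IB] by (auto simp: V.Y_add_left subsetD)
next
  case (scale c v)
  then show ?case using IB_in_VL fa.subspace_scale[OF subspace_IB] by (auto simp: V.Y_scale_left subsetD)
next
  case vac
  then show ?case using IB_in_VL fa.subspace_0[OF subspace_IB] by (auto simp: V.vacuum subsetD)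
next
  case (mode c k v)
  have w: "w \<in> VL X" using mode IB_in_VL by blast
  have "VL_mode X c k v = Y (VL_emb X c) k v" using mode by (simp add: Y_emb)
  moreover have "Y (Y (VL_emb X c) k v) n w \<in> IB X Y"
    unfolding V.iterate_formula[OF VL_emb_in mode.hyps w]
    using mode w
    by (intro fa.Sum_any_in_subspace[OF subspace_IB] fa.subspace_scale[OF subspace_IB]
        fa.subspace_diff[OF subspace_IB])
      (auto simp: Y_emb V.Y_in VL_emb_in intro: IB_mode)
  ultimately show ?case by simp
qed

text \<open>For n = -1 - k the vector is D^k w / k!, obtained by dividing D(w_(-1-k) vac) = (k + 1)
  w_(-2-k) vac by k + 1.\<close>

lemma IB_vac:
  assumes "w \<in> IB X Y"
  shows "Y w n (VL_vac X) \<in> IB X Y"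
proof (cases "n \<ge> 0")
  case True
  then show ?thesis using assms IB_in_VL fa.subspace_0[OF subspace_IB]
    by (auto simp: V.creation_nonneg subsetD)
next
  case False
  have w: "w \<in> VL X" using assms IB_in_VL by blast
  have "Y w (- 1 - int k) (VL_vac X) \<in> IB X Y" for k
  proof (induction k)
    case 0
    then show ?case using assms w by (simp add: V.creation)
  next
    case (Suc k)
    let ?n = "- 1 - int k"
    have "V.D (Y w ?n (VL_vac X)) = fa_scale (of_nat k + 1) (Y w (?n - 1) (VL_vac X))"
      using V.D_Y[OF w VL_vac_in, of ?n] w by (simp flip: fa.scale_minus_left)
    then have "Y w (?n - 1) (VL_vac X) = fa_scale (1 / (of_nat k + 1)) (V.D (Y w ?n (VL_vac X)))"
      by (simp add: add.commute of_nat_Suc[symmetric] del: of_nat_Suc)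
    then have "Y w (?n - 1) (VL_vac X) \<in> IB X Y"
      using Suc IB_D fa.subspace_scale[OF subspace_IB] by simp
    moreover have "- 1 - int (Suc k) = ?n - 1" by simp
    ultimately show ?case by (simp only:)
  qed
  from this[of "nat (- 1 - n)"] show ?thesis using False by simp
qed

text \<open>Induction on the right argument bypasses skew-symmetry: the commutator with a mode of u
  produces only terms (u_i w)_j v, where u_i w is in the ideal by \<open>IB_left\<close>. Hence the
  induction runs over all \<open>w\<close>.\<close>

lemma IB_right:
  assumes "v \<in> VL X" "w \<in> IB X Y"
  shows "Y w n v \<in> IB X Y"
  using assms
proof (induction v arbitrary: n w rule: VL_induct)
  case zero
  then show ?case using IB_in_VL fa.subspace_0[OF subspace_IB] by (auto simp: subsetD)
next
  case (add v v')
  then show ?case using IB_in_VL fa.subspace_add[OF subspace_IB] by (auto simp: V.Y_add_right subsetD)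
next
  case (scale c v)
  then show ?case using IB_in_VL fa.subspace_scale[OF subspace_IB] by (auto simp: V.Y_scale_right subsetD)
next
  case vac
  then show ?case by (simp add: IB_vac)
next
  case (mode c k v)
  have w: "w \<in> VL X" using mode IB_in_VL by blast
  let ?u = "VL_emb X c"
  have "Y ?u k (Y w n v) - Y w n (Y ?u k v) \<in> IB X Y"
    unfolding V.commutator_formula[OF VL_emb_in w mode.hyps]
    using mode w
    by (intro fa.Sum_any_in_subspace[OF subspace_IB] fa.subspace_scale[OF subspace_IB] mode.IH IB_left)
      (auto simp: VL_emb_in)
  moreover have "Y ?u k (Y w n v) \<in> IB X Y" using mode by (intro IB_left VL_emb_in mode.IH)
  ultimately have "Y ?u k (Y w n v) - (Y ?u k (Y w n v) - Y w n (Y ?u k v)) \<in> IB X Y"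
    using fa.subspace_diff[OF subspace_IB] by blast
  then show ?case using mode by (simp add: Y_emb)
qed

theorem inj_VB_emb: "inj (VB_emb X Y)"
proof -
  interpret M: mode_module X scale_fun coinduced act by (rule mode_module_coinduced)
  have "act u n vac_fun = 0" if "n \<ge> 0" for u n
    using act_vac_nonneg[OF that] by (simp add: fun_eq_iff)
  from M.VL_universal[OF vac_fun_coinduced this]
  obtain H where lin: "Vector_Spaces.linear fa_scale scale_fun H" and vac: "H (VL_vac X) = vac_fun"
    and coind: "\<And>v. H v \<in> coinduced"
    and H_mode: "\<And>u n v. v \<in> VL X \<Longrightarrow> H (VL_mode X u n v) = act u n (H v)" by metis
  interpret H: Vector_Spaces.linear fa_scale scale_fun H by (rule lin)
  have emb: "H (VL_emb X u) = creation_fun u" for u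
    by (simp add: VL_emb_def H_mode VL_vac_in vac)
  have D: "H (V.D v) = der (H v)" if "v \<in> VL X" for v
    using that
  proof (induction v rule: VL_induct)
    case zero
    then show ?case using V.D_scale[OF VL_vac_in, of 0] by (simp add: H.zero fun_eq_iff der_zero[unfolded zero_fun_def])
  next
    case (mode u n v)
    then show ?case
      by (intro ext) (simp add: D_mode H.diff H.scale H_mode V.D_in der_act scale_fun_def)
  next
    case (add v w)
    then show ?case by (intro ext) (simp only: V.D_add H.add, subst der_add, simp)
  next
    case (scale c v)
    then show ?case by (intro ext) (simp only: V.D_scale H.scale, subst der_scale, simp add: scale_fun_def)
  next
    case vac
    show ?case by (intro ext) (simp add: H.zero \<open>H (VL_vac X) = vac_fun\<close> der_vac)
  qed
  let ?S = "{v \<in> VL X. H v = 0}"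
  have S: "fa.subspace ?S"
    by (rule fa.subspaceI)
      (auto simp: H.zero H.add H.scale fa.subspace_0[OF subspace_VL] fa.subspace_add[OF subspace_VL]
        fa.subspace_scale[OF subspace_VL])
  have "IB X Y \<subseteq> ?S"
  proof (rule IB_least[OF S])
    have "H (VL_emb X (unitA X, 0) - VL_vac X) = 0"
      "H (VL_mode X (a, 0) (-1) (VL_emb X (a', 0)) - VL_emb X (a * a', 0)) = 0"
      "H (VL_mode X (a, 0) (-1) (VL_emb X (0, b)) - VL_emb X (0, actB X a b)) = 0" for a a' b
      by (simp_all add: H.diff emb vac H_mode VL_emb_in fun_eq_iff creation_fun_relations)
    then show "E_space X \<subseteq> ?S"
      unfolding E_space_def
      by (intro fa.span_minimal S)
        (auto intro!: fa.subspace_diff[OF subspace_VL] VL_mode_in VL_emb_in VL_vac_in)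
    show "V.D v \<in> ?S" if "v \<in> ?S" for v
    proof -
      have "H (V.D v) = der 0" using that D by simp
      moreover have "der 0 = 0" by (rule ext) (simp only: der_zero zero_fun_apply)
      ultimately show ?thesis using that by (simp add: V.D_in)
    qed
    show "VL_mode X u n v \<in> ?S" if "v \<in> ?S" for u n v
      using that by (auto simp: VL_mode_in H_mode)
  qed auto
  show ?thesis
  proof (rule injI)
    fix u v assume "VB_emb X Y u = VB_emb X Y v"
    then have "VL_emb X u - VL_emb X v \<in> IB X Y"
      by (simp add: VB_emb_def VB_proj_def quot_map_eq_iff[OF vector_space_fa_scale subspace_IB])
    with \<open>IB X Y \<subseteq> ?S\<close> have "H (VL_emb X u - VL_emb X v) = 0" by blast
    then have "creation_fun u [] = creation_fun v []" by (simp add: H.diff emb fun_eq_iff)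
    then show "u = v" by (simp add: creation_fun_Nil)
  qed
qed

end


section \<open>The components of degree zero and one\<close>

text \<open>With negative indices only, no factor lowers the degree, so the possible factors in
  degrees 0 and 1 can be enumerated.\<close>

inductive VL_neg_monomial ::
  "('a::comm_ring, 'b::ab_group_add) algebroid \<Rightarrow> int \<Rightarrow> ('a, 'b) loop free_alg \<Rightarrow> bool"
  for X where
  neg_vac: "VL_neg_monomial X 0 (VL_vac X)"
| neg_A: "VL_neg_monomial X d v \<Longrightarrow> n < 0 \<Longrightarrow> VL_neg_monomial X (d - n - 1) (VL_mode X (a, 0) n v)"
| neg_B: "VL_neg_monomial X d v \<Longrightarrow> n < 0 \<Longrightarrow> VL_neg_monomial X (d - n) (VL_mode X (0, b) n v)"

definition VL_neg_deg :: "('a::comm_ring, 'b::ab_group_add) algebroid \<Rightarrow> int \<Rightarrow> ('a, 'b) loop free_alg set" where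
  "VL_neg_deg X d = module.span fa_scale {v. VL_neg_monomial X d v}"

context vertex_algebroid
begin

lemma VL_neg_monomial_in: "VL_neg_monomial X d v \<Longrightarrow> v \<in> VL X"
  by (induction rule: VL_neg_monomial.induct) (auto intro: VL_vac_in VL_mode_in)

lemma VL_monomial_in: "VL_monomial X d v \<Longrightarrow> v \<in> VL X"
  by (induction rule: VL_monomial.induct) (auto intro: VL_vac_in VL_mode_in)

lemma VL_deg_in: "VL_deg X d \<subseteq> VL X"
  unfolding VL_deg_def by (rule fa.span_minimal) (auto intro: VL_monomial_in subspace_VL)

lemma subspace_VL_neg_deg: "fa.subspace (VL_neg_deg X d)"
  by (simp add: VL_neg_deg_def)

lemma VL_mode_span:
  assumes "v \<in> fa.span P" "fa.subspace S" "\<And>v. v \<in> P \<Longrightarrow> VL_mode X u n v \<in> S"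
  shows "VL_mode X u n v \<in> S"
  using assms(1)
proof (induction v rule: fa.span_induct)
  case base
  show ?case using assms(2) VL_mode_scale_right[of u n 0 0]
    by (intro fa.subspaceI)
      (auto simp: VL_mode_add_right VL_mode_scale_right fa.subspace_0 fa.subspace_add fa.subspace_scale)
qed (use assms in auto)

lemma VL_neg_deg_base: "VL_neg_monomial X d v \<Longrightarrow> v \<in> VL_neg_deg X d"
  by (simp add: VL_neg_deg_def fa.span_base)

lemma VL_neg_deg_mode_neg:
  assumes "v \<in> VL_neg_deg X d" "n < 0"
  shows "VL_mode X (a, 0) n v \<in> VL_neg_deg X (d - n - 1)" "VL_mode X (0, b) n v \<in> VL_neg_deg X (d - n)"
  by (rule VL_mode_span[OF assms(1)[unfolded VL_neg_deg_def] subspace_VL_neg_deg];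
      simp add: VL_neg_deg_base neg_A neg_B assms(2))+

lemma VL_mode_swap:
  assumes "w \<in> VL X"
  shows "VL_mode X u m (VL_mode X v n w) = VL_mode X v n (VL_mode X u m w) +
    (VL_mode X (prod0 X u v) (m + n) w + fa_scale (of_int m) (VL_mode X (prod1 X u v) (m + n - 1) w))"
  using VL_mode_comm[OF assms, of u m v n] by (simp add: algebra_simps)

lemma VL_mode_zero_left: "v \<in> VL X \<Longrightarrow> VL_mode X 0 n v = 0"
  using VL_mode_scale_left[of v 0 0 n] by simp

text \<open>A nonnegative mode is moved to the right until it kills the vacuum. Each commutator term
  is a mode of some other index on a shorter monomial, so the induction covers all indices and both
  summands at once.\<close>

lemma VL_neg_monomial_mode:
  assumes "VL_neg_monomial X d v"
  shows "VL_mode X (a, 0) n v \<in> VL_neg_deg X (d - n - 1) \<and> VL_mode X (0, b) n v \<in> VL_neg_deg X (d - n)"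
  using assms
proof (induction arbitrary: a b n rule: VL_neg_monomial.induct)
  case neg_vac
  show ?case
    by (cases "n < 0")
      (auto simp: VL_mode_vac fa.subspace_0[OF subspace_VL_neg_deg] VL_neg_deg_def
        intro!: fa.span_base neg_A[of _ 0, simplified] neg_B[of _ 0, simplified]
          VL_neg_monomial.neg_vac fa.span_zero)
next
  case (neg_A d v k c)
  show ?case
  proof (cases "n < 0")
    case True
    then show ?thesis
      using VL_neg_deg_mode_neg[OF VL_neg_deg_base[OF VL_neg_monomial.neg_A[OF neg_A.hyps]] True]
      by blast
  next
    case False
    have v: "v \<in> VL X" using neg_A.hyps VL_neg_monomial_in by blast
    have "VL_mode X (c, 0) k (VL_mode X (a, 0) n v) \<in> VL_neg_deg X ((d - n - 1) - k - 1)"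
      using neg_A by (blast intro: VL_neg_deg_mode_neg)
    moreover have "VL_mode X (c, 0) k (VL_mode X (0, b) n v) \<in> VL_neg_deg X ((d - n) - k - 1)"
      using neg_A by (blast intro: VL_neg_deg_mode_neg)
    moreover have "VL_mode X (anchor X b c, 0) (n + k) v \<in> VL_neg_deg X (d - (n + k) - 1)"
      using neg_A by auto
    ultimately show ?thesis
      unfolding VL_mode_swap[OF v, of "(a, 0)"] VL_mode_swap[OF v, of "(0, b)"]
      using fa.subspace_add[OF subspace_VL_neg_deg]
      by (auto simp: VL_mode_zero_left[OF v] op_zero algebra_simps simp flip: zero_prod_def)
  qed
next
  case (neg_B d v k c)
  show ?case
  proof (cases "n < 0")
    case True
    then show ?thesis
      using VL_neg_deg_mode_neg[OF VL_neg_deg_base[OF VL_neg_monomial.neg_B[OF neg_B.hyps]] True]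
      by blast
  next
    case False
    have v: "v \<in> VL X" using neg_B.hyps VL_neg_monomial_in by blast
    have 1: "VL_mode X (0, c) k (VL_mode X (a, 0) n v) \<in> VL_neg_deg X ((d - n - 1) - k)"
      using neg_B by (blast intro: VL_neg_deg_mode_neg)
    have 2: "VL_mode X (0, c) k (VL_mode X (0, b) n v) \<in> VL_neg_deg X ((d - n) - k)"
      using neg_B by (blast intro: VL_neg_deg_mode_neg)
    have 3: "VL_mode X (- anchor X c a, 0) (n + k) v \<in> VL_neg_deg X (d - (n + k) - 1)"
      using neg_B by auto
    have 4: "VL_mode X (0, brB X b c) (n + k) v \<in> VL_neg_deg X (d - (n + k))"
      using neg_B by auto
    have "VL_mode X (pairB X b c, 0) (n + k - 1) v \<in> VL_neg_deg X (d - (n + k - 1) - 1)"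
      using neg_B by blast
    then have 5: "fa_scale (of_int n) (VL_mode X (pairB X b c, 0) (n + k - 1) v) \<in> VL_neg_deg X (d - k - n)"
      using fa.subspace_scale[OF subspace_VL_neg_deg] by (simp add: algebra_simps)
    have "d - n - 1 - k = d - k - n - 1" "d - (n + k) - 1 = d - k - n - 1" "d - n - k = d - k - n"
      "d - (n + k) = d - k - n" by simp_all
    note deg = this
    have "prod0 X (0, b) (0, c) = (0, brB X b c)" "prod1 X (0, b) (0, c) = (pairB X b c, 0)"
      by (simp_all add: prod0_def prod1_def op_zero)
    then show ?thesis
      unfolding VL_mode_swap[OF v, of "(a, 0)"] VL_mode_swap[OF v, of "(0, b)"]
      using 1 2 3 4 5 unfolding deg
      by (auto simp: VL_mode_zero_left[OF v]
          intro!: fa.subspace_add[OF subspace_VL_neg_deg])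
  qed
qed

lemma VL_neg_deg_mode:
  assumes "v \<in> VL_neg_deg X d"
  shows "VL_mode X (a, 0) n v \<in> VL_neg_deg X (d - n - 1)" "VL_mode X (0, b) n v \<in> VL_neg_deg X (d - n)"
  by (rule VL_mode_span[OF assms[unfolded VL_neg_deg_def] subspace_VL_neg_deg];
      simp add: VL_neg_monomial_mode)+

lemma VL_deg_subset_neg: "VL_deg X d \<subseteq> VL_neg_deg X d"
proof -
  have "v \<in> VL_neg_deg X d" if "VL_monomial X d v" for v
    using that
  proof (induction rule: VL_monomial.induct)
    case VL_monomial_vac
    then show ?case by (auto simp: VL_neg_deg_def intro: fa.span_base neg_vac)
  qed (auto intro: VL_neg_deg_mode)
  then show ?thesis
    unfolding VL_deg_def by (intro fa.span_minimal subspace_VL_neg_deg) auto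
qed

lemma VL_emb_deg: "VL_emb X (a, 0) \<in> VL_deg X 0" "VL_emb X (0, b) \<in> VL_deg X 1"
  using VL_monomial_A[OF VL_monomial_vac, where n = "-1"] VL_monomial_B[OF VL_monomial_vac, where n = "-1"]
  by (auto simp: VL_emb_def VL_deg_def intro!: fa.span_base)

lemma VL_mode_minus_two: "v \<in> VL X \<Longrightarrow> VL_mode X (a, 0) (-2) v = VL_mode X (0, del X a) (-1) v"
  using VL_mode_del[of v a "-1"] by simp

end

context VL_structure
begin

lemma VB_proj_eq_iff: "VB_proj X Y v = VB_proj X Y w \<longleftrightarrow> v - w \<in> IB X Y"
  unfolding VB_proj_def by (rule quot_map_eq_iff[OF vector_space_fa_scale subspace_IB])

lemma linear_VB_proj: "Vector_Spaces.linear fa_scale fa_scale (VB_proj X Y)"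
  unfolding VB_proj_def by (rule quot_map_props(1)[OF vector_space_fa_scale subspace_IB])

sublocale VB_proj: Vector_Spaces.linear fa_scale fa_scale "VB_proj X Y"
  by (rule linear_VB_proj)

abbreviation "pr \<equiv> VB_proj X Y"

lemma pr_mode:
  assumes "pr v = pr w" shows "pr (VL_mode X u n v) = pr (VL_mode X u n w)"
proof -
  have "VL_mode X u n (v - w) \<in> IB X Y" using assms by (intro IB_mode) (simp add: VB_proj_eq_iff)
  moreover have "VL_mode X u n (v - w) = VL_mode X u n v - VL_mode X u n w"
    using VL_mode_add_right[of u n "v - w" w] by simp
  ultimately show ?thesis by (simp add: VB_proj_eq_iff)
qed

lemma pr_relations:
  "pr (VL_vac X) = pr (VL_emb X (unitA X, 0))"
  "pr (VL_mode X (a, 0) (-1) (VL_emb X (a', 0))) = pr (VL_emb X (a * a', 0))"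
  "pr (VL_mode X (a, 0) (-1) (VL_emb X (0, b))) = pr (VL_emb X (0, actB X a b))"
proof -
  have "VL_emb X (unitA X, 0) - VL_vac X \<in> IB X Y"
    "VL_mode X (a, 0) (-1) (VL_emb X (a', 0)) - VL_emb X (a * a', 0) \<in> IB X Y"
    "VL_mode X (a, 0) (-1) (VL_emb X (0, b)) - VL_emb X (0, actB X a b) \<in> IB X Y"
    by (rule subsetD[OF E_in_IB]; unfold E_space_def; rule fa.span_base; blast)+
  then show "pr (VL_vac X) = pr (VL_emb X (unitA X, 0))"
    "pr (VL_mode X (a, 0) (-1) (VL_emb X (a', 0))) = pr (VL_emb X (a * a', 0))"
    "pr (VL_mode X (a, 0) (-1) (VL_emb X (0, b))) = pr (VL_emb X (0, actB X a b))"
    by (metis VB_proj_eq_iff)+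
qed

text \<open>Exchanging the two modes leaves (pi(b)(a))(-2) on the vacuum, which is del(pi(b)(a));
  the other order is one of the relations in \<open>E_space\<close>.\<close>

lemma pr_B_A:
  "pr (VL_mode X (0, b) (-1) (VL_emb X (a, 0))) =
    pr (VL_emb X (0, actB X a b + del X (anchor X b a)))"
proof -
  have "VL_mode X (0, b) (-1) (VL_emb X (a, 0)) =
      VL_mode X (a, 0) (-1) (VL_emb X (0, b)) + VL_emb X (0, del X (anchor X b a))"
    unfolding VL_emb_def VL_mode_swap[OF VL_vac_in, of "(0, b)"]
    by (simp add: VL_mode_zero_left VL_vac_in flip: VL_mode_minus_two[OF VL_vac_in])
  moreover have "VL_emb X (0, actB X a b + del X (anchor X b a)) =
      VL_emb X (0, actB X a b) + VL_emb X (0, del X (anchor X b a))"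
    using VL_emb_add[of "(0, actB X a b)" "(0, del X (anchor X b a))"] by simp
  ultimately show ?thesis by (simp add: VB_proj.add pr_relations)
qed

text \<open>In degree at most one the outermost factor, if any, is a(-1), a(-2) or b(-1). As a(-2)
  equals (del a)(-1), \<open>pr_relations\<close> and \<open>pr_B_A\<close> cover all cases.\<close>

lemma VL_neg_monomial_low:
  assumes "VL_neg_monomial X d v"
  shows "d \<ge> 0 \<and> (d = 0 \<longrightarrow> (\<exists>a. pr v = pr (VL_emb X (a, 0)))) \<and>
    (d = 1 \<longrightarrow> (\<exists>b. pr v = pr (VL_emb X (0, b))))"
  using assms
proof (induction rule: VL_neg_monomial.induct)
  case neg_vac
  show ?case using pr_relations(1) by auto
next
  case (neg_A d v n a)
  have "\<exists>b. pr (VL_mode X (a, 0) (-2) v) = pr (VL_emb X (0, b))"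
    if "pr v = pr (VL_emb X (a', 0))" for a'
  proof -
    have "v \<in> VL X" using neg_A.hyps VL_neg_monomial_in by blast
    then show ?thesis using pr_mode[OF that] by (auto simp: VL_mode_minus_two pr_B_A)
  qed
  moreover have "\<exists>a'. pr (VL_mode X (a, 0) (-1) v) = pr (VL_emb X (a', 0))"
    if "pr v = pr (VL_emb X (a', 0))" for a'
    using pr_mode[OF that] pr_relations(2) by metis
  moreover have "\<exists>b. pr (VL_mode X (a, 0) (-1) v) = pr (VL_emb X (0, b))"
    if "pr v = pr (VL_emb X (0, b))" for b
    using pr_mode[OF that] pr_relations(3) by metis
  moreover have "d - n - 1 = 0 \<longleftrightarrow> d = 0 \<and> n = -1" "d - n - 1 = 1 \<longleftrightarrow> d = 1 \<and> n = -1 \<or> d = 0 \<and> n = -2"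
    using neg_A by linarith+
  ultimately show ?case using neg_A by auto
next
  case (neg_B d v n b)
  have "\<exists>b'. pr (VL_mode X (0, b) (-1) v) = pr (VL_emb X (0, b'))"
    if "pr v = pr (VL_emb X (a', 0))" for a'
    using pr_mode[OF that] pr_B_A by metis
  moreover have "d - n \<noteq> 0" "d - n = 1 \<longleftrightarrow> d = 0 \<and> n = -1"
    using neg_B by linarith+
  ultimately show ?case using neg_B by auto
qed

lemma VB_emb_linear:
  "VB_emb X Y (u + v) = VB_emb X Y u + VB_emb X Y v" "VB_emb X Y (smC X c u) = fa_scale c (VB_emb X Y u)"
  by (simp_all add: VB_emb_def VL_emb_add VL_emb_scale VB_proj.add VB_proj.scale)

theorem VB_deg_0: "range (\<lambda>a. VB_emb X Y (a, 0)) = VB_deg X Y 0"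
proof
  show "range (\<lambda>a. VB_emb X Y (a, 0)) \<subseteq> VB_deg X Y 0"
    using VL_emb_deg(1) by (auto simp: VB_emb_def VB_deg_def)
  have S: "fa.subspace {v. \<exists>a. pr v = VB_emb X Y (a, 0)}"
  proof (rule fa.subspaceI)
    show "0 \<in> {v. \<exists>a. pr v = VB_emb X Y (a, 0)}"
      using VB_emb_linear(2)[of 0 "(0, 0)"] by (auto simp: VB_proj.zero intro!: exI[of _ 0])
    show "v + w \<in> {v. \<exists>a. pr v = VB_emb X Y (a, 0)}"
      if "v \<in> {v. \<exists>a. pr v = VB_emb X Y (a, 0)}" "w \<in> {v. \<exists>a. pr v = VB_emb X Y (a, 0)}" for v w
      using that by (auto simp: VB_proj.add simp flip: VB_emb_linear)
    show "fa_scale c v \<in> {v. \<exists>a. pr v = VB_emb X Y (a, 0)}"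
      if "v \<in> {v. \<exists>a. pr v = VB_emb X Y (a, 0)}" for c v
      using that by (auto simp: VB_proj.scale simp flip: VB_emb_linear)
  qed
  have "VL_neg_deg X 0 \<subseteq> {v. \<exists>a. pr v = VB_emb X Y (a, 0)}"
    unfolding VL_neg_deg_def using VL_neg_monomial_low[of 0]
    by (intro fa.span_minimal S) (auto simp: VB_emb_def)
  then show "VB_deg X Y 0 \<subseteq> range (\<lambda>a. VB_emb X Y (a, 0))"
    using VL_deg_subset_neg[of 0] by (auto simp: VB_deg_def)
qed

theorem VB_deg_1: "range (\<lambda>b. VB_emb X Y (0, b)) = VB_deg X Y 1"
proof
  show "range (\<lambda>b. VB_emb X Y (0, b)) \<subseteq> VB_deg X Y 1"
    using VL_emb_deg(2) by (auto simp: VB_emb_def VB_deg_def)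
  have S: "fa.subspace {v. \<exists>b. pr v = VB_emb X Y (0, b)}"
  proof (rule fa.subspaceI)
    show "0 \<in> {v. \<exists>b. pr v = VB_emb X Y (0, b)}"
      using VB_emb_linear(2)[of 0 "(0, 0)"] by (auto simp: VB_proj.zero intro!: exI[of _ 0])
    show "v + w \<in> {v. \<exists>b. pr v = VB_emb X Y (0, b)}"
      if "v \<in> {v. \<exists>b. pr v = VB_emb X Y (0, b)}" "w \<in> {v. \<exists>b. pr v = VB_emb X Y (0, b)}" for v w
      using that by (auto simp: VB_proj.add simp flip: VB_emb_linear)
    show "fa_scale c v \<in> {v. \<exists>b. pr v = VB_emb X Y (0, b)}"
      if "v \<in> {v. \<exists>b. pr v = VB_emb X Y (0, b)}" for c v
      using that by (auto simp: VB_proj.scale smC_def simp flip: VB_emb_linear)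
  qed
  have "VL_neg_deg X 1 \<subseteq> {v. \<exists>b. pr v = VB_emb X Y (0, b)}"
    unfolding VL_neg_deg_def using VL_neg_monomial_low[of 1]
    by (intro fa.span_minimal S) (auto simp: VB_emb_def)
  then show "VB_deg X Y 1 \<subseteq> range (\<lambda>b. VB_emb X Y (0, b))"
    using VL_deg_subset_neg[of 1] by (auto simp: VB_deg_def)
qed

end


section \<open>The automorphism groups\<close>

context vertex_algebroid
begin

text \<open>Automorphisms preserve both summands, hence are the maps \<open>map_prod fA fB\<close>
  for such pairs (\<open>algebroid_automorphism_iff\<close>). Composites and inverses are then
  formed componentwise.\<close>

definition algebroid_aut_pair :: "('a \<Rightarrow> 'a) \<Rightarrow> ('b \<Rightarrow> 'b) \<Rightarrow> bool" where
  "algebroid_aut_pair fA fB \<longleftrightarrow>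
    Vector_Spaces.linear (smA X) (smA X) fA \<and> Vector_Spaces.linear (smB X) (smB X) fB \<and>
    bij fA \<and> bij fB \<and>
    (\<forall>a a'. fA (a * a') = fA a * fA a') \<and>
    (\<forall>u v. fB (brB X u v) = brB X (fB u) (fB v)) \<and>
    (\<forall>a b. fB (actB X a b) = actB X (fA a) (fB b)) \<and>
    (\<forall>u v. pairB X (fB u) (fB v) = fA (pairB X u v)) \<and>
    (\<forall>a. fB (del X a) = del X (fA a)) \<and>
    (\<forall>a b. fA (anchor X b a) = anchor X (fB b) (fA a))"

lemma algebroid_automorphism_map_prod:
  "algebroid_automorphism X (map_prod fA fB) \<longleftrightarrow> algebroid_aut_pair fA fB"
proof -
  \<comment> \<open>The equations \<open>fA 0 = 0\<close> and \<open>fB 0 = 0\<close> are what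
    preservation of the two summands means for \<open>map_prod fA fB\<close>.\<close>
  have lin: "Vector_Spaces.linear (smC X) (smC X) (map_prod fA fB) \<and> fA 0 = 0 \<and> fB 0 = 0 \<longleftrightarrow>
      Vector_Spaces.linear (smA X) (smA X) fA \<and> Vector_Spaces.linear (smB X) (smB X) fB" (is "?L \<longleftrightarrow> ?R")
  proof
    assume L: ?L
    have add: "map_prod fA fB (u + v) = map_prod fA fB u + map_prod fA fB v" for u v
      using L linear_addD[of "smC X" "smC X" "map_prod fA fB"] by blast
    have scale: "map_prod fA fB (smC X c u) = smC X c (map_prod fA fB u)" for c u
      using L linear_scaleD[of "smC X" "smC X" "map_prod fA fB"] by blast
    show ?R
      using add[of "(_, 0)" "(_, 0)"] add[of "(0, _)" "(0, _)"] scale[of _ "(_, _)"]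
      by (intro conjI linear_onI A.vector_space_axioms B.vector_space_axioms) (simp_all add: smC_def)
  next
    assume R: ?R
    then show ?L
      by (intro conjI linear_onI C.vector_space_axioms)
        (auto simp: smC_def linear_addD linear_scaleD linear_zeroD plus_prod_def)
  qed
  have bij: "bij (map_prod fA fB) \<longleftrightarrow> bij fA \<and> bij fB"
  proof
    assume "bij (map_prod fA fB)"
    then have inj: "inj (map_prod fA fB)" and surj: "surj (map_prod fA fB)" by (auto simp: bij_def)
    have "inj fA" "inj fB"
      using injD[OF inj, of "(_, undefined)" "(_, undefined)"]
        injD[OF inj, of "(undefined, _)" "(undefined, _)"] by (auto intro!: injI)
    moreover have "a \<in> range fA \<and> b \<in> range fB" for a b
      using surjD[OF surj, of "(a, b)"] by (auto simp: map_prod_def)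
    then have "surj fA" "surj fB" by auto
    ultimately show "bij fA \<and> bij fB" by (simp add: bij_def)
  next
    assume "bij fA \<and> bij fB"
    then show "bij (map_prod fA fB)"
      by (simp add: bij_def prod.inj_map map_prod_surj)
  qed
  show ?thesis
    unfolding algebroid_automorphism_def algebroid_aut_pair_def
    using lin bij linear_zeroD[of "smA X" "smA X" fA] linear_zeroD[of "smB X" "smB X" fB]
    by (auto simp: Let_def)
qed

lemma algebroid_automorphism_iff:
  "algebroid_automorphism X f \<longleftrightarrow> (\<exists>fA fB. f = map_prod fA fB \<and> algebroid_aut_pair fA fB)"
proof
  assume f: "algebroid_automorphism X f"
  let ?A = "\<lambda>a. fst (f (a, 0))" and ?B = "\<lambda>b. snd (f (0, b))"
  have "f u = map_prod ?A ?B u" for u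
  proof -
    obtain a b where u: "u = (a, b)" by (cases u)
    have "f ((a, 0) + (0, b)) = f (a, 0) + f (0, b)"
      using f by (intro linear_addD) (auto simp: algebroid_automorphism_def)
    moreover have "snd (f (a, 0)) = 0" "fst (f (0, b)) = 0"
      using f by (auto simp: algebroid_automorphism_def)
    ultimately show ?thesis by (simp add: u prod_eq_iff)
  qed
  then have "f = map_prod ?A ?B" by blast
  with f show "\<exists>fA fB. f = map_prod fA fB \<and> algebroid_aut_pair fA fB"
    using algebroid_automorphism_map_prod by metis
next
  assume "\<exists>fA fB. f = map_prod fA fB \<and> algebroid_aut_pair fA fB"
  then show "algebroid_automorphism X f" using algebroid_automorphism_map_prod by blast
qed

lemma algebroid_aut_pair_comp:
  "algebroid_aut_pair fA fB \<Longrightarrow> algebroid_aut_pair gA gB \<Longrightarrow> algebroid_aut_pair (fA \<circ> gA) (fB \<circ> gB)"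
  unfolding algebroid_aut_pair_def by (auto intro: bij_comp Vector_Spaces.linear_compose)

lemma algebroid_aut_pair_id: "algebroid_aut_pair id id"
  unfolding algebroid_aut_pair_def by (auto simp: A.linear_id B.linear_id)

lemma algebroid_aut_pair_inv:
  assumes "algebroid_aut_pair fA fB"
  shows "algebroid_aut_pair (inv_into UNIV fA) (inv_into UNIV fB)"
proof -
  note f = assms[unfolded algebroid_aut_pair_def]
  have bij: "bij fA" "bij fB" using f by auto
  have cancel: "fA (inv_into UNIV fA a) = a" "inv_into UNIV fA (fA a) = a" "fB (inv_into UNIV fB b) = b" "inv_into UNIV fB (fB b) = b" for a b
    using bij by (auto simp: bij_def surj_f_inv_f inv_f_f)
  have A: "inv_into UNIV fA a = a'" if "a = fA a'" for a a' using that cancel by simp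
  have B: "inv_into UNIV fB b = b'" if "b = fB b'" for b b' using that cancel by simp
  have lin: "fA (x + y) = fA x + fA y" "fA (smA X c x) = smA X c (fA x)"
    "fB (v + w) = fB v + fB w" "fB (smB X c v) = smB X c (fB v)" for x y v w c
    using f linear_addD[of "smA X" "smA X" fA] linear_scaleD[of "smA X" "smA X" fA]
      linear_addD[of "smB X" "smB X" fB] linear_scaleD[of "smB X" "smB X" fB] by blast+
  have hom: "fA (a * a') = fA a * fA a'" "fB (brB X u v) = brB X (fB u) (fB v)"
    "fB (actB X a v) = actB X (fA a) (fB v)" "fA (pairB X u v) = pairB X (fB u) (fB v)"
    "fB (del X a) = del X (fA a)" "fA (anchor X v a) = anchor X (fB v) (fA a)" for a a' u v
    using f by auto
  show ?thesis
    unfolding algebroid_aut_pair_def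
  proof (intro conjI allI)
    show "Vector_Spaces.linear (smA X) (smA X) (inv_into UNIV fA)"
      by (intro linear_onI A.vector_space_axioms; intro A; simp add: lin cancel)
    show "Vector_Spaces.linear (smB X) (smB X) (inv_into UNIV fB)"
      by (intro linear_onI B.vector_space_axioms; intro B; simp add: lin cancel)
    show "pairB X (inv_into UNIV fB u) (inv_into UNIV fB v) = inv_into UNIV fA (pairB X u v)" for u v
      by (intro sym[OF A]) (simp add: hom cancel)
  qed ((intro bij_imp_bij_inv bij A B; simp add: hom cancel)+)
qed

lemma group_Aut_algebroid: "group (Aut_algebroid X)"
proof (rule groupI)
  fix f assume "f \<in> carrier (Aut_algebroid X)"
  then obtain fA fB where f: "f = map_prod fA fB" "algebroid_aut_pair fA fB"
    by (auto simp: Aut_algebroid_def algebroid_automorphism_iff)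
  have "map_prod (inv_into UNIV fA) (inv_into UNIV fB) \<circ> f = id"
    using f by (auto simp: fun_eq_iff algebroid_aut_pair_def bij_def)
  with algebroid_aut_pair_inv[OF f(2)] show "\<exists>g\<in>carrier (Aut_algebroid X). g \<otimes>\<^bsub>Aut_algebroid X\<^esub> f = \<one>\<^bsub>Aut_algebroid X\<^esub>"
    by (auto simp: Aut_algebroid_def algebroid_automorphism_iff intro!: exI[of _ "map_prod (inv_into UNIV fA) (inv_into UNIV fB)"])
next
  fix f g assume "f \<in> carrier (Aut_algebroid X)" "g \<in> carrier (Aut_algebroid X)"
  then obtain fA fB gA gB where "f = map_prod fA fB" "algebroid_aut_pair fA fB"
    "g = map_prod gA gB" "algebroid_aut_pair gA gB"
    by (auto simp: Aut_algebroid_def algebroid_automorphism_iff)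
  then show "f \<otimes>\<^bsub>Aut_algebroid X\<^esub> g \<in> carrier (Aut_algebroid X)"
    by (simp add: Aut_algebroid_def map_prod.comp algebroid_automorphism_map_prod algebroid_aut_pair_comp)
next
  have "algebroid_automorphism X (map_prod id id)"
    unfolding algebroid_automorphism_map_prod by (rule algebroid_aut_pair_id)
  then show "\<one>\<^bsub>Aut_algebroid X\<^esub> \<in> carrier (Aut_algebroid X)"
    by (simp add: Aut_algebroid_def map_prod.id)
qed (auto simp: Aut_algebroid_def)

end

section \<open>The operations of V_B and its group of graded automorphisms\<close>

context VL_structure
begin

lemma VB_proj_in_VL: "v \<in> VL X \<Longrightarrow> pr v \<in> VL X"
proof -
  assume v: "v \<in> VL X"
  have "pr v - v \<in> IB X Y"
    unfolding VB_proj_def by (rule quot_map_diff_in[OF vector_space_fa_scale subspace_IB])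
  then have "(pr v - v) + v \<in> VL X" using v IB_in_VL by (intro fa.subspace_add[OF subspace_VL]) auto
  then show ?thesis by simp
qed

lemma pr_idem [simp]: "pr (pr v) = pr v"
  unfolding VB_proj_def by (rule quot_map_props(2)[OF vector_space_fa_scale subspace_IB])

lemma VB_in_VL: "VB X Y \<subseteq> VL X"
  by (auto simp: VB_def VB_proj_in_VL)

lemma pr_in_VB: "v \<in> VL X \<Longrightarrow> pr v \<in> VB X Y"
  by (simp add: VB_def)

lemma subspace_VB: "fa.subspace (VB X Y)"
  unfolding VB_def by (rule VB_proj.subspace_image[OF subspace_VL])

text \<open>One argument is changed at a time; the two errors lie in I_B because the ideal is
  two-sided.\<close>

lemma pr_Y:
  assumes "u \<in> VL X" "u' \<in> VL X" "v \<in> VL X" "v' \<in> VL X" "pr u = pr u'" "pr v = pr v'"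
  shows "pr (Y u n v) = pr (Y u' n v')"
proof -
  have "Y (u - u') n v \<in> IB X Y" using assms by (intro IB_right) (simp_all add: VB_proj_eq_iff)
  moreover have "Y u' n (v - v') \<in> IB X Y" using assms by (intro IB_left) (simp_all add: VB_proj_eq_iff)
  moreover have "Y u n v = Y (u - u') n v + Y u' n v"
    using V.Y_add_left[of "u - u'" u' v n] assms fa.subspace_diff[OF subspace_VL] by simp
  moreover have "Y u' n v = Y u' n (v - v') + Y u' n v'"
    using V.Y_add_right[of u' "v - v'" v' n] assms fa.subspace_diff[OF subspace_VL] by simp
  ultimately have "Y u n v - Y u' n v' = Y (u - u') n v + Y u' n (v - v')" by simp
  then show ?thesis
    unfolding VB_proj_eq_iff
    using \<open>Y (u - u') n v \<in> IB X Y\<close> \<open>Y u' n (v - v') \<in> IB X Y\<close> fa.subspace_add[OF subspace_IB] by simp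
qed

lemma VB_op_pr: "u \<in> VL X \<Longrightarrow> v \<in> VL X \<Longrightarrow> VB_op X Y (pr u) n (pr v) = pr (Y u n v)"
  unfolding VB_op_def by (intro pr_Y) (auto intro: VB_proj_in_VL)

lemma VB_op_in: "u \<in> VB X Y \<Longrightarrow> v \<in> VB X Y \<Longrightarrow> VB_op X Y u n v \<in> VB X Y"
  unfolding VB_op_def using VB_in_VL by (auto intro!: pr_in_VB V.Y_in)

lemma VB_vac_in: "VB_vac X Y \<in> VB X Y"
  by (simp add: VB_vac_def pr_in_VB VL_vac_in)

lemma VB_emb_in: "VB_emb X Y u \<in> VB X Y"
  by (simp add: VB_emb_def pr_in_VB VL_emb_in)

lemma VB_deg_in: "VB_deg X Y n \<subseteq> VB X Y"
  using VL_deg_in by (auto simp: VB_deg_def intro!: pr_in_VB)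

lemma VB_op_emb: "v \<in> VL X \<Longrightarrow> VB_op X Y (VB_emb X Y u) n (pr v) = pr (VL_mode X u n v)"
  by (simp add: VB_emb_def VB_op_pr VL_emb_in Y_emb)

lemma VB_induct [consumes 1, case_names zero add scale vac op]:
  assumes "v \<in> VB X Y" and "P 0"
    and "\<And>v w. v \<in> VB X Y \<Longrightarrow> w \<in> VB X Y \<Longrightarrow> P v \<Longrightarrow> P w \<Longrightarrow> P (v + w)"
    and "\<And>c v. v \<in> VB X Y \<Longrightarrow> P v \<Longrightarrow> P (fa_scale c v)" and "P (VB_vac X Y)"
    and "\<And>u n v. v \<in> VB X Y \<Longrightarrow> P v \<Longrightarrow> P (VB_op X Y (VB_emb X Y u) n v)"
  shows "P v"
proof -
  have "P (pr w)" if "w \<in> VL X" for w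
    using that
    by (induction w rule: VL_induct)
      (use assms(2-) in \<open>auto simp: VB_proj.add VB_proj.zero VB_proj.scale pr_in_VB VB_vac_def
        simp flip: VB_op_emb\<close>)
  then show ?thesis using assms(1) by (auto simp: VB_def)
qed

lemma Aut_o_VB_iff:
  "g \<in> carrier (Aut_o_VB X Y) \<longleftrightarrow>
    va_automorphism fa_scale (VB X Y) (VB_vac X Y) (VB_op X Y) g \<and> (\<forall>n. g ` VB_deg X Y n = VB_deg X Y n)"
  by (simp add: Aut_o_VB_def)

context
  fixes g assumes g: "g \<in> carrier (Aut_o_VB X Y)"
begin

lemma aut_ext: "g \<in> extensional (VB X Y)" and aut_bij: "bij_betw g (VB X Y) (VB X Y)"
  and aut_add: "u \<in> VB X Y \<Longrightarrow> v \<in> VB X Y \<Longrightarrow> g (u + v) = g u + g v"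
  and aut_scale: "v \<in> VB X Y \<Longrightarrow> g (fa_scale c v) = fa_scale c (g v)"
  and aut_vac: "g (VB_vac X Y) = VB_vac X Y"
  and aut_op: "u \<in> VB X Y \<Longrightarrow> v \<in> VB X Y \<Longrightarrow> g (VB_op X Y u n v) = VB_op X Y (g u) n (g v)"
  and aut_deg: "g ` VB_deg X Y k = VB_deg X Y k"
  using g unfolding Aut_o_VB_iff va_automorphism_def by blast+

lemma aut_in: "v \<in> VB X Y \<Longrightarrow> g v \<in> VB X Y"
  using aut_bij bij_betwE by blast

lemma aut_inj: "u \<in> VB X Y \<Longrightarrow> v \<in> VB X Y \<Longrightarrow> g u = g v \<longleftrightarrow> u = v"
  using aut_bij by (auto simp: bij_betw_def inj_on_eq_iff)

end

lemma Aut_o_VB_inv: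
  assumes g: "g \<in> carrier (Aut_o_VB X Y)"
  defines "g' \<equiv> restrict (inv_into (VB X Y) g) (VB X Y)"
  shows "g' \<in> carrier (Aut_o_VB X Y)" "compose (VB X Y) g' g = restrict id (VB X Y)"
proof -
  have bij': "bij_betw g' (VB X Y) (VB X Y)"
    unfolding g'_def bij_betw_restrict_eq by (rule bij_betw_inv_into[OF aut_bij[OF g]])
  have in': "g' v \<in> VB X Y" if "v \<in> VB X Y" for v
    using bij' that bij_betwE by blast
  have gg': "g (g' v) = v" if "v \<in> VB X Y" for v
    using aut_bij[OF g] that by (simp add: g'_def bij_betw_inv_into_right)
  have g'g: "g' (g v) = v" if "v \<in> VB X Y" for v
    using aut_bij[OF g] that aut_in[OF g] by (simp add: g'_def bij_betw_inv_into_left)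
  have eq: "g' v = w" if "v = g w" "w \<in> VB X Y" for v w
    using that g'g by simp
  show "compose (VB X Y) g' g = restrict id (VB X Y)"
    by (auto simp: compose_def fun_eq_iff g'g)
  have deg: "g' ` VB_deg X Y n = VB_deg X Y n" for n
  proof -
    have "g' ` (g ` VB_deg X Y n) = VB_deg X Y n"
      using g'g VB_deg_in[of n] by (force simp: image_image subset_iff)
    then show ?thesis by (simp add: aut_deg[OF g])
  qed
  show "g' \<in> carrier (Aut_o_VB X Y)"
    unfolding Aut_o_VB_iff va_automorphism_def
  proof (intro conjI ballI allI)
    show "g' \<in> extensional (VB X Y)" by (simp add: g'_def)
    show "bij_betw g' (VB X Y) (VB X Y)" by (rule bij')
    show "g' (u + v) = g' u + g' v" if "u \<in> VB X Y" "v \<in> VB X Y" for u v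
      using that by (intro eq) (simp_all add: aut_add[OF g] in' gg' fa.subspace_add[OF subspace_VB])
    show "g' (fa_scale c v) = fa_scale c (g' v)" if "v \<in> VB X Y" for c v
      using that by (intro eq) (simp_all add: aut_scale[OF g] in' gg' fa.subspace_scale[OF subspace_VB])
    show "g' (VB_vac X Y) = VB_vac X Y"
      by (intro eq) (simp_all add: aut_vac[OF g] VB_vac_in)
    show "g' (VB_op X Y u n v) = VB_op X Y (g' u) n (g' v)" if "u \<in> VB X Y" "v \<in> VB X Y" for u v n
      using that by (intro eq) (simp_all add: aut_op[OF g] in' gg' VB_op_in)
  qed (rule deg)
qed

theorem group_Aut_o_VB: "group (Aut_o_VB X Y)"
proof (rule groupI)
  fix g h assume gh: "g \<in> carrier (Aut_o_VB X Y)" "h \<in> carrier (Aut_o_VB X Y)"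
  have comp: "compose (VB X Y) g h v = g (h v)" if "v \<in> VB X Y" for v
    using that by (simp add: compose_def)
  have "compose (VB X Y) g h \<in> carrier (Aut_o_VB X Y)"
    unfolding Aut_o_VB_iff va_automorphism_def
  proof (intro conjI ballI allI)
    show "bij_betw (compose (VB X Y) g h) (VB X Y) (VB X Y)"
      by (rule bij_betw_compose[OF aut_bij[OF gh(2)] aut_bij[OF gh(1)]])
    have "compose (VB X Y) g h ` VB_deg X Y n = g ` (h ` VB_deg X Y n)" for n
      using comp VB_deg_in[of n] by (force simp: image_image subset_iff)
    then show "compose (VB X Y) g h ` VB_deg X Y n = VB_deg X Y n" for n
      by (simp add: aut_deg gh)
  qed (use gh in \<open>auto simp: comp aut_add aut_scale aut_vac aut_op aut_in VB_vac_in VB_op_in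
      fa.subspace_add[OF subspace_VB] fa.subspace_scale[OF subspace_VB]\<close>)
  then show "g \<otimes>\<^bsub>Aut_o_VB X Y\<^esub> h \<in> carrier (Aut_o_VB X Y)" by (simp add: Aut_o_VB_def)
next
  have "restrict id (VB X Y) ` VB_deg X Y n = VB_deg X Y n" for n
    using VB_deg_in[of n] by (force simp: subset_iff)
  then have "restrict id (VB X Y) \<in> carrier (Aut_o_VB X Y)"
    unfolding Aut_o_VB_iff va_automorphism_def
    by (auto simp: VB_vac_in VB_op_in fa.subspace_add[OF subspace_VB] fa.subspace_scale[OF subspace_VB])
  then show "\<one>\<^bsub>Aut_o_VB X Y\<^esub> \<in> carrier (Aut_o_VB X Y)" by (simp add: Aut_o_VB_def)
next
  fix f g h assume "h \<in> carrier (Aut_o_VB X Y)"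
  then show "f \<otimes>\<^bsub>Aut_o_VB X Y\<^esub> g \<otimes>\<^bsub>Aut_o_VB X Y\<^esub> h = f \<otimes>\<^bsub>Aut_o_VB X Y\<^esub> (g \<otimes>\<^bsub>Aut_o_VB X Y\<^esub> h)"
    using aut_in[of h] by (auto simp: Aut_o_VB_def compose_def fun_eq_iff)
next
  fix g assume g: "g \<in> carrier (Aut_o_VB X Y)"
  show "\<one>\<^bsub>Aut_o_VB X Y\<^esub> \<otimes>\<^bsub>Aut_o_VB X Y\<^esub> g = g"
    using aut_in[OF g] aut_ext[OF g]
    by (auto simp: Aut_o_VB_def compose_def fun_eq_iff extensional_def)
  show "\<exists>g'\<in>carrier (Aut_o_VB X Y). g' \<otimes>\<^bsub>Aut_o_VB X Y\<^esub> g = \<one>\<^bsub>Aut_o_VB X Y\<^esub>"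
    using Aut_o_VB_inv(2)[OF g] by (intro bexI[OF _ Aut_o_VB_inv(1)[OF g]]) (simp add: Aut_o_VB_def)
qed

end


section \<open>Restriction to the algebroid\<close>

context vertex_algebroid
begin

lemma VL_mode_emb:
  "VL_mode X u 0 (VL_emb X v) = VL_emb X (prod0 X u v)"
  "VL_mode X u 1 (VL_emb X v) = VL_emb X (prod1 X u v)"
  unfolding VL_emb_def VL_mode_swap[OF VL_vac_in, of u]
  using VL_mode_scale_right[of v "-1" 0 0]
  by (simp_all add: VL_mode_vac)

end

context VL_structure
begin

text \<open>Every structure map of the algebroid is obtained from vertex operations on A + B, with
  del a = a_(-2) vac. This is why an automorphism of V_B restricts to one of the algebroid.\<close>

lemma VB_op_emb_emb:
  "VB_op X Y (VB_emb X Y (a, 0)) (-1) (VB_emb X Y (a', 0)) = VB_emb X Y (a * a', 0)"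
  "VB_op X Y (VB_emb X Y (a, 0)) (-1) (VB_emb X Y (0, b)) = VB_emb X Y (0, actB X a b)"
  "VB_op X Y (VB_emb X Y u) 0 (VB_emb X Y v) = VB_emb X Y (prod0 X u v)"
  "VB_op X Y (VB_emb X Y u) 1 (VB_emb X Y v) = VB_emb X Y (prod1 X u v)"
  "VB_op X Y (VB_emb X Y (a, 0)) (-2) (VB_vac X Y) = VB_emb X Y (0, del X a)"
  unfolding VB_emb_def[of X Y "(a', 0)"] VB_emb_def[of X Y "(0, b)"] VB_emb_def[of X Y v] VB_vac_def
  by (simp_all add: VB_op_emb VL_emb_in VL_vac_in pr_relations(2,3) VL_mode_emb)
    (simp_all add: VB_emb_def VL_mode_minus_two VL_vac_in VL_emb_def)

text \<open>Preservation of degrees 0 and 1 keeps \<open>g\<close> inside the range of the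
  embedding, where \<open>inv_into\<close> is a true inverse.\<close>

lemma restrict_AB_emb:
  assumes g: "g \<in> carrier (Aut_o_VB X Y)"
  shows "VB_emb X Y (restrict_AB X Y g u) = g (VB_emb X Y u)"
proof -
  have "g (VB_emb X Y (fst u, 0)) \<in> range (\<lambda>a. VB_emb X Y (a, 0))"
    "g (VB_emb X Y (0, snd u)) \<in> range (\<lambda>b. VB_emb X Y (0, b))"
    using aut_deg[OF g, of 0] aut_deg[OF g, of 1] unfolding VB_deg_0[symmetric] VB_deg_1[symmetric] by blast+
  then obtain a b where ab: "g (VB_emb X Y (fst u, 0)) = VB_emb X Y (a, 0)"
    "g (VB_emb X Y (0, snd u)) = VB_emb X Y (0, b)" by blast
  have "g (VB_emb X Y ((fst u, 0) + (0, snd u))) = g (VB_emb X Y (fst u, 0)) + g (VB_emb X Y (0, snd u))"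
    by (simp only: VB_emb_linear aut_add[OF g VB_emb_in VB_emb_in])
  then have "g (VB_emb X Y u) \<in> range (VB_emb X Y)"
    using ab by (simp flip: VB_emb_linear)
  then show ?thesis unfolding restrict_AB_def by (rule f_inv_into_f)
qed

lemma restrict_AB_automorphism:
  assumes g: "g \<in> carrier (Aut_o_VB X Y)"
  shows "algebroid_automorphism X (restrict_AB X Y g)"
proof -
  define f where "f = restrict_AB X Y g"
  note emb = restrict_AB_emb[OF g, folded f_def]
  have inj: "VB_emb X Y u = VB_emb X Y v \<longleftrightarrow> u = v" for u v
    by (rule inj_eq[OF inj_VB_emb])
  have add: "f (u + v) = f u + f v" and scale: "f (smC X c u) = smC X c (f u)" for u v c
    by (simp_all add: emb VB_emb_linear aut_add[OF g] aut_scale[OF g] VB_emb_in flip: inj)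
  have lin: "Vector_Spaces.linear (smC X) (smC X) f"
    by (intro linear_onI C.vector_space_axioms add scale)
  have ex: "\<exists>a'. f (a, 0) = (a', 0)" "\<exists>b'. f (0, b) = (0, b')"
    "\<exists>a'. f (a', 0) = (a, 0)" "\<exists>b'. f (0, b') = (0, b)" for a b
  proof -
    have A: "g ` range (\<lambda>a. VB_emb X Y (a, 0)) = range (\<lambda>a. VB_emb X Y (a, 0))"
      and B: "g ` range (\<lambda>b. VB_emb X Y (0, b)) = range (\<lambda>b. VB_emb X Y (0, b))"
      unfolding VB_deg_0 VB_deg_1 by (rule aut_deg[OF g])+
    have "g (VB_emb X Y (a, 0)) \<in> range (\<lambda>a. VB_emb X Y (a, 0))"
      "g (VB_emb X Y (0, b)) \<in> range (\<lambda>b. VB_emb X Y (0, b))" using A B by blast+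
    then show "\<exists>a'. f (a, 0) = (a', 0)" "\<exists>b'. f (0, b) = (0, b')"
      unfolding emb[symmetric] by (auto simp: inj)
    have "VB_emb X Y (a, 0) \<in> g ` range (\<lambda>a. VB_emb X Y (a, 0))"
      "VB_emb X Y (0, b) \<in> g ` range (\<lambda>b. VB_emb X Y (0, b))" unfolding A B by blast+
    then show "\<exists>a'. f (a', 0) = (a, 0)" "\<exists>b'. f (0, b') = (0, b)"
      unfolding image_image emb[symmetric] by (auto simp: inj)
  qed
  define fA fB where "fA a = fst (f (a, 0))" and "fB b = snd (f (0, b))" for a b
  have f_A: "f (a, 0) = (fA a, 0)" for a using ex(1)[of a] by (auto simp: fA_def)
  have f_B: "f (0, b) = (0, fB b)" for b using ex(2)[of b] by (auto simp: fB_def)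
  have "inj f"
    using aut_inj[OF g VB_emb_in VB_emb_in] by (intro injI) (simp flip: inj emb)
  moreover have "surj f"
  proof (rule surjI)
    fix u :: "'a \<times> 'b"
    show "f ((SOME a. f (a, 0) = (fst u, 0), 0) + (0, SOME b. f (0, b) = (0, snd u))) = u"
      unfolding add someI_ex[OF ex(3)] someI_ex[OF ex(4)] by simp
  qed
  ultimately have bij: "bij f" by (simp add: bij_def)
  \<comment> \<open>Any identity u_n v = w between embedded elements is carried over to
    \<open>f\<close>; the homomorphism conditions on products, bracket, anchor and pairing are
    instances.\<close>
  have op: "VB_emb X Y (f w) = VB_op X Y (VB_emb X Y (f u)) n (VB_emb X Y (f v))"
    if "VB_op X Y (VB_emb X Y u) n (VB_emb X Y v) = VB_emb X Y w" for u v w n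
    unfolding emb that[symmetric] by (rule aut_op[OF g VB_emb_in VB_emb_in])
  have mult: "fA (a * a') = fA a * fA a'" for a a'
    using op[OF VB_op_emb_emb(1)[of a a']] unfolding f_A VB_op_emb_emb inj by simp
  have act: "fB (actB X a b) = actB X (fA a) (fB b)" for a b
    using op[OF VB_op_emb_emb(2)[of a b]] unfolding f_A f_B VB_op_emb_emb inj by simp
  have p0: "f (prod0 X u v) = prod0 X (f u) (f v)" and p1: "f (prod1 X u v) = prod1 X (f u) (f v)" for u v
    using op[OF VB_op_emb_emb(3)[of u v]] op[OF VB_op_emb_emb(4)[of u v]]
    unfolding VB_op_emb_emb inj by simp_all
  have br: "fB (brB X b b') = brB X (fB b) (fB b')" for b b'
    using p0[of "(0, b)" "(0, b')"] by (simp add: prod0_def op_zero f_B)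
  have anc: "fA (anchor X b a) = anchor X (fB b) (fA a)" for a b
    using p0[of "(0, b)" "(a, 0)"] by (simp add: prod0_def op_zero f_A f_B)
  have pair: "fA (pairB X b b') = pairB X (fB b) (fB b')" for b b'
    using p1[of "(0, b)" "(0, b')"] by (simp add: prod1_def f_A f_B)
  have "VB_emb X Y (f (0, del X a)) = VB_emb X Y (0, del X (fA a))" for a
  proof -
    have "VB_emb X Y (f (0, del X a)) = g (VB_op X Y (VB_emb X Y (a, 0)) (-2) (VB_vac X Y))"
      by (simp only: emb VB_op_emb_emb(5))
    also have "\<dots> = VB_op X Y (g (VB_emb X Y (a, 0))) (-2) (g (VB_vac X Y))"
      by (rule aut_op[OF g VB_emb_in VB_vac_in])
    also have "\<dots> = VB_op X Y (VB_emb X Y (fA a, 0)) (-2) (VB_vac X Y)"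
      by (simp only: aut_vac[OF g] emb[symmetric] f_A)
    finally show ?thesis by (simp only: VB_op_emb_emb(5))
  qed
  then have del: "fB (del X a) = del X (fA a)" for a by (simp add: inj f_B)
  show ?thesis
    unfolding f_def[symmetric] algebroid_automorphism_def Let_def
    using lin bij by (simp add: f_A f_B mult act br anc pair del)
qed

section \<open>Lifting automorphisms of the algebroid to V_L and V_B\<close>

definition lifts :: "('a \<times> 'b \<Rightarrow> 'a \<times> 'b) \<Rightarrow>
    (('a, 'b) loop free_alg \<Rightarrow> ('a, 'b) loop free_alg) \<Rightarrow> bool" where
  "lifts f h \<longleftrightarrow> Vector_Spaces.linear fa_scale fa_scale h \<and> h (VL_vac X) = VL_vac X \<and>
    (\<forall>v. h v \<in> VL X) \<and> (\<forall>u n. \<forall>v\<in>VL X. h (VL_mode X u n v) = VL_mode X (f u) n (h v))"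

text \<open>Replacing u(n) by (f u)(n) gives another module structure on V_L, because f respects
  both products and \<open>del X\<close>. Its nonnegative modes still kill the vacuum, so
  \<open>VL_universal\<close> applies.\<close>

lemma lifts_exists:
  assumes f: "algebroid_aut_pair fA fB"
  shows "\<exists>h. lifts (map_prod fA fB) h"
proof -
  note f' = f[unfolded algebroid_aut_pair_def]
  let ?f = "map_prod fA fB"
  have "algebroid_automorphism X ?f" using f by (simp add: algebroid_automorphism_map_prod)
  then have lin: "Vector_Spaces.linear (smC X) (smC X) ?f" by (simp add: algebroid_automorphism_def)
  have zero: "fA 0 = 0" "fB 0 = 0" using f' by (auto intro: linear_zeroD)
  have diff: "fA (x - y) = fA x - fA y" for x y using f' by (auto intro: linear_diffD)
  have p0: "?f (prod0 X u v) = prod0 X (?f u) (?f v)" and p1: "?f (prod1 X u v) = prod1 X (?f u) (?f v)"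
    for u v using f' by (simp_all add: prod0_def prod1_def diff zero)
  have del: "fB (del X a) = del X (fA a)" for a using f' by blast
  interpret M: mode_module X fa_scale "VL X" "\<lambda>u. VL_mode X (?f u)"
  proof unfold_locales
    show "VL_mode X (?f (u + v)) n x = VL_mode X (?f u) n x + VL_mode X (?f v) n x" if "x \<in> VL X" for u v n x
      unfolding linear_addD[OF lin] by (rule VL_mode_add_left[OF that])
    show "VL_mode X (?f (smC X c u)) n x = fa_scale c (VL_mode X (?f u) n x)" if "x \<in> VL X" for c u n x
      unfolding linear_scaleD[OF lin] by (rule VL_mode_scale_left[OF that])
    show "VL_mode X (?f (0, del X a)) n x + fa_scale (of_int n) (VL_mode X (?f (a, 0)) (n - 1) x) = 0"
      if "x \<in> VL X" for a n x
      using VL_mode_del[OF that] by (simp add: zero del)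
    show "VL_mode X (?f u) m (VL_mode X (?f v) n x) - VL_mode X (?f v) n (VL_mode X (?f u) m x) =
        VL_mode X (?f (prod0 X u v)) (m + n) x + fa_scale (of_int m) (VL_mode X (?f (prod1 X u v)) (m + n - 1) x)"
      if "x \<in> VL X" for u m v n x
      unfolding p0 p1 by (rule VL_mode_comm[OF that])
  qed (simp_all add: subspace_VL VL_mode_in VL_mode_add_right VL_mode_scale_right)
  from M.VL_universal[OF VL_vac_in VL_mode_vac] show ?thesis unfolding lifts_def by metis
qed

lemma lifts_inverse:
  assumes "lifts f h" "lifts f' h'" "\<And>u. f' (f u) = u" "v \<in> VL X"
  shows "h' (h v) = v"
proof -
  interpret h: Vector_Spaces.linear fa_scale fa_scale h using assms(1) by (simp add: lifts_def)
  interpret h': Vector_Spaces.linear fa_scale fa_scale h' using assms(2) by (simp add: lifts_def)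
  note h = assms(1)[unfolded lifts_def] and h' = assms(2)[unfolded lifts_def]
  show ?thesis
    using assms(4)
  proof (induction v rule: VL_induct)
    case (mode u n v)
    have "h' (h (VL_mode X u n v)) = VL_mode X (f' (f u)) n (h' (h v))" using h h' mode by metis
    then show ?case using mode assms(3) by simp
  qed (use h h' in \<open>simp_all add: h.zero h'.zero h.add h'.add h.scale h'.scale\<close>)
qed

context
  fixes f h f' h'
  assumes h: "lifts f h" and h': "lifts f' h'" and f'f: "\<And>u. f' (f u) = u"
begin

interpretation h: Vector_Spaces.linear fa_scale fa_scale h using h by (simp add: lifts_def)

lemma lifts_in: "h v \<in> VL X" and lifts_vac: "h (VL_vac X) = VL_vac X"
  and lifts_mode: "v \<in> VL X \<Longrightarrow> h (VL_mode X u n v) = VL_mode X (f u) n (h v)"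
  using h unfolding lifts_def by blast+

lemma lifts_emb: "h (VL_emb X u) = VL_emb X (f u)"
  by (simp add: VL_emb_def lifts_mode lifts_vac VL_vac_in)

lemma lifts_zero_iff: "v \<in> VL X \<Longrightarrow> h v = 0 \<longleftrightarrow> v = 0"
  using lifts_inverse[OF h h' f'f, of v] lifts_inverse[OF h h' f'f, of 0] fa.subspace_0[OF subspace_VL]
  by (metis h.zero)

text \<open>As \<open>Sum_any\<close> is zero on infinite support, a linear map could fail to
  commute with it by shrinking the support to a finite set. Injectivity on \<open>VL X\<close>,
  which comes from the inverse lift \<open>h'\<close>, excludes this without an appeal to
  truncation.\<close>

lemma lifts_Sum_any:
  assumes "\<And>i. F i \<in> VL X"
  shows "h (Sum_any F) = Sum_any (\<lambda>i. h (F i))"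
  unfolding Sum_any.expand_set lifts_zero_iff[OF assms] by (rule h.sum)

text \<open>By construction \<open>h\<close> is compatible with modes only; the iterate formula
  extends this to operations of all vectors, by induction on the left argument.\<close>

lemma lifts_Y:
  assumes "u \<in> VL X" "v \<in> VL X"
  shows "h (Y u n v) = Y (h u) n (h v)"
  using assms
proof (induction u arbitrary: n v rule: VL_induct)
  case zero
  then show ?case by (simp add: h.zero lifts_in)
next
  case (add u u')
  then show ?case by (simp add: V.Y_add_left h.add lifts_in)
next
  case (scale c u)
  then show ?case by (simp add: V.Y_scale_left h.scale lifts_in)
next
  case vac
  then show ?case by (simp add: V.vacuum lifts_vac lifts_in h.zero)
next
  case (mode c k u)
  let ?F = "\<lambda>h c u v i. fa_scale ((-1) ^ i * (of_int k gchoose i))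
    (Y (VL_emb X c) (k - int i) (Y u (n + int i) v) - fa_scale ((-1) powi k) (Y u (n + k - int i) (Y (VL_emb X c) (int i) v)))"
  have "h (Y (VL_mode X c k u) n v) = h (Y (Y (VL_emb X c) k u) n v)"
    using mode by (simp add: Y_emb)
  also have "\<dots> = Sum_any (\<lambda>i. h (?F h c u v i))"
    unfolding V.iterate_formula[OF VL_emb_in mode.hyps mode.prems] using mode
    by (intro lifts_Sum_any fa.subspace_scale[OF subspace_VL] fa.subspace_diff[OF subspace_VL] V.Y_in VL_emb_in)
  also have "(\<lambda>i. h (?F h c u v i)) = ?F h (f c) (h u) (h v)"
    using mode by (simp add: fun_eq_iff h.scale h.diff Y_emb V.Y_in lifts_in lifts_mode VL_mode_in)
  also have "Sum_any \<dots> = Y (Y (VL_emb X (f c)) k (h u)) n (h v)"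
    by (rule V.iterate_formula[symmetric]) (simp_all add: VL_emb_in lifts_in)
  also have "\<dots> = Y (h (VL_mode X c k u)) n (h v)"
    using mode by (simp add: Y_emb lifts_mode lifts_in)
  finally show ?case .
qed

lemma lifts_deg: "h ` VL_deg X d \<subseteq> VL_deg X d" if f: "f = map_prod fA fB" "fA 0 = 0" "fB 0 = 0"
proof -
  have "VL_monomial X d (h v)" if "VL_monomial X d v" for d v
    using that
  proof (induction rule: VL_monomial.induct)
    case VL_monomial_vac
    show ?case by (simp add: lifts_vac VL_monomial.VL_monomial_vac)
  next
    case (VL_monomial_A d v n a)
    then show ?case
      using VL_monomial.VL_monomial_A[OF VL_monomial_A.IH, of n "fA a"]
      by (simp add: lifts_mode VL_monomial_in f(2,3), simp add: f)
  next
    case (VL_monomial_B d v n b)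
    then show ?case
      using VL_monomial.VL_monomial_B[OF VL_monomial_B.IH, of n "fB b"]
      by (simp add: lifts_mode VL_monomial_in f(2,3), simp add: f)
  qed
  then have "VL_deg X d \<subseteq> {v. h v \<in> VL_deg X d}"
    unfolding VL_deg_def
    by (intro fa.span_minimal fa.subspaceI)
      (auto simp: h.zero h.add h.scale fa.span_zero fa.span_add fa.span_scale fa.span_base)
  then show ?thesis by blast
qed

lemma lifts_IB:
  assumes f: "f = map_prod fA fB" "algebroid_aut_pair fA fB" and v: "v \<in> IB X Y"
  shows "h v \<in> IB X Y"
proof -
  note f' = f(2)[unfolded algebroid_aut_pair_def]
  have zero: "fA 0 = 0" "fB 0 = 0" using f' by (auto intro: linear_zeroD)
  \<comment> \<open>Unitality comes from surjectivity: if fA a = e, then fA(e) e = fA(e) fA(a) =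
    fA(e a) = e.\<close>
  have "fA (unitA X) = unitA X"
  proof -
    obtain a where "fA a = unitA X" using f' by (metis bij_pointE)
    then have "fA (unitA X) * unitA X = unitA X" using f' by (metis unitA)
    then show ?thesis by (simp add: unitA_right)
  qed
  note f'' = this f'
  let ?S = "{v \<in> VL X. h v \<in> IB X Y}"
  have S: "fa.subspace ?S"
    by (rule fa.subspaceI)
      (auto simp: h.zero h.add h.scale fa.subspace_0[OF subspace_VL] fa.subspace_add[OF subspace_VL]
        fa.subspace_scale[OF subspace_VL] fa.subspace_0[OF subspace_IB] fa.subspace_add[OF subspace_IB]
        fa.subspace_scale[OF subspace_IB])
  have "IB X Y \<subseteq> ?S"
  proof (rule IB_least[OF S])
    have "h (VL_emb X (unitA X, 0) - VL_vac X) \<in> IB X Y"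
      "h (VL_mode X (a, 0) (-1) (VL_emb X (a', 0)) - VL_emb X (a * a', 0)) \<in> IB X Y"
      "h (VL_mode X (a, 0) (-1) (VL_emb X (0, b)) - VL_emb X (0, actB X a b)) \<in> IB X Y" for a a' b
      using pr_relations f'' zero
      by (simp_all add: h.diff lifts_emb lifts_vac lifts_mode VL_emb_in f(1) flip: VB_proj_eq_iff)
    then show "E_space X \<subseteq> ?S"
      unfolding E_space_def
      by (intro fa.span_minimal S)
        (auto intro!: fa.subspace_diff[OF subspace_VL] VL_mode_in VL_emb_in VL_vac_in)
    show "V.D v \<in> ?S" if "v \<in> ?S" for v
      using that IB_D[of "h v"] by (simp add: V.D_in) (simp add: V.D_def lifts_Y lifts_vac VL_vac_in)
    show "VL_mode X u n v \<in> ?S" if "v \<in> ?S" for u n v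
      using that by (auto simp: VL_mode_in lifts_mode IB_mode)
  qed auto
  with v show ?thesis by blast
qed

end

theorem restrict_AB_surj:
  assumes "algebroid_automorphism X f"
  shows "\<exists>g\<in>carrier (Aut_o_VB X Y). restrict_AB X Y g = f"
proof -
  obtain fA fB where f: "f = map_prod fA fB" "algebroid_aut_pair fA fB"
    using assms algebroid_automorphism_iff by blast
  define fA' fB' where "fA' = inv_into UNIV fA" and "fB' = inv_into UNIV fB"
  have f': "algebroid_aut_pair fA' fB'"
    unfolding fA'_def fB'_def by (rule algebroid_aut_pair_inv[OF f(2)])
  have bij: "bij fA" "bij fB" using f(2) by (auto simp: algebroid_aut_pair_def)
  have inv: "map_prod fA' fB' (f u) = u" "f (map_prod fA' fB' u) = u" for u
    using bij by (cases u; simp add: f fA'_def fB'_def bij_def surj_f_inv_f)+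
  have zero: "fA 0 = 0" "fB 0 = 0" "fA' 0 = 0" "fB' 0 = 0"
    using f(2) f' by (auto simp: algebroid_aut_pair_def intro: linear_zeroD)
  obtain h h' where h: "lifts f h" and h': "lifts (map_prod fA' fB') h'"
    using lifts_exists f f' by blast
  note H = h h' inv(1) and H' = h' h inv(2)
  have lin: "Vector_Spaces.linear fa_scale fa_scale h" "Vector_Spaces.linear fa_scale fa_scale h'"
    using h h' by (auto simp: lifts_def)
  interpret h: Vector_Spaces.linear fa_scale fa_scale h by (rule lin)
  interpret h': Vector_Spaces.linear fa_scale fa_scale h' by (rule lin)
  define g where "g = restrict (\<lambda>v. pr (h v)) (VB X Y)"
  define g' where "g' = restrict (\<lambda>v. pr (h' v)) (VB X Y)"
  have g: "g (pr v) = pr (h v)" and g': "g' (pr v) = pr (h' v)" if v: "v \<in> VL X" for v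
  proof -
    \<comment> \<open>The vector and its representative differ by an element of
      \<open>IB X Y\<close>, which both lifts preserve, so the induced maps do not depend on the
      representative.\<close>
    have "pr v - v \<in> IB X Y" by (simp flip: VB_proj_eq_iff)
    then have "h (pr v - v) \<in> IB X Y" "h' (pr v - v) \<in> IB X Y"
      using lifts_IB[OF H f] lifts_IB[OF H' refl f'] by auto
    then show "g (pr v) = pr (h v)" "g' (pr v) = pr (h' v)"
      using v by (simp_all add: g_def g'_def pr_in_VB VB_proj_eq_iff h.diff h'.diff)
  qed
  have VB: "\<exists>w\<in>VL X. v = pr w" if "v \<in> VB X Y" for v using that by (auto simp: VB_def)
  have g'g: "g' (g v) = v" and gg': "g (g' v) = v" if "v \<in> VB X Y" for v
    using VB[OF that] lifts_inverse[OF H] lifts_inverse[OF H']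
    by (auto simp: g g' lifts_in[OF H] lifts_in[OF H'])
  have g_in: "g v \<in> VB X Y" "g' v \<in> VB X Y" if "v \<in> VB X Y" for v
    using VB[OF that] by (auto simp: g g' pr_in_VB lifts_in[OF H] lifts_in[OF H'])
  have deg: "g ` VB_deg X Y n \<subseteq> VB_deg X Y n" "g' ` VB_deg X Y n \<subseteq> VB_deg X Y n" for n
  proof -
    have "g (pr v) \<in> VB_deg X Y n" "g' (pr v) \<in> VB_deg X Y n" if "v \<in> VL_deg X (int n)" for v
      using that lifts_deg[OF H f(1) zero(1,2), of "int n"] lifts_deg[OF H' refl zero(3,4), of "int n"]
      by (auto simp: g g' subsetD[OF VL_deg_in] VB_deg_def)
    then show "g ` VB_deg X Y n \<subseteq> VB_deg X Y n" "g' ` VB_deg X Y n \<subseteq> VB_deg X Y n"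
      by (auto simp: VB_deg_def)
  qed
  have mem: "g \<in> carrier (Aut_o_VB X Y)"
    unfolding Aut_o_VB_iff va_automorphism_def
  proof (intro conjI allI ballI)
    show "g \<in> extensional (VB X Y)" by (simp add: g_def)
    show "bij_betw g (VB X Y) (VB X Y)"
      by (rule bij_betw_byWitness[where f' = g']) (auto simp: gg' g'g g_in)
    show "g (u + v) = g u + g v" if "u \<in> VB X Y" "v \<in> VB X Y" for u v
      using that by (simp add: g_def fa.subspace_add[OF subspace_VB] h.add VB_proj.add)
    show "g (fa_scale c v) = fa_scale c (g v)" if "v \<in> VB X Y" for c v
      using that by (simp add: g_def fa.subspace_scale[OF subspace_VB] h.scale VB_proj.scale)
    show "g (VB_vac X Y) = VB_vac X Y"
      by (simp add: VB_vac_def g VL_vac_in lifts_vac[OF H])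
    show "g (VB_op X Y u n v) = VB_op X Y (g u) n (g v)" if "u \<in> VB X Y" "v \<in> VB X Y" for u v n
      using VB[OF that(1)] VB[OF that(2)]
      by (auto simp: VB_op_pr g V.Y_in lifts_in[OF H] lifts_Y[OF H])
    show "g ` VB_deg X Y n = VB_deg X Y n" for n
    proof
      show "VB_deg X Y n \<subseteq> g ` VB_deg X Y n"
      proof
        fix v assume v: "v \<in> VB_deg X Y n"
        then have "v = g (g' v)" using gg'[of v] VB_deg_in[of n] by auto
        with v deg(2)[of n] show "v \<in> g ` VB_deg X Y n" by blast
      qed
    qed (rule deg)
  qed
  have "VB_emb X Y (restrict_AB X Y g u) = VB_emb X Y (f u)" for u
    unfolding restrict_AB_emb[OF mem] by (simp add: VB_emb_def g VL_emb_in lifts_emb[OF H])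
  then have "restrict_AB X Y g = f" by (intro ext injD[OF inj_VB_emb])
  with mem show ?thesis by blast
qed

lemma restrict_AB_inj: "inj_on (restrict_AB X Y) (carrier (Aut_o_VB X Y))"
proof (rule inj_onI)
  fix g h assume g: "g \<in> carrier (Aut_o_VB X Y)" and h: "h \<in> carrier (Aut_o_VB X Y)"
    and eq: "restrict_AB X Y g = restrict_AB X Y h"
  have emb: "g (VB_emb X Y u) = h (VB_emb X Y u)" for u
    using restrict_AB_emb[OF g, of u] restrict_AB_emb[OF h, of u] eq by simp
  have zero: "g 0 = 0" "h 0 = 0"
    using aut_scale[OF g VB_vac_in, of 0] aut_scale[OF h VB_vac_in, of 0] by simp_all
  have "g v = h v" if "v \<in> VB X Y" for v
    using that
    by (induction v rule: VB_induct)
      (simp_all add: zero aut_add[OF g] aut_add[OF h] aut_scale[OF g] aut_scale[OF h] aut_vac[OF g]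
        aut_vac[OF h] aut_op[OF g] aut_op[OF h] VB_emb_in emb)
  then show "g = h" by (rule extensionalityI[OF aut_ext[OF g] aut_ext[OF h]])
qed

lemma restrict_AB_compose:
  assumes g: "g \<in> carrier (Aut_o_VB X Y)" and h: "h \<in> carrier (Aut_o_VB X Y)"
  shows "restrict_AB X Y (compose (VB X Y) g h) = restrict_AB X Y g \<circ> restrict_AB X Y h"
proof -
  interpret group "Aut_o_VB X Y" by (rule group_Aut_o_VB)
  have gh: "compose (VB X Y) g h \<in> carrier (Aut_o_VB X Y)"
    using m_closed[OF g h] by (simp add: Aut_o_VB_def)
  have "VB_emb X Y (restrict_AB X Y (compose (VB X Y) g h) u) =
      VB_emb X Y (restrict_AB X Y g (restrict_AB X Y h u))" for u
    unfolding restrict_AB_emb[OF gh] restrict_AB_emb[OF g] restrict_AB_emb[OF h]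
    by (simp add: compose_def VB_emb_in)
  then show ?thesis by (intro ext injD[OF inj_VB_emb]) simp
qed

theorem restrict_AB_iso: "restrict_AB X Y \<in> iso (Aut_o_VB X Y) (Aut_algebroid X)"
proof (rule isoI)
  have mem: "restrict_AB X Y g \<in> carrier (Aut_algebroid X)" if "g \<in> carrier (Aut_o_VB X Y)" for g
    using restrict_AB_automorphism[OF that] by (simp add: Aut_algebroid_def)
  then show "restrict_AB X Y \<in> hom (Aut_o_VB X Y) (Aut_algebroid X)"
    using restrict_AB_compose by (auto simp: hom_def Aut_o_VB_def Aut_algebroid_def)
  show "bij_betw (restrict_AB X Y) (carrier (Aut_o_VB X Y)) (carrier (Aut_algebroid X))"
    unfolding bij_betw_def
  proof
    show "restrict_AB X Y ` carrier (Aut_o_VB X Y) = carrier (Aut_algebroid X)"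
      using mem restrict_AB_surj by (fastforce simp: Aut_algebroid_def)
  qed (rule restrict_AB_inj)
qed

end

theorem theorem2p17:
  fixes X :: "('a::comm_ring, 'b::ab_group_add) algebroid"
    and Y :: "('a, 'b) loop free_alg \<Rightarrow> int \<Rightarrow> ('a, 'b) loop free_alg \<Rightarrow> ('a, 'b) loop free_alg"
  assumes "vertex_algebroid X"
    and "VL_vertex_structure X Y"
  shows "inj (VB_emb X Y)
    \<and> range (\<lambda>a. VB_emb X Y (a, 0)) = VB_deg X Y 0
    \<and> range (\<lambda>b. VB_emb X Y (0, b)) = VB_deg X Y 1
    \<and> group (Aut_o_VB X Y)
    \<and> group (Aut_algebroid X)
    \<and> restrict_AB X Y \<in> iso (Aut_o_VB X Y) (Aut_algebroid X)"
proof -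
  interpret VL_structure X Y
    using assms by (simp add: VL_structure_def VL_structure_axioms_def)
  show ?thesis
    using inj_VB_emb VB_deg_0 VB_deg_1 group_Aut_o_VB group_Aut_algebroid restrict_AB_iso by blast
qed

end
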